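(* For real $x>1/6$ let $$f_{15}(x)=\frac{(74x^2-47x+8)\,\Gamma(6x-1)\,\Gamma(x)^9}{32\,\Gamma(3x)\,\Gamma(2x)^6}.$$ Then the following series converge and $$\sum_{k=1}^\infty f_{15}'(k)=-18\zeta(3),\qquad \sum_{k=1}^\infty f_{15}''(k)=18\zeta(4),\qquad \sum_{k=1}^\infty f_{15}'''(k)=36\big(35\zeta(5)-3\pi^2\zeta(3)\big),$$ $$\sum_{k=1}^\infty f_{15}^{(4)}(k)=36\big(300\zeta(3)^2-437\zeta(6)\big),\qquad \frac1{2160}\sum_{k=1}^\infty f_{15}^{(5)}(k)=305\zeta(7)+70\zeta(2)\zeta(5)-327\zeta(3)\zeta(4),$$ $$\frac1{540}\sum_{k=1}^\infty f_{15}^{(6)}(k)=600\pi^2\zeta(3)^2+9856\zeta(5,3)+35280\zeta(3)\zeta(5)-52735\zeta(8),$$ $$\frac1{5040}\sum_{k=1}^\infty f_{15}^{(7)}(k)=116890\zeta(9)-7500\zeta(3)^3-192789\zeta(3)\zeta(6)+68670\zeta(4)\zeta(5)+32940\zeta(2)\zeta(7).$$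
   Context: $\Gamma$ is Euler's gamma function and $f^{(m)}$ (also $f',f'',f'''$) is the $m$-th derivative with respect to $x$. $\zeta(s)=\sum_{n\ge1}n^{-s}$ is the Riemann zeta function and $\zeta(5,3)=\sum_{k_1>k_2>0}\frac{1}{k_1^5k_2^3}$. Note $f_{15}(k)=\frac{(74k^2-47k+8)\binom{6k}{3k}\binom{3k}{k}}{(6k-1)k^3\binom{2k}{k}^5}$ for positive integers $k$. *)

theory Defs
  imports "HOL-Analysis.Analysis"
begin

text \<open>Only meaningful for real arguments \<open>s > 1\<close>, where the series converges.\<close>

definition zeta :: "real \<Rightarrow> real" where
  "zeta s = (\<Sum>n. 1 / real (Suc n) powr s)"

definition double_zeta :: "nat \<Rightarrow> nat \<Rightarrow> real" where
  "double_zeta a b =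
     (\<Sum>\<^sub>\<infinity>(k1, k2)\<in>{(k1, k2). 0 < k2 \<and> k2 < k1}. 1 / (real k1 ^ a * real k2 ^ b))"

text \<open>At positive integers \<open>k\<close> this is
  \<open>(74k\<^sup>2 - 47k + 8) (6k choose 3k) (3k choose k) / ((6k - 1) k\<^sup>3 (2k choose k)\<^sup>5)\<close>.
  The intended domain is \<open>x > 1/6\<close>.  Since it is open, derivatives at positive integers
  are unaffected by the values elsewhere.\<close>

definition f15 :: "real \<Rightarrow> real" where
  "f15 x = (74 * x\<^sup>2 - 47 * x + 8) * Gamma (6 * x - 1) * Gamma x ^ 9 /
           (32 * Gamma (3 * x) * Gamma (2 * x) ^ 6)"

end

theory Submission
  imports Defs "HOL-Complex_Analysis.Complex_Analysis" "HOL-Real_Asymp.Real_Asymp"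
begin

text \<open>The summand continues to a holomorphic function \<open>fc\<close>, and the series in question are the
  derivatives at \<open>0\<close> of \<open>S z = (\<Sum>k. fc (z + 1 + k))\<close>. A WZ pair relates \<open>fc\<close> to the well-poised sum
  \<open>V z = (\<Sum>n. n / (n - z)\<^sup>3 * (\<Prod>0<j<n. ((j + z) / (j - z))\<^sup>3))\<close>: with the prefactor
  \<open>P z = \<Gamma>(1+6z) \<Gamma>(1+z)\<^sup>9 / (\<Gamma>(1+3z) \<Gamma>(1+2z)\<^sup>6)\<close>, the function \<open>G = P * (48 V + 9/z\<^sup>2)\<close> satisfies the same
  difference equation \<open>G z = fc (z + 1) + G (z + 1)\<close> as \<open>S\<close>. So \<open>S - G\<close> is periodic with moderate
  growth and a few known poles, hence an explicit trigonometric function up to a constant, and all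
  Taylor coefficients of \<open>S\<close> beyond the constant one can be read off. Those of \<open>P\<close> are polynomials in zeta
  values. Those of \<open>V\<close> are combinations of multiple zeta values, which are reduced to zeta values
  and \<open>\<zeta>(5,3)\<close> by integer combinations of regularised double shuffle relations.\<close>

section \<open>Multiple harmonic sums and the double shuffle relations\<close>

text \<open>The obstacle is convergence. The difference equation compares z with z + 1, but the
  series for \<open>V\<close> stops converging at Re z = 1/6 and \<open>S\<close> is estimated only
  for Re z >= -3/4. Summation by parts continues \<open>V\<close> to Re z < 1/3, just enough for a
  common strip slightly wider than one period. The equation is proved only in the narrow range where
  z and z + 1 both lie in that strip. In the strip all functions grow at most polynomially in |Im
  z|, away from their poles, whereas a nonconstant 1-periodic entire function grows exponentially.
  The poles of \<open>G\<close> are at 0, 1/6 and -1/6, and an explicit trigonometric function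
  cancels them. The remaining constant is never determined, which is why only derivatives of order
  at least 1 are evaluated. The term 9/z^2 is the coboundary that turns the boundary term of the WZ
  telescoping into the rational factor of \<open>fc\<close>. No regularised values of divergent
  words are ever formed: each relation is used as an identity between truncated sums whose defect
  tends to 0, so that a relation between limits reduces to a finite formal identity of words,
  checked by evaluation.\<close>

fun hsum :: "nat list \<Rightarrow> nat \<Rightarrow> real" where
  "hsum [] n = 1"
| "hsum (k # ks) n = (\<Sum>m<n. hsum ks m / real m ^ k)"

fun stuffle :: "nat list \<Rightarrow> nat list \<Rightarrow> nat list list" where
  "stuffle [] v = [v]"
| "stuffle (a # u) [] = [a # u]"
| "stuffle (a # u) (b # v) = map ((#) a) (stuffle u (b # v)) @ map ((#) b) (stuffle (a # u) v)
     @ map ((#) (a + b)) (stuffle u v)"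

lemma hsum_0: "hsum (k # ks) 0 = 0"
  and hsum_Suc: "hsum (k # ks) (Suc n) = hsum (k # ks) n + hsum ks n / real n ^ k"
  by simp_all

lemma hsum_nonneg: "hsum w n \<ge> 0"
  by (induction w arbitrary: n) (auto intro!: sum_nonneg)

lemma hsum_mono: "m \<le> n \<Longrightarrow> hsum w m \<le> hsum w n"
  by (cases w) (auto intro!: sum_mono2 simp: hsum_nonneg)

lemma sum_list_hsum_Cons:
  "(\<Sum>w\<leftarrow>map ((#) a) ws. hsum w n) = (\<Sum>m<n. (\<Sum>w\<leftarrow>ws. hsum w m) / real m ^ a)"
  by (induction ws) (auto simp: sum.distrib add_divide_distrib)

text \<open>Exact at every truncation \<open>n\<close>, hence valid for divergent words too. When
  \<open>n\<close> grows by one, a product of two sums changes by two mixed terms and by the product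
  of the increments; these are the three branches of \<open>stuffle\<close>.\<close>

lemma hsum_stuffle: "(\<Sum>w\<leftarrow>stuffle u v. hsum w n) = hsum u n * hsum v n"
proof (induction u v arbitrary: n rule: stuffle.induct)
  case (3 a u b v)
  let ?F = "hsum (a # u)" and ?G = "hsum (b # v)"
  have "(\<Sum>m<n. hsum u m * ?G m / real m ^ a) + ((\<Sum>m<n. ?F m * hsum v m / real m ^ b)
          + (\<Sum>m<n. hsum u m * hsum v m / real m ^ (a + b))) = ?F n * ?G n"
    by (induction n) (simp_all del: hsum.simps(2) add: hsum_0 hsum_Suc,
      simp add: algebra_simps power_add)
  thus ?case
    by (simp only: stuffle.simps map_append sum_list_append sum_list_hsum_Cons "3.IH")
qed simp_all

section \<open>The shuffle product through generating series of polylogarithms\<close>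

fun binshuffle :: "bool list \<Rightarrow> bool list \<Rightarrow> bool list list" where
  "binshuffle [] v = [v]"
| "binshuffle (a # u) [] = [a # u]"
| "binshuffle (a # u) (b # v) =
     map ((#) a) (binshuffle u (b # v)) @ map ((#) b) (binshuffle (a # u) v)"

text \<open>Coding of a zeta word as an iterated integral: an exponent k stands for k - 1 forms dt/t
  followed by one form dt/(1-t).\<close>

fun binword :: "nat list \<Rightarrow> bool list" where
  "binword [] = []"
| "binword (k # ks) = replicate (k - 1) False @ True # binword ks"

fun unbin :: "nat \<Rightarrow> bool list \<Rightarrow> nat list" where
  "unbin k [] = []"
| "unbin k (True # w) = Suc k # unbin 0 w"
| "unbin k (False # w) = unbin (Suc k) w"

text \<open>The power series of the multiple polylogarithm attached to a word; \<open>False\<close> and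
  \<open>True\<close> stand for the forms \<open>dt/t\<close> and \<open>dt/(1-t)\<close>.\<close>

definition polylog_step :: "bool \<Rightarrow> real fps \<Rightarrow> real fps" where
  "polylog_step b f = Abs_fps (\<lambda>n. (if b then \<Sum>m<n. fps_nth f m else fps_nth f n) / real n)"

fun polylog :: "bool list \<Rightarrow> real fps" where
  "polylog [] = 1"
| "polylog (b # w) = polylog_step b (polylog w)"

text \<open>Words whose innermost form is dt/(1-t). For these the iterated integral from 0 has no
  logarithms and is a power series.\<close>

definition finword :: "bool list \<Rightarrow> bool" where
  "finword w \<longleftrightarrow> (w = [] \<or> last w)"

text \<open>The two forms divided by dt/t, namely 1 and t/(1-t), to be used with the Euler operator
  t d/dt.\<close>

definition geom_form :: "bool \<Rightarrow> real fps" where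
  "geom_form b = (if b then Abs_fps (\<lambda>n. if n = 0 then 0 else 1) else 1)"

lemma fps_nth_geom_form: "fps_nth (f * geom_form True) n = (\<Sum>m<n. fps_nth f m)"
proof -
  have "fps_nth (f * geom_form True) n = (\<Sum>m\<le>n. fps_nth f m * (if n - m = 0 then 0 else 1))"
    by (simp add: fps_mult_nth geom_form_def atLeast0AtMost)
  also have "\<dots> = (\<Sum>m<n. fps_nth f m * (if n - m = 0 then 0 else 1))"
    by (rule sum.mono_neutral_right) (auto simp: not_less)
  finally show ?thesis by (simp cong: sum.cong_simp)
qed

text \<open>The hypothesis rules out a constant term under dt/t, whose primitive would be a
  logarithm.\<close>

lemma deriv_polylog_step:
  assumes "b \<or> fps_nth f 0 = 0"
  shows "fps_X * fps_deriv (polylog_step b f) = geom_form b * f"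
proof (rule fps_ext)
  fix n
  show "fps_nth (fps_X * fps_deriv (polylog_step b f)) n = fps_nth (geom_form b * f) n"
  proof (cases b)
    case True
    thus ?thesis
      by (cases n) (simp_all only: mult.commute[of "geom_form _"] True fps_nth_geom_form,
        simp_all add: polylog_step_def del: of_nat_Suc)
  next
    case False
    thus ?thesis using assms
      by (cases n) (simp_all add: geom_form_def polylog_step_def del: of_nat_Suc)
  qed
qed

lemma polylog_nth_0: "w \<noteq> [] \<Longrightarrow> fps_nth (polylog w) 0 = 0"
  by (cases w) (auto simp: polylog_step_def)

lemma sum_list_polylog_step:
  "(\<Sum>w\<leftarrow>map ((#) b) ws. polylog w) = polylog_step b (\<Sum>w\<leftarrow>ws. polylog w)"
proof (induction ws)
  case Nil
  show ?case by (rule fps_ext) (simp add: polylog_step_def)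
next
  case (Cons w ws)
  have "polylog_step b (f + g) = polylog_step b f + polylog_step b g" for f g
    by (rule fps_ext) (simp add: polylog_step_def sum.distrib add_divide_distrib)
  thus ?case using Cons by simp
qed

lemma fps_theta_eqI:
  fixes f g :: "real fps"
  assumes "fps_X * fps_deriv f = fps_X * fps_deriv g" "fps_nth f 0 = fps_nth g 0"
  shows "f = g"
proof (rule fps_ext)
  fix n
  show "fps_nth f n = fps_nth g n"
  proof (cases n)
    case (Suc m)
    have "fps_nth (fps_X * fps_deriv f) n = fps_nth (fps_X * fps_deriv g) n"
      using assms by simp
    thus ?thesis using Suc by (simp del: of_nat_Suc)
  qed (use assms in simp)
qed

text \<open>Integration by parts: both sides vanish at 0 and have the same image under the Euler
  operator, because the product rule reproduces the two branches of
  \<open>binshuffle\<close>.\<close>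

lemma polylog_shuffle:
  assumes "finword u" "finword v"
  shows "(\<Sum>w\<leftarrow>binshuffle u v. polylog w) = polylog u * polylog v"
  using assms
proof (induction u v rule: binshuffle.induct)
  case (3 a u b v)
  have fin: "finword u" "finword v"
    using "3.prems" by (auto simp: finword_def split: if_splits)
  have a: "a \<or> fps_nth (polylog u) 0 = 0" and b: "b \<or> fps_nth (polylog v) 0 = 0"
    using "3.prems" by (auto simp: finword_def polylog_nth_0 split: if_splits)
  have a': "a \<or> fps_nth (polylog u * polylog (b # v)) 0 = 0"
    and b': "b \<or> fps_nth (polylog (a # u) * polylog v) 0 = 0"
    using a b by auto
  let ?L = "polylog_step a (polylog u * polylog (b # v)) + polylog_step b (polylog (a # u) * polylog v)"
  have "?L = polylog (a # u) * polylog (b # v)"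
  proof (rule fps_theta_eqI)
    show "fps_X * fps_deriv ?L = fps_X * fps_deriv (polylog (a # u) * polylog (b # v))"
    proof -
      have "fps_X * fps_deriv ?L = geom_form a * (polylog u * polylog (b # v))
              + geom_form b * (polylog (a # u) * polylog v)"
        by (simp only: fps_deriv_add distrib_left deriv_polylog_step[OF a'] deriv_polylog_step[OF b'])
      also have "\<dots> = (fps_X * fps_deriv (polylog (a # u))) * polylog (b # v)
              + polylog (a # u) * (fps_X * fps_deriv (polylog (b # v)))"
        by (simp only: polylog.simps deriv_polylog_step[OF a] deriv_polylog_step[OF b] mult.assoc
            mult.left_commute)
      finally show ?thesis
        by (simp only: fps_deriv_mult distrib_left mult_ac add.commute)
    qed
    show "fps_nth ?L 0 = fps_nth (polylog (a # u) * polylog (b # v)) 0"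
      by (simp add: polylog_step_def)
  qed
  thus ?case
    using "3.IH" "3.prems" fin by (simp add: sum_list_polylog_step del: map_map polylog.simps)
qed simp_all

lemma polylog_nth_replicate:
  "fps_nth (polylog (replicate j False @ w)) n = fps_nth (polylog w) n / real n ^ j"
  by (induction j) (auto simp: polylog_step_def)

text \<open>Truncated zeta sums are partial sums of the coefficients, not the coefficients
  themselves. At n = 0 this would fail for the empty word, where \<open>hsum [] 0\<close> is
  1.\<close>

lemma sum_polylog_binword:
  assumes "0 \<notin> set ks" "n > 0"
  shows "(\<Sum>m<n. fps_nth (polylog (binword ks)) m) = hsum ks n"
  using assms
proof (induction ks arbitrary: n)
  case Nil
  thus ?case by (cases n) (simp_all add: sum.lessThan_Suc_shift del: sum.lessThan_Suc)
next
  case (Cons k ks)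
  have "fps_nth (polylog (binword (k # ks))) m = hsum ks m / real m ^ k" for m
  proof (cases "m = 0")
    case True
    thus ?thesis using Cons.prems by (simp add: polylog_nth_0)
  next
    case False
    obtain j where j: "k = Suc j" using Cons.prems by (cases k) auto
    have "fps_nth (polylog (binword (k # ks))) m
            = (\<Sum>i<m. fps_nth (polylog (binword ks)) i) / real m / real m ^ j"
      by (simp add: polylog_nth_replicate polylog_step_def j)
    also have "\<dots> = hsum ks m / real m ^ k"
      using Cons.IH[of m] Cons.prems False by (simp add: j)
    finally show ?thesis .
  qed
  thus ?case by simp
qed

lemma polylog_binword_nth:
  assumes "0 \<notin> set (k # ks)"
  shows "fps_nth (polylog (binword (k # ks))) m = hsum ks m / real m ^ k"
proof -
  have "(\<Sum>i<Suc m. fps_nth (polylog (binword (k # ks))) i) = hsum (k # ks) (Suc m)"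
    using assms by (intro sum_polylog_binword) auto
  moreover have "(\<Sum>i<m. fps_nth (polylog (binword (k # ks))) i) = hsum (k # ks) m"
    using sum_polylog_binword[of "k # ks" m] assms by (cases m) auto
  ultimately show ?thesis by simp
qed

lemma binword_unbin: "finword w \<Longrightarrow> (w = [] \<longrightarrow> k = 0) \<Longrightarrow> binword (unbin k w) = replicate k False @ w"
proof (induction k w rule: unbin.induct)
  case (2 k w)
  thus ?case by (auto simp: finword_def split: if_splits)
next
  case (3 k w)
  thus ?case by (auto simp: finword_def replicate_append_same split: if_splits)
qed auto

lemma zero_notin_unbin: "0 \<notin> set (unbin k w)"
  by (induction k w rule: unbin.induct) auto

lemma finword_binshuffle: "finword u \<Longrightarrow> finword v \<Longrightarrow> w \<in> set (binshuffle u v) \<Longrightarrow> finword w"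
proof (induction u v arbitrary: w rule: binshuffle.induct)
  case (3 a u b v)
  have fin: "finword u" "finword v"
    using "3.prems" by (auto simp: finword_def split: if_splits)
  have ne: "w \<noteq> []" if "w \<in> set (binshuffle u v)" "u \<noteq> [] \<or> v \<noteq> []" for u v w
    using that by (cases u; cases v) auto
  have cons: "finword (c # w')" if "finword w'" "w' \<noteq> []" for c w'
    using that by (simp add: finword_def)
  from "3.prems"(3) consider w' where "w = a # w'" "w' \<in> set (binshuffle u (b # v))"
    | w' where "w = b # w'" "w' \<in> set (binshuffle (a # u) v)" by auto
  thus ?case
  proof cases
    case 1
    thus ?thesis using "3.IH"(1)[OF fin(1) "3.prems"(2)] ne[OF 1(2)] cons by blast
  next
    case 2
    thus ?thesis using "3.IH"(2)[OF "3.prems"(1) fin(2)] ne[OF 2(2)] cons by blast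
  qed
qed auto

lemma finword_binword: "finword (binword ks)"
  by (induction ks) (auto simp: finword_def)

definition shuffle :: "nat list \<Rightarrow> nat list \<Rightarrow> nat list list" where
  "shuffle u v = map (unbin 0) (binshuffle (binword u) (binword v))"

text \<open>Unlike the stuffle product, the shuffle product is not exact at level \<open>n\<close>:
  it gives the truncated Cauchy product, a sum over i + j < n, in place of the product of two
  truncations.\<close>

lemma sum_hsum_shuffle:
  assumes "n > 0"
  shows "(\<Sum>w\<leftarrow>shuffle u v. hsum w n)
           = (\<Sum>m<n. fps_nth (polylog (binword u) * polylog (binword v)) m)"
proof -
  have eq: "(\<Sum>w\<leftarrow>ws. \<Sum>m<n. fps_nth (polylog w) m) = (\<Sum>m<n. fps_nth (\<Sum>w\<leftarrow>ws. polylog w) m)" for ws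
    by (induction ws) (auto simp: sum.distrib)
  have "(\<Sum>w\<leftarrow>shuffle u v. hsum w n)
      = (\<Sum>w\<leftarrow>binshuffle (binword u) (binword v). \<Sum>m<n. fps_nth (polylog w) m)"
    unfolding shuffle_def map_map o_def
  proof (intro arg_cong[of _ _ sum_list] map_cong refl)
    fix w assume "w \<in> set (binshuffle (binword u) (binword v))"
    hence "finword w" using finword_binshuffle finword_binword by blast
    thus "hsum (unbin 0 w) n = (\<Sum>m<n. fps_nth (polylog w) m)"
      using sum_polylog_binword[OF zero_notin_unbin assms, of 0 w] binword_unbin[of w 0] by simp
  qed
  also have "\<dots> = (\<Sum>m<n. fps_nth (\<Sum>w\<leftarrow>binshuffle (binword u) (binword v). polylog w) m)"
    by (rule eq)
  finally show ?thesis by (simp add: polylog_shuffle finword_binword)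
qed

lemma sum_fps_mult_nth:
  fixes f g :: "real fps"
  shows "(\<Sum>m<n. fps_nth (f * g) m) = (\<Sum>j<n. fps_nth g j * (\<Sum>i<n - j. fps_nth f i))"
proof -
  have "(\<Sum>m<n. fps_nth (f * g) m) = (\<Sum>m<n. \<Sum>j\<le>m. fps_nth g j * fps_nth f (m - j))"
    by (subst mult.commute) (simp add: fps_mult_nth atLeast0AtMost)
  also have "\<dots> = (\<Sum>(m, j)\<in>(SIGMA m:{..<n}. {..m}). fps_nth g j * fps_nth f (m - j))"
    by (simp add: sum.Sigma)
  also have "\<dots> = (\<Sum>(j, i)\<in>(SIGMA j:{..<n}. {..<n - j}). fps_nth g j * fps_nth f i)"
    by (rule sum.reindex_bij_witness[of _ "\<lambda>(j, i). (i + j, j)" "\<lambda>(m, j). (j, m - j)"]) auto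
  also have "\<dots> = (\<Sum>j<n. fps_nth g j * (\<Sum>i<n - j. fps_nth f i))"
    by (simp add: sum.Sigma sum_distrib_left)
  finally show ?thesis .
qed

section \<open>Logarithmic growth of truncated sums and convergence\<close>

lemma hsum_le_power: "0 \<notin> set ks \<Longrightarrow> hsum ks n \<le> hsum [1] n ^ length ks"
proof (induction ks arbitrary: n)
  case (Cons k ks)
  have "hsum ks m / real m ^ k \<le> hsum [1] n ^ length ks * (1 / real m)" if "m < n" for m
  \<comment> \<open>At m = 0 an exponent k >= 1 gives a division by 0, hence the value 0. For k = 0
    it would be a division by 0 ^ 0 = 1, whence the hypothesis on the word.\<close>
  proof (cases "m = 0")
    case False
    have "hsum ks m \<le> hsum [1] n ^ length ks"
      using Cons.IH[of m] Cons.prems hsum_mono[of m n "[1]"] that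
      by (meson hsum_nonneg less_imp_le list.set_intros(2) order_trans power_mono)
    moreover have "real m \<le> real m ^ k"
      using False Cons.prems by (intro self_le_power) auto
    ultimately have "hsum ks m / real m ^ k \<le> hsum [1] n ^ length ks / real m"
      using False by (intro frac_le) (auto simp: hsum_nonneg simp del: hsum.simps)
    thus ?thesis by simp
  qed (use Cons.prems in \<open>simp add: power_0_left\<close>)
  hence "hsum (k # ks) n \<le> (\<Sum>m<n. hsum [1] n ^ length ks * (1 / real m))"
    unfolding hsum.simps(2) by (intro sum_mono) auto
  also have "\<dots> = hsum [1] n ^ length (k # ks)"
    by (simp only: sum_distrib_left[symmetric]) simp
  finally show ?case .
qed simp

lemma harmonic_le_ln: "n \<ge> 1 \<Longrightarrow> hsum [1] (Suc n) \<le> 1 + ln (real n)"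
proof (induction n rule: nat_induct_at_least)
  case (Suc n)
  have "ln (real n / real (Suc n)) \<le> real n / real (Suc n) - 1"
    using Suc.hyps by (intro ln_le_minus_one) auto
  hence "1 / real (Suc n) \<le> ln (real (Suc n)) - ln (real n)"
    using Suc.hyps by (simp add: ln_div field_simps)
  thus ?case using Suc.IH by (simp del: of_nat_Suc)
qed simp

lemma harmonic_ge_1: "n \<ge> 1 \<Longrightarrow> hsum [1] (Suc n) \<ge> 1"
  using hsum_mono[of 2 "Suc n" "[1]"] by (simp add: numeral_2_eq_2)

text \<open>The extra harmonic factor is what the dominated convergence in
  \<open>double_shuffle\<close> needs: it majorises the truncation defect of a product with the
  divergent word [1].\<close>

lemma summable_hsum:
  assumes "0 \<notin> set ks" "k \<ge> 2"
  shows "summable (\<lambda>n. hsum ks n / real n ^ k * hsum [1] (Suc n))"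
proof (rule summable_comparison_test')
  define r where "r = Suc (length ks)"
  \<comment> \<open>With this exponent the r harmonic factors together contribute at most a constant
    times n^(1/2), which against n^2 leaves n^(-3/2).\<close>
  define a where "a = 1 / (2 * real r)"
  have a: "a > 0" "a * real r = 1 / 2" by (auto simp: a_def r_def)
  show "summable (\<lambda>n. (1 + 1 / a) ^ r * (real n powr (- 3 / 2)))"
    by (intro summable_mult) (simp add: summable_real_powr_iff)
  fix n :: nat
  assume n: "n \<ge> 1"
  let ?h = "hsum [1] (Suc n)"
  have "?h \<le> 1 + ln (real n)" using harmonic_le_ln[OF n] .
  also have "\<dots> \<le> real n powr a + real n powr a / a"
    using n a ln_powr_bound[of "real n" a] ge_one_powr_ge_zero[of "real n" a] by simp
  finally have h: "?h \<le> (1 + 1 / a) * real n powr a" by (simp add: algebra_simps)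
  have "hsum ks n \<le> hsum ks (Suc n)" by (intro hsum_mono) simp
  also have "\<dots> \<le> ?h ^ length ks" using assms by (intro hsum_le_power)
  finally have "hsum ks n * ?h \<le> ?h ^ r"
    unfolding r_def power_Suc mult.commute[of ?h] by (intro mult_right_mono hsum_nonneg)
  also have "\<dots> \<le> ((1 + 1 / a) * real n powr a) ^ r"
    by (intro power_mono h hsum_nonneg)
  also have "\<dots> = (1 + 1 / a) ^ r * real n powr (1 / 2)"
    using n by (simp add: power_mult_distrib powr_powr a(2) flip: powr_realpow)
  finally have *: "hsum ks n * ?h \<le> (1 + 1 / a) ^ r * real n powr (1 / 2)" .
  have "hsum ks n / real n ^ k * ?h = (hsum ks n * ?h) / real n ^ k" by simp
  also have "\<dots> \<le> (hsum ks n * ?h) / real n ^ 2"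
    using n assms by (intro divide_left_mono power_increasing) (auto simp: hsum_nonneg simp del: hsum.simps)
  also have "\<dots> \<le> (1 + 1 / a) ^ r * real n powr (1 / 2) / real n ^ 2"
    by (intro divide_right_mono *) auto
  also have "real n ^ 2 = real n powr 2" using n by simp
  also have "(1 + 1 / a) ^ r * real n powr (1 / 2) / real n powr 2
               = (1 + 1 / a) ^ r * (real n powr (- 3 / 2))"
    by (simp only: times_divide_eq_right[symmetric] powr_diff[symmetric]) simp
  finally show "norm (hsum ks n / real n ^ k * ?h) \<le> (1 + 1 / a) ^ r * (real n powr (- 3 / 2))"
    by (simp add: hsum_nonneg del: hsum.simps)
qed

lemma summable_hsum':
  assumes "0 \<notin> set ks" "k \<ge> 2"
  shows "summable (\<lambda>n. hsum ks n / real n ^ k)"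
proof (rule summable_comparison_test'[OF summable_hsum[OF assms]])
  fix n :: nat assume n: "n \<ge> 1"
  have "hsum ks n / real n ^ k * 1 \<le> hsum ks n / real n ^ k * hsum [1] (Suc n)"
    using harmonic_ge_1[OF n] by (intro mult_left_mono) (auto simp: hsum_nonneg)
  thus "norm (hsum ks n / real n ^ k) \<le> hsum ks n / real n ^ k * hsum [1] (Suc n)"
    by (simp add: hsum_nonneg)
qed

definition mzv :: "nat list \<Rightarrow> real" where
  "mzv w = lim (hsum w)"

definition admissible :: "nat list \<Rightarrow> bool" where
  "admissible w \<longleftrightarrow> w \<noteq> [] \<and> 0 \<notin> set w \<and> hd w \<ge> 2"

lemma hsum_tendsto_mzv:
  assumes "admissible w"
  shows "hsum w \<longlonglongrightarrow> mzv w"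
proof -
  obtain k ks where w: "w = k # ks" using assms by (auto simp: admissible_def neq_Nil_conv)
  have "hsum w \<longlonglongrightarrow> (\<Sum>n. hsum ks n / real n ^ k)"
    using summable_LIMSEQ[OF summable_hsum'[of ks k]] assms
    by (simp add: w admissible_def hsum.simps(2)[abs_def])
  thus ?thesis unfolding mzv_def by (metis limI)
qed

definition lin_hsum :: "(int \<times> nat list) list \<Rightarrow> nat \<Rightarrow> real" where
  "lin_hsum L n = (\<Sum>(c, w)\<leftarrow>L. of_int c * hsum w n)"

definition ds_rel :: "nat list \<Rightarrow> nat list \<Rightarrow> (int \<times> nat list) list" where
  "ds_rel u v = map (Pair 1) (stuffle u v) @ map (Pair (- 1)) (shuffle u v)"

text \<open>For \<open>u = [1]\<close> this is Hoffman's relation: the divergent word \<open>1 # v\<close> occurs once in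
  either product and cancels.\<close>

theorem double_shuffle:
  assumes u: "u = [1] \<or> admissible u" and v: "admissible v"
  shows "lin_hsum (ds_rel u v) \<longlonglongrightarrow> 0"
proof -
  obtain k ks where v': "v = k # ks" using v by (auto simp: admissible_def neq_Nil_conv)
  have kks: "0 \<notin> set (k # ks)" "0 \<notin> set ks" "k \<ge> 2" using v by (auto simp: v' admissible_def)
  have u0: "0 \<notin> set u" using u by (auto simp: admissible_def)
  define c where "c j = hsum ks j / real j ^ k" for j
  have c_nonneg: "c j \<ge> 0" for j by (simp add: c_def hsum_nonneg)
  define h where "h j = hsum [1] (Suc j)" for j
  \<comment> \<open>\<open>D j N\<close> is the contribution of the outer index j of
    \<open>v\<close> to stuffle minus shuffle: the stuffle product multiplies it by the full
    \<open>hsum u N\<close>, the shuffle product only by the part with i + j < N.\<close>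
  define D where "D j N = (if j < N then c j * (hsum u N - hsum u (N - j)) else 0)" for j N
  have eq: "lin_hsum (ds_rel u v) N = (\<Sum>j. D j N)" if "N > 0" for N
  proof -
    have "(\<Sum>w\<leftarrow>shuffle u v. hsum w N)
            = (\<Sum>j<N. c j * (\<Sum>i<N - j. fps_nth (polylog (binword u)) i))"
      using that unfolding sum_hsum_shuffle[OF that] sum_fps_mult_nth
      by (simp only: v' polylog_binword_nth[OF kks(1)] c_def)
    also have "\<dots> = (\<Sum>j<N. c j * hsum u (N - j))"
      using u0 by (intro sum.cong) (auto simp: sum_polylog_binword)
    finally have sh: "(\<Sum>w\<leftarrow>shuffle u v. hsum w N) = (\<Sum>j<N. c j * hsum u (N - j))" .
    have "(\<Sum>w\<leftarrow>stuffle u v. hsum w N) = (\<Sum>j<N. c j * hsum u N)"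
      by (simp add: hsum_stuffle v' c_def sum_distrib_left mult.commute)
    hence "lin_hsum (ds_rel u v) N = (\<Sum>j<N. c j * hsum u N) - (\<Sum>j<N. c j * hsum u (N - j))"
      using sh by (simp add: lin_hsum_def ds_rel_def o_def uminus_sum_list_map[of "\<lambda>w. hsum w N", unfolded o_def, symmetric])
    also have "\<dots> = (\<Sum>j<N. D j N)"
      by (simp add: D_def algebra_simps flip: sum_subtractf)
    also have "\<dots> = (\<Sum>j. D j N)"
      by (rule suminf_finite[symmetric]) (auto simp: D_def)
    finally show ?thesis .
  qed
  \<comment> \<open>Two properties of \<open>u\<close> suffice: the last j terms of its truncated
    sum are dominated by the harmonic number of j uniformly in N, and for fixed j they tend to 0.
    The divergent word [1] has both.\<close>
  obtain K where K: "\<And>j N. 1 \<le> j \<Longrightarrow> j < N \<Longrightarrow> hsum u N - hsum u (N - j) \<le> K * h j"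
    and lim: "\<And>j. (\<lambda>n. hsum u (n + j) - hsum u n) \<longlonglongrightarrow> 0"
  proof (cases "u = [1]")
    case True
    have "hsum [1] (a + j) \<le> hsum [1] a + h j" if "a \<ge> 1" for a j
    proof (induction j)
      case (Suc j)
      have "1 / real (a + j) \<le> 1 / real (Suc j)"
        using that by (intro divide_left_mono) auto
      thus ?case using Suc by (simp add: h_def del: of_nat_Suc of_nat_add)
    qed (simp add: h_def)
    from this[of "N - j" j for N j] have "hsum u N - hsum u (N - j) \<le> 1 * h j" if "j < N" for N j
      using that True by (simp del: hsum.simps) (metis One_nat_def Suc_leI add.commute diff_le_eq le_add_diff_inverse2 less_imp_le zero_less_diff)
    moreover have "(\<lambda>n. hsum u (n + j) - hsum u n) \<longlonglongrightarrow> 0" for j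
    proof (induction j)
      case (Suc j)
      have "(\<lambda>n. (hsum u (n + j) - hsum u n) + 1 / real (n + j)) \<longlonglongrightarrow> 0 + 0"
        by (intro tendsto_add Suc.IH LIMSEQ_ignore_initial_segment[OF lim_1_over_n])
      thus ?case by (simp add: True algebra_simps)
    qed simp
    ultimately show ?thesis using that by blast
  next
    case False
    hence u': "hsum u \<longlonglongrightarrow> mzv u" using u hsum_tendsto_mzv by auto
    have le: "hsum u N \<le> mzv u" for N
      using u' hsum_mono by (intro incseq_le) (auto simp: incseq_def)
    have "hsum u N - hsum u (N - j) \<le> mzv u * h j" if "1 \<le> j" for N j
    proof -
      have "hsum u N - hsum u (N - j) \<le> mzv u * 1" using le[of N] hsum_nonneg[of u "N - j"] by simp
      also have "\<dots> \<le> mzv u * h j"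
        using harmonic_ge_1[OF that] le[of 0] hsum_nonneg[of u 0] by (intro mult_left_mono) (auto simp: h_def)
      finally show ?thesis .
    qed
    moreover have "(\<lambda>n. hsum u (n + j) - hsum u n) \<longlonglongrightarrow> 0" for j
      using tendsto_diff[OF LIMSEQ_ignore_initial_segment[OF u'] u'] by simp
    ultimately show ?thesis using that by blast
  qed
  have "(\<lambda>N. \<Sum>j. D j N) \<longlonglongrightarrow> (\<Sum>j. 0)"
  proof (rule tannerys_theorem[where M = "\<lambda>j. \<bar>K\<bar> * (c j * h j)", THEN conjunct2, THEN conjunct2])
    show "summable (\<lambda>j. \<bar>K\<bar> * (c j * h j))"
      unfolding c_def h_def by (intro summable_mult summable_hsum kks)
    show "eventually (\<lambda>(j, N). norm (D j N) \<le> \<bar>K\<bar> * (c j * h j)) (at_top \<times>\<^sub>F sequentially)"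
    proof (rule always_eventually, safe)
      fix j N
      show "norm (D j N) \<le> \<bar>K\<bar> * (c j * h j)"
      proof (cases "1 \<le> j \<and> j < N")
        case True
        have "hsum u N - hsum u (N - j) \<le> K * h j" using K True by blast
        also have "\<dots> \<le> \<bar>K\<bar> * h j"
          by (intro mult_right_mono) (auto simp: h_def hsum_nonneg simp del: hsum.simps)
        finally have "c j * (hsum u N - hsum u (N - j)) \<le> c j * (\<bar>K\<bar> * h j)"
          by (intro mult_left_mono c_nonneg)
        moreover have "hsum u N - hsum u (N - j) \<ge> 0" using hsum_mono[of "N - j" N u] by simp
        ultimately show ?thesis using True c_nonneg[of j] by (simp add: D_def abs_mult mult_ac)
      next
        case False
        hence "D j N = 0" by (auto simp: D_def not_le)
        thus ?thesis using c_nonneg[of j] by (simp add: h_def hsum_nonneg del: hsum.simps)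
      qed
    qed
    show "((\<lambda>N. D j N) \<longlongrightarrow> 0) sequentially" for j
    proof (rule LIMSEQ_offset[of _ j])
      have "(\<lambda>n. c j * (hsum u (n + j) - hsum u n)) \<longlonglongrightarrow> c j * 0"
        by (intro tendsto_mult lim tendsto_const)
      moreover have "\<forall>\<^sub>F n in sequentially. c j * (hsum u (n + j) - hsum u n) = D j (n + j)"
        using eventually_gt_at_top[of 0] by eventually_elim (auto simp: D_def)
      ultimately show "(\<lambda>n. D j (n + j)) \<longlonglongrightarrow> 0"
        by (simp add: Lim_transform_eventually)
    qed
  qed auto
  hence "(\<lambda>N. \<Sum>j. D j N) \<longlonglongrightarrow> 0" by simp
  thus ?thesis
    by (rule Lim_transform_eventually)
      (auto intro!: eventually_mono[OF eventually_gt_at_top[of 0]] simp: eq)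
qed

section \<open>Certified linear relations between multiple zeta values\<close>

text \<open>Formal integer combinations of binary words. In a trie equal words meet and cancel
  without any sorting or comparison, which keeps the evaluation of the large certificates
  cheap.\<close>

datatype wtrie = WLeaf | WNode int wtrie wtrie

fun winsert :: "bool list \<Rightarrow> int \<Rightarrow> wtrie \<Rightarrow> wtrie" where
  "winsert [] c WLeaf = WNode c WLeaf WLeaf"
| "winsert [] c (WNode d l r) = WNode (c + d) l r"
| "winsert (b # w) c WLeaf =
     (if b then WNode 0 (winsert w c WLeaf) WLeaf else WNode 0 WLeaf (winsert w c WLeaf))"
| "winsert (b # w) c (WNode d l r) =
     (if b then WNode d (winsert w c l) r else WNode d l (winsert w c r))"

fun wzero :: "wtrie \<Rightarrow> bool" where
  "wzero WLeaf = True"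
| "wzero (WNode c l r) \<longleftrightarrow> c = 0 \<and> wzero l \<and> wzero r"

fun weval :: "(bool list \<Rightarrow> real) \<Rightarrow> wtrie \<Rightarrow> real" where
  "weval F WLeaf = 0"
| "weval F (WNode c l r) = of_int c * F [] + weval (\<lambda>w. F (True # w)) l + weval (\<lambda>w. F (False # w)) r"

lemma weval_winsert: "weval F (winsert w c t) = weval F t + of_int c * F w"
  by (induction w c t arbitrary: F rule: winsert.induct) (auto simp: algebra_simps)

lemma weval_wzero: "wzero t \<Longrightarrow> weval F t = 0"
  by (induction t arbitrary: F) auto

fun winsert_words :: "int \<Rightarrow> bool list list \<Rightarrow> wtrie \<Rightarrow> wtrie" where
  "winsert_words c [] t = t"
| "winsert_words c (w # ws) t = winsert_words c ws (winsert w c t)"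

text \<open>The keys are binary words, so the shuffle side is inserted as it arises and only the
  stuffle side has to be coded.\<close>

fun winsert_rels :: "(int \<times> nat list \<times> nat list) list \<Rightarrow> wtrie \<Rightarrow> wtrie" where
  "winsert_rels [] t = t"
| "winsert_rels ((c, u, v) # R) t = winsert_rels R
     (winsert_words (- c) (binshuffle (binword u) (binword v))
       (winsert_words c (map binword (stuffle u v)) t))"

fun winsert_lin :: "(int \<times> nat list) list \<Rightarrow> wtrie \<Rightarrow> wtrie" where
  "winsert_lin [] t = t"
| "winsert_lin ((c, w) # L) t = winsert_lin L (winsert (binword w) c t)"

definition bin_hsum :: "nat \<Rightarrow> bool list \<Rightarrow> real" where
  "bin_hsum n w = hsum (unbin 0 w) n"

lemma unbin_binword: "0 \<notin> set w \<Longrightarrow> unbin 0 (binword w) = w"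
proof (induction w)
  case (Cons k w)
  have "unbin i (replicate j False @ True # v) = Suc (i + j) # unbin 0 v" for i j v
    by (induction j arbitrary: i) auto
  thus ?case using Cons by simp
qed simp

lemma zero_notin_stuffle: "0 \<notin> set u \<Longrightarrow> 0 \<notin> set v \<Longrightarrow> w \<in> set (stuffle u v) \<Longrightarrow> 0 \<notin> set w"
proof (induction u v arbitrary: w rule: stuffle.induct)
  case (3 a u b v)
  from "3.prems"(3) consider w' where "w = a # w'" "w' \<in> set (stuffle u (b # v))"
    | w' where "w = b # w'" "w' \<in> set (stuffle (a # u) v)"
    | w' where "w = (a + b) # w'" "w' \<in> set (stuffle u v)" by auto
  thus ?case
  proof cases
    case 1
    thus ?thesis using "3.IH"(1)[of w'] "3.prems"(1,2) by simp
  next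
    case 2
    thus ?thesis using "3.IH"(2)[of w'] "3.prems"(1,2) by simp
  next
    case 3
    thus ?thesis using "3.IH"(3)[of w'] "3.prems"(1,2) by simp
  qed
qed auto

lemma weval_winsert_words:
  "weval F (winsert_words c ws t) = weval F t + of_int c * (\<Sum>w\<leftarrow>ws. F w)"
  by (induction c ws t rule: winsert_words.induct) (auto simp: weval_winsert algebra_simps)

lemma weval_winsert_rels:
  assumes "\<forall>(c, u, v)\<in>set R. 0 \<notin> set u \<and> 0 \<notin> set v"
  shows "weval (bin_hsum n) (winsert_rels R t)
           = weval (bin_hsum n) t + (\<Sum>(c, u, v)\<leftarrow>R. of_int c * lin_hsum (ds_rel u v) n)"
  using assms
proof (induction R t rule: winsert_rels.induct)
  case (2 c u v R t)
  have "map (bin_hsum n) (map binword (stuffle u v)) = map (\<lambda>w. hsum w n) (stuffle u v)"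
    using "2.prems" by (auto simp: bin_hsum_def unbin_binword dest: zero_notin_stuffle[rotated 2])
  hence st: "(\<Sum>w\<leftarrow>map binword (stuffle u v). bin_hsum n w) = (\<Sum>w\<leftarrow>stuffle u v. hsum w n)"
    by (simp only:)
  have sh: "(\<Sum>w\<leftarrow>binshuffle (binword u) (binword v). bin_hsum n w) = (\<Sum>w\<leftarrow>shuffle u v. hsum w n)"
    by (simp add: shuffle_def o_def bin_hsum_def)
  have ds: "lin_hsum (ds_rel u v) n = (\<Sum>w\<leftarrow>stuffle u v. hsum w n) - (\<Sum>w\<leftarrow>shuffle u v. hsum w n)"
    by (simp add: lin_hsum_def ds_rel_def o_def
        uminus_sum_list_map[of "\<lambda>w. hsum w n", unfolded o_def, symmetric])
  have R: "\<forall>(c, u, v)\<in>set R. 0 \<notin> set u \<and> 0 \<notin> set v" using "2.prems" by simp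
  show ?case
    unfolding winsert_rels.simps "2.IH"[OF R] weval_winsert_words st sh
    by (simp add: ds algebra_simps)
qed simp

lemma weval_winsert_lin:
  assumes "\<forall>(c, w)\<in>set L. 0 \<notin> set w"
  shows "weval (bin_hsum n) (winsert_lin L t) = weval (bin_hsum n) t + lin_hsum L n"
  using assms
  by (induction L t rule: winsert_lin.induct)
    (auto simp: weval_winsert lin_hsum_def bin_hsum_def unbin_binword)

text \<open>Products of zeta values are themselves expanded into single words by repeated stuffle,
  so that the value claimed by a certificate may be a polynomial in zeta values.\<close>

fun prod_words :: "nat list list \<Rightarrow> nat list list" where
  "prod_words [] = [[]]"
| "prod_words (u # us) = concat (map (stuffle u) (prod_words us))"

lemma hsum_prod_words: "(\<Sum>w\<leftarrow>prod_words us. hsum w n) = (\<Prod>u\<leftarrow>us. hsum u n)"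
proof (induction us)
  case (Cons u us)
  have "(\<Sum>w\<leftarrow>concat (map (stuffle u) ws). hsum w n) = hsum u n * (\<Sum>w\<leftarrow>ws. hsum w n)" for ws
    by (induction ws) (auto simp: hsum_stuffle algebra_simps)
  thus ?case using Cons by simp
qed simp

definition prods_lin :: "(int \<times> nat list list) list \<Rightarrow> (int \<times> nat list) list" where
  "prods_lin Q = concat (map (\<lambda>(c, us). map (Pair c) (prod_words us)) Q)"

lemma lin_hsum_prods_lin:
  "lin_hsum (prods_lin Q) n = (\<Sum>(c, us)\<leftarrow>Q. of_int c * (\<Prod>u\<leftarrow>us. hsum u n))"
proof -
  have "lin_hsum (map (Pair c) ws) n = of_int c * (\<Sum>w\<leftarrow>ws. hsum w n)" for c ws
    by (induction ws) (auto simp: lin_hsum_def algebra_simps)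
  moreover have "lin_hsum (xs @ ys) n = lin_hsum xs n + lin_hsum ys n" for xs ys
    by (simp add: lin_hsum_def)
  ultimately show ?thesis
    by (induction Q) (auto simp: prods_lin_def hsum_prod_words, simp add: lin_hsum_def)
qed

definition scale_lin :: "int \<Rightarrow> (int \<times> nat list) list \<Rightarrow> (int \<times> nat list) list" where
  "scale_lin d L = map (\<lambda>(c, w). (d * c, w)) L"

lemma lin_hsum_scale_lin: "lin_hsum (scale_lin d L) n = of_int d * lin_hsum L n"
  by (induction L) (auto simp: scale_lin_def lin_hsum_def algebra_simps)

text \<open>The evaluated condition is a formal identity of words: d * L minus the expansion of
  \<open>Q\<close> plus the sum of c * (stuffle - shuffle) over \<open>R\<close> is zero. The
  integer \<open>d\<close> clears the denominators.\<close>

definition mzv_certificate ::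
  "int \<Rightarrow> (int \<times> nat list) list \<Rightarrow> (int \<times> nat list list) list \<Rightarrow>
     (int \<times> nat list \<times> nat list) list \<Rightarrow> bool" where
  "mzv_certificate d L Q R \<longleftrightarrow>
     d \<noteq> 0 \<and> list_all (\<lambda>(c, w). list_all (\<lambda>k. k \<noteq> 0) w) L
     \<and> list_all (\<lambda>(c, us). list_all admissible us) Q
     \<and> list_all (\<lambda>(c, u, v). (u = [1] \<or> admissible u) \<and> admissible v) R
     \<and> wzero (winsert_rels R (winsert_lin (scale_lin d L) (winsert_lin (scale_lin (- 1) (prods_lin Q)) WLeaf)))"

lemma zero_notin_prod_words:
  "list_all admissible us \<Longrightarrow> w \<in> set (prod_words us) \<Longrightarrow> 0 \<notin> set w"
proof (induction us arbitrary: w)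
  case (Cons u us)
  then obtain v where "v \<in> set (prod_words us)" "w \<in> set (stuffle u v)" by auto
  thus ?case using Cons zero_notin_stuffle[of u v w] by (auto simp: admissible_def)
qed simp

text \<open>The formal identity holds between truncated sums at each n. There the defects of the
  relations tend to 0 by \<open>double_shuffle\<close> and the products converge, so the convergence
  of \<open>lin_hsum L\<close> is a result and not an assumption.\<close>

theorem mzv_certificate_sound:
  assumes "mzv_certificate d L Q R"
  shows "lin_hsum L \<longlonglongrightarrow> (\<Sum>(c, us)\<leftarrow>Q. of_int c * (\<Prod>u\<leftarrow>us. mzv u)) / of_int d"
proof -
  have d: "d \<noteq> 0" and L: "\<forall>(c, w)\<in>set (scale_lin d L). 0 \<notin> set w"
    and R: "\<forall>(c, u, v)\<in>set R. (u = [1] \<or> admissible u) \<and> admissible v"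
    and Q: "\<forall>(c, us)\<in>set Q. list_all admissible us"
    using assms by (auto simp: mzv_certificate_def list_all_iff scale_lin_def)
  have Q': "\<forall>(c, w)\<in>set (scale_lin (- 1) (prods_lin Q)). 0 \<notin> set w"
    using Q by (auto simp: scale_lin_def prods_lin_def dest: zero_notin_prod_words)
  have R': "\<forall>(c, u, v)\<in>set R. 0 \<notin> set u \<and> 0 \<notin> set v"
    using R by (fastforce simp: admissible_def)
  have eq: "of_int d * lin_hsum L n = lin_hsum (prods_lin Q) n
              - (\<Sum>(c, u, v)\<leftarrow>R. of_int c * lin_hsum (ds_rel u v) n)" for n
  proof -
    have "weval (bin_hsum n) (winsert_rels R (winsert_lin (scale_lin d L)
            (winsert_lin (scale_lin (- 1) (prods_lin Q)) WLeaf))) = 0"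
      using assms by (intro weval_wzero) (simp add: mzv_certificate_def)
    thus ?thesis
      by (simp add: weval_winsert_rels[OF R'] weval_winsert_lin[OF L] weval_winsert_lin[OF Q']
        lin_hsum_scale_lin)
  qed
  have "(\<lambda>n. \<Sum>(c, u, v)\<leftarrow>R. of_int c * lin_hsum (ds_rel u v) n) \<longlonglongrightarrow> 0"
    using R
  proof (induction R)
    case (Cons r R)
    obtain c u v where r: "r = (c, u, v)" by (cases r)
    have "(\<lambda>n. of_int c * lin_hsum (ds_rel u v) n + (\<Sum>(c, u, v)\<leftarrow>R. of_int c * lin_hsum (ds_rel u v) n))
             \<longlonglongrightarrow> of_int c * 0 + 0"
      using Cons r by (intro tendsto_add tendsto_mult tendsto_const double_shuffle Cons.IH) auto
    thus ?case by (simp add: r)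
  qed simp
  moreover have "lin_hsum (prods_lin Q) \<longlonglongrightarrow> (\<Sum>(c, us)\<leftarrow>Q. of_int c * (\<Prod>u\<leftarrow>us. mzv u))"
    unfolding lin_hsum_prods_lin[abs_def] using Q
  proof (induction Q)
    case (Cons q Q)
    obtain c us where q: "q = (c, us)" by (cases q)
    have "list_all admissible us \<Longrightarrow> (\<lambda>n. \<Prod>u\<leftarrow>us. hsum u n) \<longlonglongrightarrow> (\<Prod>u\<leftarrow>us. mzv u)"
      by (induction us) (auto intro!: tendsto_mult hsum_tendsto_mzv)
    thus ?case using Cons by (auto simp: q intro!: tendsto_add tendsto_mult)
  qed simp
  ultimately have "(\<lambda>n. (lin_hsum (prods_lin Q) n
         - (\<Sum>(c, u, v)\<leftarrow>R. of_int c * lin_hsum (ds_rel u v) n)) / of_int d)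
      \<longlonglongrightarrow> ((\<Sum>(c, us)\<leftarrow>Q. of_int c * (\<Prod>u\<leftarrow>us. mzv u)) - 0) / of_int d"
    using d by (intro tendsto_divide tendsto_diff tendsto_const) auto
  thus ?thesis using d by (simp flip: eq)
qed

text \<open>The coefficient of \<open>x^m\<close> in \<open>\<Prod>\<^bsub>j<n\<^esub> ((1 + x/j) / (1 - x/j))^3\<close> as a combination of words;
  the numbers \<open>4k\<^sup>2 + 2\<close> are the coefficients of \<open>((1 + u) / (1 - u))^3\<close>.\<close>

fun cube_words :: "nat \<Rightarrow> (int \<times> nat list) list" where
  "cube_words m = (if m = 0 then [(1, [])] else
     concat (map (\<lambda>k. if k = 0 \<or> k > m then [] else
       map (\<lambda>(c, w). ((4 * int k ^ 2 + 2) * c, k # w)) (cube_words (m - k))) [0..<Suc m]))"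

declare cube_words.simps [simp del]

text \<open>Since n / (n - x)^3 = n^(-2) (1 - x/n)^(-3) has the coefficients binomial(k + 2, 2) /
  n^(k + 2), a letter k + 2 in front of the words of the product over j < n gives the coefficient of
  x^m in the sum over n.\<close>

definition V_words :: "nat \<Rightarrow> (int \<times> nat list) list" where
  "V_words m = concat (map (\<lambda>k. map (\<lambda>(c, w). (int ((k + 2) choose 2) * c, (k + 2) # w))
     (cube_words (m - k))) [0..<Suc m])"

text \<open>The coefficients of the double shuffle relations below were found by linear algebra over \<open>\<rat>\<close>.\<close>

lemma certificate_zeta_4: "mzv_certificate 5 [(1, [4])]
   [(2, [[2], [2]])]
   [(1,[2],[2]), (-4,[1],[3])]"
  by code_simp

lemma certificate_zeta_6: "mzv_certificate 1645 [(1, [6])]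
   [(376, [[2], [2], [2]])]
   [(73,[3],[3]), (158,[2],[4]), (-80,[2],[3,1]), (108,[2],[2,2]), (-1500,[1],[5]), (720,[1],[4,1]), 
    (-624,[1],[3,2]), (-192,[1],[3,1,1]), (-480,[1],[2,3]), (480,[1],[2,2,1]), (-480,[2],[2,1,1]), 
    (336,[2,1],[2,1])]"
  by code_simp

lemma certificate_zeta_8: "mzv_certificate 8187375 [(1, [8])]
   [(1122840, [[2], [2], [2], [2]])]
   [(1782869,[4],[4]), (2517828,[3],[5]), (-10914512,[2],[6]), (27420032,[2],[5,1]), 
    (20295104,[2],[4,2]), (4164480,[2],[4,1,1]), (10552640,[2],[3,2,1]), (-16075296,[3],[4,1]), 
    (-450720,[1],[7]), (4080000,[1],[6,1]), (-21479040,[1],[5,2]), (-88583040,[1],[5,1,1]), 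
    (-13020480,[1],[4,3]), (-73897920,[1],[4,2,1]), (-63141120,[1],[4,1,2]), (594240,[1],[3,4]), 
    (-54239040,[1],[3,3,1]), (-30915840,[1],[3,2,2]), (4934400,[1],[2,5]), (-29606400,[1],[2,4,1]), 
    (-9868800,[1],[2,3,2]), (-3074720,[2],[3,3]), (18401920,[2],[3,1,2]), (9164480,[2],[2,3,1]), 
    (-24733664,[3],[3,2]), (-7788560,[2],[2,4]), (20852520,[2],[2,2,2]), (33251040,[3,1],[3,1]), 
    (-4584640,[3],[2,3]), (-2908740,[2,2],[2,2]), (-48961920,[3],[3,1,1]), (11479440,[2,2],[4]), 
    (3967680,[3],[2,2,1]), (4934400,[3],[2,1,2])]"
  by code_simp

section \<open>The Taylor coefficients of \<open>V\<close>, in weights 2 to 9\<close>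

lemma certificate_V_0: "mzv_certificate 1 (V_words 0)
   [(1, [[2]])]
   []"
  by code_simp

lemma certificate_V_1: "mzv_certificate 1 (V_words 1)
   [(9, [[3]])]
   [(6,[1],[2])]"
  by code_simp

lemma certificate_V_2: "mzv_certificate 1 (V_words 2)
   [(24, [[2], [2]])]
   [(12,[2],[2]), (6,[1],[3]), (36,[1],[2,1])]"
  by code_simp

lemma certificate_V_3: "mzv_certificate 5 (V_words 3)
   [(1400, [[5]]), (250, [[2], [3]])]
   [(-284,[2],[3]), (324,[2],[2,1]), (1884,[1],[4]), (-324,[1],[3,1]), (1620,[1],[2,2]), 
    (1080,[1],[2,1,1])]"
  by code_simp

lemma certificate_V_4: "mzv_certificate 1645 (V_words 4)
   [(742694, [[2], [2], [2]]), (370125, [[3], [3]])]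
   [(-1202178,[3],[3]), (1287662,[2],[4]), (846760,[2],[3,1]), (1219752,[2],[2,2]), 
    (1002660,[1],[5]), (-4067640,[1],[4,1]), (1381524,[1],[3,2]), (2529672,[1],[3,1,1]), 
    (1902420,[1],[2,3]), (1670520,[1],[2,2,1]), (3197880,[1],[2,1,2]), (2131920,[1],[2,1,1,1]), 
    (-1670520,[2],[2,1,1]), (1169364,[2,1],[2,1])]"
  by code_simp

lemma certificate_V_5: "mzv_certificate 15640 (V_words 5)
   [(117827850, [[7]]), (22990800, [[2], [5]]), (18768000, [[2], [2], [3]])]
   [(-393252177,[3],[4]), (613301427,[2],[5]), (210064734,[2],[4,1]), (193158618,[2],[3,2]), 
    (-451443024,[2],[3,1,1]), (-60791040,[1],[6]), (-1822415328,[1],[5,1]), (-252292320,[1],[4,2]), 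
    (797756688,[1],[4,1,1]), (412353696,[1],[3,3]), (195595200,[1],[3,2,1]), 
    (457413696,[1],[3,1,2]), (-45606240,[1],[3,1,1,1]), (184451904,[1],[2,4]), 
    (-11767536,[1],[2,3,1]), (-36597600,[1],[2,2,2]), (159621840,[1],[2,2,1,1]), 
    (226623600,[1],[2,1,3]), (-22803120,[1],[2,1,2,1]), (182424960,[1],[2,1,1,2]), 
    (121616640,[1],[2,1,1,1,1]), (244432680,[2],[2,3]), (-139778352,[2],[2,2,1]), 
    (391518876,[3],[3,1]), (-48365136,[2],[2,1,2]), (22803120,[2],[2,1,1,1]), (142652088,[3],[2,2]), 
    (-573396192,[2,1],[4]), (256501440,[2,1],[3,1])]"
  by code_simp

text \<open>Weight 8 is the first weight in which polynomials in single zeta values are not expected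
  to suffice; the word [5,3] therefore stays in the target.\<close>

lemma certificate_V_6: "mzv_certificate 9508271500 (V_words 6)
   [(82615904073040, [[2], [2], [2], [2]]), (11885339375000, [[2], [3], [3]]), (133115801000000, [[3], [5]]), (1464273811000, [[5,3]])]
   [(-390025853059696,[4],[4]), (-97438701911527,[3],[5]), (2246523197925933,[2],[6]), 
    (4537334292589712,[2],[5,1]), (2619335019255914,[2],[4,2]), (666224628526080,[2],[4,1,1]), 
    (-4603837728172960,[2],[3,2,1]), (-2211081642254436,[3],[4,1]), (-1531707830108670,[1],[7]), 
    (4574924672724600,[1],[6,1]), (-2470432144204440,[1],[5,2]), (7787070967786560,[1],[5,1,1]), 
    (1353411624121320,[1],[4,3]), (6322801377574080,[1],[4,2,1]), (1411110526711680,[1],[4,1,2]), 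
    (-4893354685440000,[1],[4,1,1,1]), (1928459144002440,[1],[3,4]), (2982184918428960,[1],[3,3,1]), 
    (-740502560039040,[1],[3,2,2]), (-2699428851288000,[1],[3,2,1,1]), 
    (2554443506152800,[1],[3,1,3]), (-4373687715408000,[1],[3,1,2,1]), 
    (-928898359272000,[1],[3,1,1,2]), (665426872656000,[1],[3,1,1,1,1]), 
    (121965211870800,[1],[2,5]), (3472660315123200,[1],[2,4,1]), (-652438367169600,[1],[2,3,2]), 
    (-1520143684488000,[1],[2,3,1,1]), (438687075528000,[1],[2,2,3]), 
    (1315833514632000,[1],[2,2,2,1]), (1112565564864000,[1],[2,2,1,2]), 
    (1062394491132000,[1],[2,1,4]), (-1850755164336000,[1],[2,1,3,1]), 
    (32860586304000,[1],[2,1,2,2]), (665426872656000,[1],[2,1,2,1,1]), 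
    (743470765128000,[1],[2,1,1,3]), (665426872656000,[1],[2,1,1,1,2]), 
    (443617915104000,[1],[2,1,1,1,1,1]), (-1505957796192170,[2],[3,3]), 
    (-1089256552371680,[2],[3,1,2]), (375514525152000,[2],[3,1,1,1]), 
    (-4518555073529920,[2],[2,3,1]), (2570848954733126,[3],[3,2]), (813561095350090,[2],[2,4]), 
    (-3473120789352480,[2],[2,2,2]), (710516533968000,[2],[2,2,1,1]), 
    (-2399883261466560,[3,1],[3,1]), (685728268992000,[2],[2,1,2,1]), (1989927559724910,[3],[2,3]), 
    (-387555771484800,[2],[2,1,3]), (296332072920000,[2],[2,1,1,2]), (903790566383460,[2,2],[2,2]), 
    (2643826253947680,[3],[3,1,1]), (-4116200949026310,[2,2],[4]), (3194977468133280,[3],[2,2,1]), 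
    (-558692569934400,[3],[2,1,2]), (67284165888000,[2,1],[2,2,1])]"
  by code_simp

lemma certificate_V_7: "mzv_certificate 196944073600428000 (V_words 7)
   [(41735075116912032240000, [[9]]), (7793076992368935960000, [[2], [7]]), (6948186916623099840000, [[2], [2], [5]]), (4445871787191376080000, [[2], [2], [2], [3]]), (738540276001605000000, [[3], [3], [3]])]
   [(-619219072359776266643548,[4],[5]), (187583821471089061789789,[3],[6]), 
    (2314559981270649528401535,[2],[7]), (20774890175884738689527788,[2],[6,1]), 
    (11736410340559089692850256,[2],[5,2]), (-25902567530516383857709392,[2],[5,1,1]), 
    (1583094249872621319660588,[2],[4,2,1]), (-11769643122609464228739824,[3],[5,1]), 
    (-13115904443721712403507620,[3],[4,2]), (-1821271069279514889835776,[1],[8]), 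
    (-15431374410376478380558608,[1],[7,1]), (-23082881137680075706014960,[1],[6,2]), 
    (-81150817921922252217923040,[1],[6,1,1]), (6759055740465143026163664,[1],[5,3]), 
    (-55190185938691766636183424,[1],[5,2,1]), (-36618128115468440402817504,[1],[5,1,2]), 
    (-4588361164062665317944000,[1],[5,1,1,1]), (10681574648301867630494952,[1],[4,4]), 
    (-56305406145285370399257360,[1],[4,3,1]), (-24956627800255016084066832,[1],[4,2,2]), 
    (-4020567803083915057548000,[1],[4,2,1,1]), (3010495891468408511767200,[1],[4,1,3]), 
    (-3942168411687144237648000,[1],[4,1,2,1]), (-2092674314264526859860000,[1],[4,1,1,2]), 
    (540143913875014415232000,[1],[4,1,1,1,1]), (7335586310765427222739632,[1],[3,5]), 
    (-40713486392704158120249552,[1],[3,4,1]), (-13220109130070887884771264,[1],[3,3,2]), 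
    (-2060962329030972840396000,[1],[3,3,1,1]), (480435502993356068902800,[1],[3,2,3]), 
    (-1709243155808771659650000,[1],[3,2,2,1]), (-1415969486209175387112000,[1],[3,2,1,2]), 
    (674341029606792659328000,[1],[3,2,1,1,1]), (443712121141652874151200,[1],[3,1,4]), 
    (-1843161048605455574688000,[1],[3,1,3,1]), (-1480775228636192958672000,[1],[3,1,2,2]), 
    (1164764355587919834048000,[1],[3,1,2,1,1]), (-367546927002235602048000,[1],[3,1,1,3]), 
    (606925133397964963008000,[1],[3,1,1,2,1]), (313155686694140333568000,[1],[3,1,1,1,2]), 
    (-22553892076667486976000,[1],[3,1,1,1,1,1]), (849289408521524835202800,[1],[2,6]), 
    (-9219303676404372274718400,[1],[2,5,1]), (-5147813979879395363960400,[1],[2,4,2]), 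
    (-1505610416507239016352000,[1],[2,4,1,1]), (42278604675344294468400,[1],[2,3,3]), 
    (-1105967273601635808930000,[1],[2,3,2,1]), (-935550601673936334156000,[1],[2,3,1,2]), 
    (518331980322762665472000,[1],[2,3,1,1,1]), (382083295670342045640000,[1],[2,2,4]), 
    (-1309899108483077172354000,[1],[2,2,3,1]), (653317651758337804854000,[1],[2,2,2,2]), 
    (-250225503085189521792000,[1],[2,2,2,1,1]), (151834278604491600768000,[1],[2,2,1,3]), 
    (-150872986908102187008000,[1],[2,2,1,2,1]), (-77244760003318996032000,[1],[2,2,1,1,2]), 
    (67661676230002460928000,[1],[2,2,1,1,1,1]), (173914327987490359584000,[1],[2,1,5]), 
    (-738159370007333843520000,[1],[2,1,4,1]), (-292132299032565570432000,[1],[2,1,3,2]), 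
    (694679618490566841216000,[1],[2,1,3,1,1]), (-86280435598767383232000,[1],[2,1,2,3]), 
    (236059626293097247872000,[1],[2,1,2,2,1]), (206535178368742079808000,[1],[2,1,2,1,2]), 
    (-15035928051111657984000,[1],[2,1,2,1,1,1]), (78799400712307392768000,[1],[2,1,1,4]), 
    (5476047870466591488000,[1],[2,1,1,3,1]), (-10952095740933182976000,[1],[2,1,1,2,2]), 
    (75179640255558289920000,[1],[2,1,1,2,1,1]), (99914670043343826048000,[1],[2,1,1,1,3]), 
    (-7517964025555828992000,[1],[2,1,1,1,2,1]), (82697604281114118912000,[1],[2,1,1,1,1,2]), 
    (55131736187409412608000,[1],[2,1,1,1,1,1,1]), (2280753604497061053456282,[2],[4,3]), 
    (14324268925751565967739124,[2],[4,1,2]), (1867880938018740201648000,[2],[4,1,1,1]), 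
    (23524798036662689987330104,[2],[3,3,1]), (995281873116551736660000,[2],[3,2,1,1]), 
    (2260753221399223587781435,[2],[3,4]), (11865241331344030429686008,[2],[3,2,2]), 
    (446685831299255340870000,[2],[3,1,2,1]), (-30332845512679139136000,[2],[3,1,1,1,1]), 
    (16437679187353134433998876,[2],[2,4,1]), (784428509645769561300000,[2],[2,3,1,1]), 
    (-14393050142558954024597466,[3],[3,3]), (-1193728033893447765694800,[2],[3,1,3]), 
    (339253394254294978080000,[2],[3,1,1,2]), (-3018532883999608342076186,[2],[2,5]), 
    (3981027547907437070526772,[2],[2,3,2]), (885378921389520674256000,[2],[2,2,2,1]), 
    (-54448612032261379968000,[2],[2,2,1,1,1]), (1541848375607819485775136,[4],[4,1]), 
    (-940011180922475519495400,[2],[2,2,3]), (630119700044958830364000,[2],[2,2,1,2]), 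
    (240751737828551499606000,[2],[2,1,3,1]), (-151353807637776432192000,[2],[2,1,2,1,1]), 
    (7517964025555828992000,[2],[2,1,1,1,1,1]), (-32999110753669551367595496,[3],[4,1,1]), 
    (6761845326245521749456893,[4],[3,2]), (492837331007263270014000,[2],[2,1,2,2]), 
    (-101293160057207572608000,[2],[2,1,1,2,1]), (-9339285412739181076955576,[3],[3,2,1]), 
    (-6599189630262294742758789,[3],[2,4]), (-128877928687509902359200,[2],[2,1,4]), 
    (-23922904044284134848000,[2],[2,1,1,1,2]), (10205590670265694345336329,[4],[2,3]), 
    (94391748636922195200000,[2],[2,1,1,3]), (-4162805229787831999413512,[3],[3,1,2]), 
    (1746459207268548807534336,[3],[2,3,1]), (33080043445492000952671032,[3,1],[4,1]), 
    (8609099291788859242565832,[3],[2,2,2]), (11283012798456912103251672,[3,1],[3,2]), 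
    (-3223440562544214606403930,[2,2],[5]), (-381465136304397159588000,[3],[3,1,1,1]), 
    (275764121827107011028000,[3,1],[3,1,1]), (-6963209883473431492256788,[2,2],[3,2]), 
    (-165239708593896657252000,[3],[2,2,1,1]), (804080486213070403050000,[3],[2,1,3]), 
    (-2357064400001679750762240,[2,1],[5,1]), (-11481741508449296169586740,[2,2],[4,1]), 
    (69237510180405274890000,[3],[2,1,2,1]), (-933969683831261194152000,[2,1],[4,1,1]), 
    (-21455551594146555648000,[2,1],[2,2,1,1])]"
  by code_simp

section \<open>The Gamma quotient\<close>

lemma Re_pos_notin_nonpos_Ints: "Re z > 0 \<Longrightarrow> z \<notin> \<int>\<^sub>\<le>\<^sub>0"
  by (auto elim!: nonpos_Ints_cases)

lemma pochhammer_triple: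
  fixes z :: complex
  shows "pochhammer (3 * z) (3 * n)
    = 27 ^ n * pochhammer z n * pochhammer (z + 1 / 3) n * pochhammer (z + 2 / 3) n"
proof (induction n)
  case (Suc n)
  have "3 * Suc n = Suc (Suc (Suc (3 * n)))" by simp
  thus ?case using Suc
    by (simp only: pochhammer_Suc power_Suc) (simp add: field_simps)
qed simp

text \<open>Gauss's argument: in the ratio of the sequences converging to the four Gamma values,
  multiplied by exp(3 z ln 3), everything depending on z cancels and the sequence \<open>h\<close>
  is left. Its limit is a constant, which is found at z = 1/3 by the reflection formula.\<close>

lemma Gamma_triplication:
  fixes z :: complex
  assumes "Re z > 0"
  shows "Gamma z * Gamma (z + 1 / 3) * Gamma (z + 2 / 3)
           = of_real (2 * sqrt 3 * pi) * exp (- 3 * z * of_real (ln 3)) * Gamma (3 * z)"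
proof -
  let ?e = "\<lambda>n a. exp (a * complex_of_real (ln (real n)))"
  define h where "h = (\<lambda>n::nat. (fact (n - 1)) ^ 3 / fact (3 * n - 1) * 27 ^ n * ?e n 1)"
  have lim: "h \<longlonglongrightarrow> exp (3 * z * of_real (ln 3)) * (Gamma z * Gamma (z + 1 / 3) * Gamma (z + 2 / 3)) / Gamma (3 * z)"
    if "Re z > 0" for z
  proof -
    let ?g = "\<lambda>n. exp (3 * z * of_real (ln 3)) * (Gamma_series' z n * Gamma_series' (z + 1 / 3) n
                 * Gamma_series' (z + 2 / 3) n) / Gamma_series' (3 * z) (3 * n)"
    have nz: "z \<notin> \<int>\<^sub>\<le>\<^sub>0" "z + 1 / 3 \<notin> \<int>\<^sub>\<le>\<^sub>0" "z + 2 / 3 \<notin> \<int>\<^sub>\<le>\<^sub>0" "3 * z \<notin> \<int>\<^sub>\<le>\<^sub>0"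
      using that by (auto intro!: Re_pos_notin_nonpos_Ints)
    have "?g \<longlonglongrightarrow> exp (3 * z * of_real (ln 3)) * (Gamma z * Gamma (z + 1 / 3) * Gamma (z + 2 / 3)) / Gamma (3 * z)"
      using LIMSEQ_subseq_LIMSEQ[OF Gamma_series'_LIMSEQ, of "(*) 3" "3 * z"] nz
      by (intro tendsto_intros Gamma_series'_LIMSEQ)
        (simp_all add: o_def strict_mono_def Gamma_eq_zero_iff)
    moreover have "eventually (\<lambda>n. ?g n = h n) sequentially"
      using eventually_gt_at_top[of 0]
    proof eventually_elim
      fix n :: nat assume n: "n > 0"
      have p: "pochhammer z n \<noteq> 0" "pochhammer (z + 1 / 3) n \<noteq> 0" "pochhammer (z + 2 / 3) n \<noteq> 0"
        using nz by (auto dest: pochhammer_eq_0_imp_nonpos_Int)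
      have A: "?e n z * ?e n (z + 1 / 3) * ?e n (z + 2 / 3) = ?e n (3 * z) * ?e n 1"
        by (simp add: exp_add[symmetric] algebra_simps)
      have B: "?e (3 * n) (3 * z) = exp (3 * z * of_real (ln 3)) * ?e n (3 * z)"
        using n by (simp add: ln_mult exp_add[symmetric] algebra_simps)
      have "?g n = exp (3 * z * of_real (ln 3)) * ((fact (n - 1)) ^ 3 * (?e n z * ?e n (z + 1 / 3) * ?e n (z + 2 / 3))
              / (pochhammer z n * pochhammer (z + 1 / 3) n * pochhammer (z + 2 / 3) n))
              / (fact (3 * n - 1) * ?e (3 * n) (3 * z) / pochhammer (3 * z) (3 * n))"
        by (simp add: Gamma_series'_def power3_eq_cube)
      also have "\<dots> = h n"
        unfolding A B pochhammer_triple h_def using p by (simp add: field_simps)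
      finally show "?g n = h n" .
    qed
    ultimately show ?thesis by (rule Lim_transform_eventually)
  qed
  have G13: "Gamma (1 / 3) * Gamma (2 / 3 :: complex) = of_real (2 * pi / sqrt 3)"
  proof -
    have "Gamma (1 / 3) * Gamma (1 - 1 / 3 :: complex) = of_real pi / sin (of_real pi * (1 / 3))"
      by (rule Gamma_reflection_complex)
    also have "sin (of_real pi * (1 / 3 :: complex)) = of_real (sin (pi / 3))"
      by (simp flip: sin_of_real)
    also have "\<dots> = of_real (sqrt 3 / 2)" by (simp add: sin_60)
    finally show ?thesis by simp
  qed
  have "exp (3 * (1 / 3) * of_real (ln 3)) * (Gamma (1 / 3) * Gamma (1 / 3 + 1 / 3) * Gamma (1 / 3 + 2 / 3 :: complex))
          / Gamma (3 * (1 / 3)) = of_real (2 * sqrt 3 * pi)"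
  proof -
    have "3 * (2 * pi / sqrt 3) = 2 * sqrt 3 * pi" by (simp add: field_simps)
    hence "3 * complex_of_real (2 * pi / sqrt 3) = of_real (2 * sqrt 3 * pi)"
      by (metis of_real_mult of_real_numeral)
    thus ?thesis using G13 by (simp add: exp_of_real)
  qed
  with lim[of "1 / 3"] have "h \<longlonglongrightarrow> of_real (2 * sqrt 3 * pi)" by simp
  from LIMSEQ_unique[OF this lim[OF assms]]
  have "of_real (2 * sqrt 3 * pi) = exp (3 * z * of_real (ln 3)) * (Gamma z * Gamma (z + 1 / 3) * Gamma (z + 2 / 3)) / Gamma (3 * z)" .
  moreover have "Gamma (3 * z) \<noteq> 0"
    using assms by (auto simp: Gamma_eq_zero_iff intro!: Re_pos_notin_nonpos_Ints dest: Re_pos_notin_nonpos_Ints)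
  ultimately show ?thesis by (simp add: exp_minus field_simps)
qed

text \<open>A substitute for Stirling's formula, uniform in Im z. In the limit product each factor
  |z + c + k| / |z + k| is, for given real part, largest on the real axis; there it equals 1 + c /
  (Re z + k), which decreases in Re z.\<close>

lemma norm_Gamma_quotient_le:
  assumes "0 < s" "s \<le> Re z" "c \<ge> 0"
  shows "norm (Gamma z * rGamma (z + of_real c)) \<le> Gamma s * rGamma (s + c)"
proof (rule LIMSEQ_le)
  show "(\<lambda>n. norm (Gamma_series z n * rGamma_series (z + of_real c) n)) \<longlonglongrightarrow> norm (Gamma z * rGamma (z + of_real c))"
    by (intro tendsto_intros)
  show "(\<lambda>n. Gamma_series s n * rGamma_series (s + c) n) \<longlonglongrightarrow> Gamma s * rGamma (s + c)"
    by (intro tendsto_intros)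
  have "norm (Gamma_series z n * rGamma_series (z + of_real c) n) \<le> Gamma_series s n * rGamma_series (s + c) n"
    for n
  proof -
    have "cmod (z + of_real c + of_nat k) / cmod (z + of_nat k) \<le> (s + c + real k) / (s + real k)" for k
    proof -
      define a b where "a = Re z + real k" and "b = Im z"
      have a: "a \<ge> s + real k" "a > 0" using assms by (auto simp: a_def)
      have "((a + c)\<^sup>2 + b\<^sup>2) * a\<^sup>2 \<le> (a + c)\<^sup>2 * (a\<^sup>2 + b\<^sup>2)"
        using mult_left_mono[of "a\<^sup>2" "(a + c)\<^sup>2" "b\<^sup>2"] power_mono[of a "a + c" 2] a assms(3)
        by (simp add: algebra_simps)
      hence "sqrt ((a + c)\<^sup>2 + b\<^sup>2) * a \<le> (a + c) * sqrt (a\<^sup>2 + b\<^sup>2)"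
        using a assms(3) real_sqrt_le_mono[of "((a + c)\<^sup>2 + b\<^sup>2) * a\<^sup>2" "(a + c)\<^sup>2 * (a\<^sup>2 + b\<^sup>2)"]
        by (simp add: real_sqrt_mult)
      moreover have "a\<^sup>2 + b\<^sup>2 > 0" using a by (simp add: add_pos_nonneg)
      ultimately have "sqrt ((a + c)\<^sup>2 + b\<^sup>2) / sqrt (a\<^sup>2 + b\<^sup>2) \<le> (a + c) / a"
        using a by (simp add: field_simps)
      also have "\<dots> = 1 + c / a" using a by (simp add: field_simps)
      also have "\<dots> \<le> 1 + c / (s + real k)"
        using a assms by (intro add_left_mono divide_left_mono) auto
      also have "\<dots> = (s + c + real k) / (s + real k)" using assms by (simp add: field_simps)
      finally show ?thesis
        by (simp add: cmod_def a_def b_def add_ac)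
    qed
    hence "(\<Prod>k=0..<Suc n. cmod (z + of_real c + of_nat k) / cmod (z + of_nat k))
            \<le> (\<Prod>k=0..<Suc n. (s + c + real k) / (s + real k))"
      by (intro prod_mono) auto
    hence "norm (pochhammer (z + of_real c) (n + 1)) / norm (pochhammer z (n + 1))
            \<le> pochhammer (s + c) (n + 1) / pochhammer s (n + 1)"
      by (simp only: pochhammer_prod prod_dividef prod_norm Suc_eq_plus1)
    hence "norm (pochhammer (z + of_real c) (n + 1)) / norm (pochhammer z (n + 1)) * exp (- c * ln (real n))
       \<le> pochhammer (s + c) (n + 1) / pochhammer s (n + 1) * exp (- c * ln (real n))"
      by (intro mult_right_mono) auto
    moreover have "norm (Gamma_series z n * rGamma_series (z + of_real c) n)
       = norm (pochhammer (z + of_real c) (n + 1)) / norm (pochhammer z (n + 1)) * exp (- c * ln (real n))"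
      by (simp add: Gamma_series_def rGamma_series_def norm_mult norm_divide exp_add algebra_simps
          exp_minus field_simps)
    moreover have "Gamma_series s n * rGamma_series (s + c) n
       = pochhammer (s + c) (n + 1) / pochhammer s (n + 1) * exp (- c * ln (real n))"
      by (simp add: Gamma_series_def rGamma_series_def exp_add algebra_simps exp_minus field_simps)
    ultimately show ?thesis by simp
  qed
  thus "\<exists>N. \<forall>n\<ge>N. norm (Gamma_series z n * rGamma_series (z + of_real c) n) \<le> Gamma_series s n * rGamma_series (s + c) n"
    by blast
qed

text \<open>Legendre duplication and Gauss triplication turn the quotient in
  \<open>P_eq_Gamma\<close> into five Gamma factors against the fifth power of 1/Gamma(z + 1/2).
  This form shows the geometric rate 27/64 = 3^3 / 2^6 next to polynomial growth, and that -1/6 is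
  the only pole in Re z > -5/6.\<close>

definition P :: "complex \<Rightarrow> complex" where
  "P z = of_real (pi powr (3 / 2) / 2) * exp (z * of_real (ln (27 / 64))) *
     Gamma (z + 1 / 6) * Gamma (z + 5 / 6) * Gamma (z + 1) ^ 3 * rGamma (z + 1 / 2) ^ 5"

lemma P_eq_Gamma:
  assumes "Re z > - 1 / 6"
  shows "P z = Gamma (1 + 6 * z) * Gamma (1 + z) ^ 9 / (Gamma (1 + 3 * z) * Gamma (1 + 2 * z) ^ 6)"
proof -
  have nz: "Gamma (1 + 6 * z) \<noteq> 0" "Gamma (1 + z) \<noteq> 0" "Gamma (1 + 3 * z) \<noteq> 0" "Gamma (1 + 2 * z) \<noteq> 0"
      "Gamma (1 / 2 + z) \<noteq> 0"
    using assms by (auto simp: Gamma_eq_zero_iff dest: Re_pos_notin_nonpos_Ints[THEN notE, rotated])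
  let ?e = "\<lambda>a. exp (a * complex_of_real (ln 2))"
  have d1: "Gamma (1 / 2 + 3 * z) * Gamma (1 + 3 * z) = ?e (- 6 * z) * of_real (sqrt pi) * Gamma (1 + 6 * z)"
  proof -
    have "1 / 2 + 3 * z \<notin> \<int>\<^sub>\<le>\<^sub>0" "1 / 2 + 3 * z + 1 / 2 \<notin> \<int>\<^sub>\<le>\<^sub>0"
      using assms by (auto intro!: Re_pos_notin_nonpos_Ints)
    from Gamma_legendre_duplication[OF this] show ?thesis by (simp add: algebra_simps)
  qed
  have d2: "Gamma (1 / 2 + z) * Gamma (1 + z) = ?e (- 2 * z) * of_real (sqrt pi) * Gamma (1 + 2 * z)"
  proof -
    have "1 / 2 + z \<notin> \<int>\<^sub>\<le>\<^sub>0" "1 / 2 + z + 1 / 2 \<notin> \<int>\<^sub>\<le>\<^sub>0"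
      using assms by (auto intro!: Re_pos_notin_nonpos_Ints)
    from Gamma_legendre_duplication[OF this] show ?thesis by (simp add: algebra_simps)
  qed
  \<comment> \<open>The triplication at z + 1/6 involves precisely the arguments z + 1/6, z + 1/2
    and z + 5/6; the Gamma(3z + 1/2) that it produces is removed by \<open>d1\<close>.\<close>
  have t: "Gamma (z + 1 / 6) * Gamma (1 / 2 + z) * Gamma (z + 5 / 6)
      = of_real (2 * sqrt 3 * pi) * exp (- (3 * z + 1 / 2) * of_real (ln 3)) * Gamma (1 / 2 + 3 * z)"
    using Gamma_triplication[of "z + 1 / 6"] assms by (simp add: algebra_simps)
  have e: "exp (z * of_real (ln (27 / 64))) = exp (3 * z * of_real (ln 3)) * ?e (- 6 * z)"
  proof -
    have "ln (27 / 64 :: real) = ln (3 ^ 3 / 2 ^ 6)" by simp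
    also have "\<dots> = 3 * ln 3 - 6 * ln 2" by (simp only: ln_div ln_realpow) (simp add: ln_div ln_realpow)
    finally have "ln (27 / 64 :: real) = 3 * ln 3 - 6 * ln 2" .
    thus ?thesis by (simp only: of_real_diff of_real_mult) (simp add: exp_add[symmetric] algebra_simps)
  qed
  define a b g G1 G2 G3 G6 where "a = Gamma (z + 1 / 6)" and "b = Gamma (z + 5 / 6)"
    and "g = Gamma (1 / 2 + z)" and "G1 = Gamma (1 + z)" and "G2 = Gamma (1 + 2 * z)"
    and "G3 = Gamma (1 + 3 * z)" and "G6 = Gamma (1 + 6 * z)"
  define E3 F sp s3 where "E3 = exp (3 * z * of_real (ln 3))" and "F = ?e (- 2 * z)"
    and "sp = complex_of_real (sqrt pi)" and "s3 = complex_of_real (sqrt 3)"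
  note defs = a_def b_def g_def G1_def G2_def G3_def G6_def E3_def F_def sp_def s3_def
  have [simp]: "g \<noteq> 0" "G1 \<noteq> 0" "G2 \<noteq> 0" "G3 \<noteq> 0" "E3 \<noteq> 0" "F \<noteq> 0" "sp \<noteq> 0" "s3 \<noteq> 0"
    using nz by (auto simp: defs)
  have F3: "?e (- 6 * z) = F ^ 3"
    by (simp add: F_def exp_of_nat_mult[symmetric] algebra_simps)
  have s3: "exp (- (3 * z + 1 / 2) * of_real (ln 3)) = 1 / (E3 * s3)"
  proof -
    have "s3 = exp (of_real (ln 3) / 2)"
      by (simp add: s3_def powr_half_sqrt[symmetric] powr_def exp_of_real[symmetric])
    hence "E3 * s3 = exp (3 * z * of_real (ln 3) + of_real (ln 3) / 2)"
      by (simp add: E3_def exp_add)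
    moreover have "exp (- (3 * z + 1 / 2) * of_real (ln 3)) = exp (- (3 * z * of_real (ln 3) + of_real (ln 3) / 2))"
      by (rule arg_cong[of _ _ exp]) (simp add: algebra_simps)
    ultimately show ?thesis by (simp only: exp_minus inverse_eq_divide)
  qed
  define H where "H = Gamma (1 / 2 + 3 * z)"
  have "H * G3 = F ^ 3 * sp * G6"
    using d1 unfolding F3 H_def G3_def G6_def sp_def .
  hence H: "H = F ^ 3 * sp * G6 / G3" by (simp add: eq_divide_eq)
  have ab: "a * b = 2 * sp ^ 2 * F ^ 3 * sp * G6 / (E3 * G3 * g)"
  proof -
    have "complex_of_real (2 * sqrt 3 * pi) = 2 * s3 * sp ^ 2"
      by (simp add: s3_def sp_def flip: of_real_power)
    with t have "a * g * b = 2 * s3 * sp ^ 2 * (1 / (E3 * s3)) * H"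
      unfolding s3 a_def b_def g_def H_def by (simp only:)
    thus ?thesis unfolding H by (simp add: field_simps)
  qed
  have G2': "G2 = g * G1 / (F * sp)"
  proof -
    have "g * G1 = F * sp * G2"
      using d2 unfolding g_def G1_def G2_def F_def sp_def .
    thus ?thesis by (simp add: field_simps)
  qed
  have c: "complex_of_real (pi powr (3 / 2) / 2) = sp ^ 3 / 2"
  proof -
    have "pi powr (3 / 2) = (pi powr (1 / 2)) ^ 3"
      by (simp add: powr_powr flip: powr_realpow)
    thus ?thesis by (simp add: sp_def powr_half_sqrt)
  qed
  have r: "rGamma (z + 1 / 2) = 1 / g"
    by (simp add: g_def Gamma_def add.commute inverse_eq_divide)
  have "P z = sp ^ 3 / 2 * (E3 * F ^ 3) * (a * b) * G1 ^ 3 * (1 / g) ^ 5"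
    unfolding P_def c e r F3 by (simp add: defs add.commute)
  also have "\<dots> = G6 * G1 ^ 9 / (G3 * G2 ^ 6)"
    unfolding ab G2' by (simp add: field_simps) (intro disjI2, algebra)
  finally show ?thesis by (simp add: defs)
qed

lemma P_plus1:
  assumes "z + 1 / 6 \<notin> \<int>\<^sub>\<le>\<^sub>0" "z + 5 / 6 \<notin> \<int>\<^sub>\<le>\<^sub>0" "z + 1 \<notin> \<int>\<^sub>\<le>\<^sub>0"
  shows "8 * (2 * z + 1) ^ 5 * P (z + 1) = 3 * (6 * z + 1) * (6 * z + 5) * (z + 1) ^ 3 * P z"
proof -
  have r: "rGamma (z + 1 / 2) = (z + 1 / 2) * rGamma (z + 1 + 1 / 2)"
    using rGamma_plus1[of "z + 1 / 2"] by (simp add: add_ac)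
  have g: "Gamma (z + 1 + 1 / 6) = (z + 1 / 6) * Gamma (z + 1 / 6)"
    "Gamma (z + 1 + 5 / 6) = (z + 5 / 6) * Gamma (z + 5 / 6)" "Gamma (z + 1 + 1) = (z + 1) * Gamma (z + 1)"
    using Gamma_plus1[OF assms(1)] Gamma_plus1[OF assms(2)] Gamma_plus1[OF assms(3)] by (simp_all add: add_ac)
  have e: "exp ((z + 1) * of_real (ln (27 / 64))) = 27 / 64 * exp (z * of_real (ln (27 / 64)))"
    by (simp add: distrib_right exp_add exp_of_real)
  show ?thesis unfolding P_def e g r by (simp add: power_mult_distrib) (simp add: field_simps power_mult_distrib)
qed

text \<open>Each numerator Gamma is paired with one factor 1/Gamma(z + 1/2). Where its argument
  exceeds z + 1/2 it is first lowered by 1, at the price of a factor of size |z|: once for z + 5/6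
  and three times for z + 1, hence the exponent 4.\<close>

lemma P_norm_bound:
  obtains C where "C > 0" "\<And>z. Re z \<ge> 1 / 4 \<Longrightarrow> norm (P z) \<le> C * (27 / 64) powr Re z * (1 + norm z) ^ 4"
proof -
  define A where "A = Gamma (1 / 4) * rGamma (1 / 4 + 1 / 3 :: real)"
  define B where "B = Gamma (1 / 12) * rGamma (1 / 12 + 2 / 3 :: real)"
  define D where "D = Gamma (1 / 4) * rGamma (1 / 4 + 1 / 2 :: real)"
  have pos: "A > 0" "B > 0" "D > 0"
    by (auto simp: A_def B_def D_def rGamma_inverse_Gamma intro!: mult_pos_pos Gamma_real_pos)
  have "norm (P z) \<le> (pi powr (3 / 2) / 2 * A * B * D ^ 3) * (27 / 64) powr Re z * (1 + norm z) ^ 4"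
    if z: "Re z \<ge> 1 / 4" for z
  proof -
    have a: "norm (Gamma (z + 1 / 6) * rGamma (z + 1 / 2)) \<le> A"
      using norm_Gamma_quotient_le[of "1 / 4" "z + 1 / 6" "1 / 3"] z by (simp add: A_def add.assoc)
    have b: "norm (Gamma (z + 5 / 6) * rGamma (z + 1 / 2)) \<le> B * (1 + norm z)"
    proof -
      have "z - 1 / 6 \<notin> \<int>\<^sub>\<le>\<^sub>0" using z by (intro Re_pos_notin_nonpos_Ints) simp
      from Gamma_plus1[OF this] have "Gamma (z + 5 / 6) = (z - 1 / 6) * Gamma (z - 1 / 6)"
        by (simp add: add.commute)
      moreover have "norm (Gamma (z - 1 / 6) * rGamma (z + 1 / 2)) \<le> B"
        using norm_Gamma_quotient_le[of "1 / 12" "z - 1 / 6" "2 / 3"] z by (simp add: B_def add.commute)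
      moreover have "norm (z - 1 / 6) \<le> 1 + norm z"
        using norm_triangle_ineq4[of z "1 / 6"] by simp
      ultimately show ?thesis
        using mult_mono[of "norm (Gamma (z - 1 / 6) * rGamma (z + 1 / 2))" B "norm (z - 1 / 6)" "1 + norm z"] pos
        by (simp add: norm_mult mult_ac)
    qed
    have d: "norm (Gamma (z + 1) * rGamma (z + 1 / 2)) \<le> D * (1 + norm z)"
    proof -
      have "z \<notin> \<int>\<^sub>\<le>\<^sub>0" using z by (intro Re_pos_notin_nonpos_Ints) simp
      from Gamma_plus1[OF this] have "Gamma (z + 1) = z * Gamma z" .
      moreover have "norm (Gamma z * rGamma (z + 1 / 2)) \<le> D"
        using norm_Gamma_quotient_le[of "1 / 4" z "1 / 2"] z by (simp add: D_def)
      ultimately show ?thesis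
        using mult_mono[of "norm (Gamma z * rGamma (z + 1 / 2))" D "norm z" "1 + norm z"] pos
        by (simp add: norm_mult mult_ac)
    qed
    have e: "norm (exp (z * of_real (ln (27 / 64)))) = (27 / 64) powr Re z"
      by (simp add: powr_def)
    have "norm (P z) = pi powr (3 / 2) / 2 * (27 / 64) powr Re z * norm (Gamma (z + 1 / 6) * rGamma (z + 1 / 2))
        * norm (Gamma (z + 5 / 6) * rGamma (z + 1 / 2)) * norm (Gamma (z + 1) * rGamma (z + 1 / 2)) ^ 3"
      unfolding P_def norm_mult e norm_power
      by (simp add: power_mult_distrib eval_nat_numeral)
    also have "\<dots> \<le> pi powr (3 / 2) / 2 * (27 / 64) powr Re z * A * (B * (1 + norm z)) * (D * (1 + norm z)) ^ 3"
      using pos by (intro mult_mono a b d power_mono mult_nonneg_nonneg) auto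
    also have "\<dots> = (pi powr (3 / 2) / 2 * A * B * D ^ 3) * (27 / 64) powr Re z * (1 + norm z) ^ 4"
      by (simp add: power_mult_distrib eval_nat_numeral)
    finally show ?thesis .
  qed
  moreover have "pi powr (3 / 2) / 2 * A * B * D ^ 3 > 0" using pos by simp
  ultimately show ?thesis using that by blast
qed

text \<open>The shift equation \<open>P_plus1\<close> carries the bound one unit to the left. For
  |Im z| >= 1 the factors to divide by have modulus at least 1, and (2z + 1)^5 raises the exponent
  from 4 to 9.\<close>

lemma P_strip_bound:
  obtains C where "C > 0"
    "\<And>z. Re z \<ge> - 3 / 4 \<Longrightarrow> \<bar>Im z\<bar> \<ge> 1 \<Longrightarrow> norm (P z) \<le> C * (1 + norm z) ^ 9"
proof -
  obtain C where C: "C > 0" "\<And>z. Re z \<ge> 1 / 4 \<Longrightarrow> norm (P z) \<le> C * (27 / 64) powr Re z * (1 + norm z) ^ 4"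
    using P_norm_bound by blast
  have "norm (P z) \<le> (8 * 2 ^ 5 * C * 2 ^ 4) * (1 + norm z) ^ 9"
    if z: "Re z \<ge> - 3 / 4" "\<bar>Im z\<bar> \<ge> 1" for z
  proof -
    have im: "w \<notin> \<int>\<^sub>\<le>\<^sub>0" if "Im w \<noteq> 0" for w using that by (auto elim!: nonpos_Ints_cases)
    have "8 * (2 * z + 1) ^ 5 * P (z + 1) = 3 * (6 * z + 1) * (6 * z + 5) * (z + 1) ^ 3 * P z"
      using z by (intro P_plus1 im) auto
    hence eq: "8 * norm (2 * z + 1) ^ 5 * norm (P (z + 1))
         = 3 * norm (6 * z + 1) * norm (6 * z + 5) * norm (z + 1) ^ 3 * norm (P z)"
      by (metis (no_types, lifting) norm_mult norm_numeral norm_power)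
    have ge: "norm (6 * z + 1) \<ge> 1" "norm (6 * z + 5) \<ge> 1" "norm (z + 1) \<ge> 1"
      using z abs_Im_le_cmod[of "6 * z + 1"] abs_Im_le_cmod[of "6 * z + 5"] abs_Im_le_cmod[of "z + 1"] by simp_all
    have "1 \<le> norm (6 * z + 1) * norm (6 * z + 5) * norm (z + 1) ^ 3"
      using ge by (intro mult_ge1_I one_le_power) auto
    hence "norm (P z) * 1 \<le> norm (P z) * (3 * (norm (6 * z + 1) * norm (6 * z + 5) * norm (z + 1) ^ 3))"
      by (intro mult_left_mono) auto
    also have "\<dots> = 8 * norm (2 * z + 1) ^ 5 * norm (P (z + 1))" using eq by (simp add: mult_ac)
    also have "\<dots> \<le> 8 * (2 * (1 + norm z)) ^ 5 * (C * 1 * (2 * (1 + norm z)) ^ 4)"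
    proof (intro mult_mono power_mono)
      show "norm (2 * z + 1) \<le> 2 * (1 + norm z)" using norm_triangle_ineq[of "2 * z" 1] by simp
      have "norm (P (z + 1)) \<le> C * (27 / 64) powr Re (z + 1) * (1 + norm (z + 1)) ^ 4"
        using z by (intro C) simp
      also have "\<dots> \<le> C * 1 * (2 * (1 + norm z)) ^ 4"
      proof (intro mult_mono power_mono)
        have "(27 / 64 :: real) powr Re (z + 1) \<le> (27 / 64) powr 0"
          using z by (intro powr_mono') auto
        thus "(27 / 64 :: real) powr Re (z + 1) \<le> 1" by simp
        show "1 + norm (z + 1) \<le> 2 * (1 + norm z)"
          using norm_triangle_ineq[of z 1] norm_ge_zero[of z] by (simp del: norm_ge_zero)
      qed (use C in auto)
      finally show "norm (P (z + 1)) \<le> C * 1 * (2 * (1 + norm z)) ^ 4" .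
    qed auto
    also have "\<dots> = (8 * 2 ^ 5 * C * 2 ^ 4) * (1 + norm z) ^ 9"
      unfolding power_mult_distrib by (simp add: power_add[symmetric])
    finally show ?thesis by simp
  qed
  thus ?thesis using C(1) that[of "8 * 2 ^ 5 * C * 2 ^ 4"] by simp
qed

lemma P_holomorphic: "P holomorphic_on {z. Re z > - 5 / 6} - {- 1 / 6}"
proof -
  have "z + 1 / 6 \<notin> \<int>\<^sub>\<le>\<^sub>0" "z + 5 / 6 \<notin> \<int>\<^sub>\<le>\<^sub>0" "z + 1 \<notin> \<int>\<^sub>\<le>\<^sub>0" if "Re z > - 5 / 6" "z \<noteq> - 1 / 6" for z
  proof -
    show "z + 1 / 6 \<notin> \<int>\<^sub>\<le>\<^sub>0"
    proof
      assume "z + 1 / 6 \<in> \<int>\<^sub>\<le>\<^sub>0"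
      then obtain n where n: "z + 1 / 6 = - of_nat n" by (rule nonpos_Ints_cases')
      hence "Re z + 1 / 6 = - real n" by (metis Re_complex_of_real uminus_complex.simps(1) of_real_of_nat_eq plus_complex.simps(1) Re_divide_numeral one_complex.simps(1))
      hence "n = 0" using that by linarith
      thus False using n that by (simp add: eq_neg_iff_add_eq_0)
    qed
    show "z + 5 / 6 \<notin> \<int>\<^sub>\<le>\<^sub>0" "z + 1 \<notin> \<int>\<^sub>\<le>\<^sub>0"
      using that by (auto intro!: Re_pos_notin_nonpos_Ints)
  qed
  thus ?thesis unfolding P_def[abs_def]
    by (intro holomorphic_intros) auto
qed

section \<open>The summand and the series \<open>S\<close>\<close>

definition fc :: "complex \<Rightarrow> complex" where
  "fc z = (74 * z ^ 2 - 47 * z + 8) * P z / ((6 * z - 1) * z ^ 3)"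

lemma f15_eq_fc:
  assumes "x > 1 / 6"
  shows "complex_of_real (f15 x) = fc (of_real x)"
proof -
  let ?z = "complex_of_real x"
  have G: "Gamma (1 + 6 * ?z) = 6 * ?z * (6 * ?z - 1) * Gamma (6 * ?z - 1)"
  proof -
    have "6 * ?z \<notin> \<int>\<^sub>\<le>\<^sub>0" "6 * ?z - 1 \<notin> \<int>\<^sub>\<le>\<^sub>0" using assms by (auto intro!: Re_pos_notin_nonpos_Ints)
    from Gamma_plus1[OF this(1)] Gamma_plus1[OF this(2)] show ?thesis by (simp add: add.commute)
  qed
  have G1: "Gamma (1 + ?z) = ?z * Gamma ?z"
    using Gamma_plus1[of ?z] Re_pos_notin_nonpos_Ints[of ?z] assms by (simp add: add.commute)
  have G3: "Gamma (1 + 3 * ?z) = 3 * ?z * Gamma (3 * ?z)"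
    using Gamma_plus1[of "3 * ?z"] Re_pos_notin_nonpos_Ints[of "3 * ?z"] assms by (simp add: add.commute)
  have G2: "Gamma (1 + 2 * ?z) = 2 * ?z * Gamma (2 * ?z)"
    using Gamma_plus1[of "2 * ?z"] Re_pos_notin_nonpos_Ints[of "2 * ?z"] assms by (simp add: add.commute)
  have nz: "Gamma ?z \<noteq> 0" "Gamma (3 * ?z) \<noteq> 0" "Gamma (2 * ?z) \<noteq> 0" "?z \<noteq> 0" "6 * ?z - 1 \<noteq> 0"
    using assms Re_pos_notin_nonpos_Ints[of "2 * ?z"] Re_pos_notin_nonpos_Ints[of "3 * ?z"]
      Re_pos_notin_nonpos_Ints[of ?z] Re_pos_notin_nonpos_Ints[of "6 * ?z - 1"]
    by (auto simp: Gamma_eq_zero_iff)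
  have "fc ?z = (74 * ?z ^ 2 - 47 * ?z + 8) * (6 * ?z * (6 * ?z - 1) * Gamma (6 * ?z - 1) * (?z * Gamma ?z) ^ 9
           / (3 * ?z * Gamma (3 * ?z) * (2 * ?z * Gamma (2 * ?z)) ^ 6)) / ((6 * ?z - 1) * ?z ^ 3)"
    using assms by (simp add: fc_def P_eq_Gamma G G1 G2 G3)
  \<comment> \<open>The constant 32 is 3 * 2^6 / 6, left over from lowering the Gamma arguments; the
    powers of z cancel as 1 + 9 = 1 + 6 + 3.\<close>
  also have "\<dots> = (74 * ?z ^ 2 - 47 * ?z + 8) * Gamma (6 * ?z - 1) * Gamma ?z ^ 9 /
                     (32 * Gamma (3 * ?z) * Gamma (2 * ?z) ^ 6)"
    using nz by (simp add: divide_simps power_mult_distrib)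
  also have "\<dots> = complex_of_real (f15 x)"
    unfolding f15_def by (simp flip: Gamma_complex_of_real)
  finally show ?thesis ..
qed

lemma fc_norm_bound:
  obtains C where "C > 0" "\<And>z. Re z \<ge> 1 / 4 \<Longrightarrow> norm (fc z) \<le> C * (27 / 64) powr Re z * (1 + norm z) ^ 6"
proof -
  obtain C where C: "C > 0" "\<And>z. Re z \<ge> 1 / 4 \<Longrightarrow> norm (P z) \<le> C * (27 / 64) powr Re z * (1 + norm z) ^ 4"
    using P_norm_bound by blast
  have "norm (fc z) \<le> (129 * 128 * C) * (27 / 64) powr Re z * (1 + norm z) ^ 6" if z: "Re z \<ge> 1 / 4" for z
  proof -
    have "norm (74 * z ^ 2 - 47 * z + 8) \<le> 74 * norm z ^ 2 + 47 * norm z + 8"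
      using norm_triangle_ineq[of "74 * z ^ 2 - 47 * z" 8] norm_triangle_ineq4[of "74 * z ^ 2" "47 * z"]
      by (simp add: norm_mult norm_power)
    also have "\<dots> \<le> 129 * (1 + norm z) ^ 2" by (simp add: power2_eq_square algebra_simps)
    finally have 1: "norm (74 * z ^ 2 - 47 * z + 8) \<le> 129 * (1 + norm z) ^ 2" .
    have "norm (6 * z - 1) \<ge> 1 / 2" using z complex_Re_le_cmod[of "6 * z - 1"] by simp
    moreover have "norm z ^ 3 \<ge> (1 / 4) ^ 3" using z complex_Re_le_cmod[of z] by (intro power_mono) auto
    ultimately have "norm (6 * z - 1) * norm z ^ 3 \<ge> 1 / 2 * (1 / 4) ^ 3" by (intro mult_mono) auto
    hence 2: "norm ((6 * z - 1) * z ^ 3) \<ge> 1 / 128" by (simp add: norm_mult norm_power power3_eq_cube)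
    have "norm (fc z) = norm (74 * z ^ 2 - 47 * z + 8) * norm (P z) / norm ((6 * z - 1) * z ^ 3)"
      by (simp add: fc_def norm_mult norm_divide)
    also have "\<dots> \<le> 129 * (1 + norm z) ^ 2 * (C * (27 / 64) powr Re z * (1 + norm z) ^ 4) / (1 / 128)"
      using C z 1 2 by (intro frac_le mult_mono) auto
    also have "\<dots> = (129 * 128 * C) * (27 / 64) powr Re z * (1 + norm z) ^ 6"
      by (simp add: eval_nat_numeral)
    finally show ?thesis .
  qed
  thus ?thesis using C(1) that[of "129 * 128 * C"] by simp
qed

definition S :: "complex \<Rightarrow> complex" where
  "S z = (\<Sum>k. fc (z + 1 + of_nat k))"

text \<open>The dependence on z and on k is separated, so that one summable majorant gives
  convergence, local uniformity and the polynomial growth of \<open>S\<close>.\<close>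

lemma S_bounds:
  obtains M where "summable M" "\<And>k. M k \<ge> 0"
    "\<And>z k. Re z \<ge> - 3 / 4 \<Longrightarrow> norm (fc (z + 1 + of_nat k)) \<le> (1 + norm z) ^ 6 * M k"
proof -
  obtain C where C: "C > 0" "\<And>z. Re z \<ge> 1 / 4 \<Longrightarrow> norm (fc z) \<le> C * (27 / 64) powr Re z * (1 + norm z) ^ 6"
    using fc_norm_bound by blast
  define M where "M k = C * ((27 / 64) ^ k * real (k + 2) ^ 6)" for k
  have "summable (\<lambda>k. (27 / 64) ^ k * real (k + 2) ^ 6)"
  proof (rule summable_comparison_test_bigo)
    show "summable (\<lambda>k. norm ((1 / 2 :: real) ^ k))" by (simp add: summable_geometric)
    show "(\<lambda>k. (27 / 64) ^ k * real (k + 2) ^ 6) \<in> O(\<lambda>k. (1 / 2) ^ k)" by real_asymp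
  qed
  hence "summable M" unfolding M_def by (rule summable_mult)
  moreover have "norm (fc (z + 1 + of_nat k)) \<le> (1 + norm z) ^ 6 * M k" if z: "Re z \<ge> - 3 / 4" for z k
  proof -
    have "norm (fc (z + 1 + of_nat k)) \<le> C * (27 / 64) powr Re (z + 1 + of_nat k) * (1 + norm (z + 1 + of_nat k)) ^ 6"
      using z by (intro C) auto
    also have "\<dots> \<le> C * (27 / 64) powr real k * (real (k + 2) * (1 + norm z)) ^ 6"
    proof (intro mult_mono power_mono)
      show "(27 / 64 :: real) powr Re (z + 1 + of_nat k) \<le> (27 / 64) powr real k"
        using z by (intro powr_mono') auto
      have "norm (z + 1 + of_nat k) \<le> norm z + 1 + real k"
        using norm_triangle_ineq[of "z + 1" "of_nat k"] norm_triangle_ineq[of z 1] by simp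
      moreover have "real (k + 2) * (1 + norm z) = real k + 2 + norm z * real k + 2 * norm z"
        by (simp add: algebra_simps)
      moreover have "norm z * real k \<ge> 0" "norm z \<ge> 0" by auto
      ultimately show "1 + norm (z + 1 + of_nat k) \<le> real (k + 2) * (1 + norm z)"
        by linarith
    qed (use C in auto)
    also have "\<dots> = (1 + norm z) ^ 6 * M k"
      by (simp add: M_def powr_realpow power_mult_distrib mult_ac)
    finally show ?thesis .
  qed
  moreover have "M k \<ge> 0" for k using C by (simp add: M_def)
  ultimately show ?thesis using that by blast
qed

lemma fc_summable:
  assumes "Re z \<ge> - 3 / 4"
  shows "summable (\<lambda>k. norm (fc (z + 1 + of_nat k)))"
proof -
  obtain M where M: "summable M" "\<And>z k. Re z \<ge> - 3 / 4 \<Longrightarrow> norm (fc (z + 1 + of_nat k)) \<le> (1 + norm z) ^ 6 * M k"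
    using S_bounds by metis
  show ?thesis
    by (rule summable_comparison_test'[OF summable_mult[OF M(1), of "(1 + norm z) ^ 6"], of 0])
      (use M(2)[OF assms] in simp)
qed

lemma S_rec:
  assumes "Re z \<ge> - 3 / 4"
  shows "S z = fc (z + 1) + S (z + 1)"
proof -
  have "S z = fc (z + 1 + of_nat 0) + (\<Sum>k. fc (z + 1 + of_nat (Suc k)))"
    unfolding S_def using suminf_split_head[OF summable_norm_cancel[OF fc_summable[OF assms]]] by simp
  thus ?thesis by (simp add: S_def algebra_simps)
qed

lemma S_norm_bound:
  obtains C where "C > 0" "\<And>z. Re z \<ge> - 3 / 4 \<Longrightarrow> norm (S z) \<le> C * (1 + norm z) ^ 6"
proof -
  obtain M where M: "summable M" "\<And>k. M k \<ge> 0"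
    "\<And>z k. Re z \<ge> - 3 / 4 \<Longrightarrow> norm (fc (z + 1 + of_nat k)) \<le> (1 + norm z) ^ 6 * M k"
    using S_bounds by metis
  have "norm (S z) \<le> (suminf M + 1) * (1 + norm z) ^ 6" if z: "Re z \<ge> - 3 / 4" for z
  proof -
    have "norm (S z) \<le> (\<Sum>k. norm (fc (z + 1 + of_nat k)))"
      unfolding S_def by (rule summable_norm[OF fc_summable[OF z]])
    also have "\<dots> \<le> (\<Sum>k. (1 + norm z) ^ 6 * M k)"
      using M(3)[OF z] by (rule suminf_le[OF _ fc_summable[OF z] summable_mult[OF M(1)]])
    also have "\<dots> = (1 + norm z) ^ 6 * suminf M" by (rule suminf_mult[OF M(1)])
    also have "\<dots> \<le> (suminf M + 1) * (1 + norm z) ^ 6" by (simp add: algebra_simps)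
    finally show ?thesis .
  qed
  moreover have "suminf M + 1 > 0" using suminf_nonneg[OF M(1) M(2)] by linarith
  ultimately show ?thesis using that by blast
qed

lemma fc_holomorphic: "fc holomorphic_on {z. Re z > 1 / 6}"
proof -
  have "P holomorphic_on {z. Re z > 1 / 6}"
    by (rule holomorphic_on_subset[OF P_holomorphic]) auto
  moreover have "6 * z - 1 \<noteq> 0" "z \<noteq> 0" if "Re z > 1 / 6" for z
    using that by (auto simp: complex_eq_iff)
  ultimately show ?thesis unfolding fc_def[abs_def] by (intro holomorphic_intros) auto
qed

lemma S_uniform_limit:
  assumes "K \<subseteq> {z. Re z \<ge> - 3 / 4}" "bounded K"
  shows "uniform_limit K (\<lambda>N z. \<Sum>k<N. fc (z + 1 + of_nat k)) S sequentially"
proof -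
  obtain M where M: "summable M" "\<And>k. M k \<ge> 0"
    "\<And>z k. Re z \<ge> - 3 / 4 \<Longrightarrow> norm (fc (z + 1 + of_nat k)) \<le> (1 + norm z) ^ 6 * M k"
    using S_bounds by metis
  obtain B where B: "\<And>z. z \<in> K \<Longrightarrow> norm z \<le> B" using assms(2) by (auto simp: bounded_iff)
  show ?thesis unfolding S_def[abs_def]
  proof (rule Weierstrass_m_test)
    show "summable (\<lambda>k. (1 + B) ^ 6 * M k)" using M(1) by (rule summable_mult)
    fix k z assume z: "z \<in> K"
    have "norm (fc (z + 1 + of_nat k)) \<le> (1 + norm z) ^ 6 * M k" using z assms M by auto
    also have "\<dots> \<le> (1 + B) ^ 6 * M k"
      using B[OF z] M(2) by (intro mult_right_mono power_mono) auto
    finally show "norm (fc (z + 1 + of_nat k)) \<le> (1 + B) ^ 6 * M k" .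
  qed
qed

lemma fc_shift_holomorphic: "(\<lambda>z. \<Sum>k<N. fc (z + 1 + of_nat k)) holomorphic_on {z. Re z > - 3 / 4}"
  by (intro holomorphic_on_sum holomorphic_on_compose_gen[OF _ fc_holomorphic, unfolded o_def] holomorphic_intros) auto

lemma S_holomorphic: "S holomorphic_on {z. Re z > - 3 / 4}"
proof (rule holomorphic_uniform_sequence)
  show "open {z. Re z > - 3 / 4}" by (simp add: open_halfspace_Re_gt)
  show "(\<lambda>z. \<Sum>k<N. fc (z + 1 + of_nat k)) holomorphic_on {z. Re z > - 3 / 4}" for N
    by (rule fc_shift_holomorphic)
  fix z assume "z \<in> {z. Re z > - 3 / 4}"
  then obtain d where d: "d > 0" "cball z d \<subseteq> {z. Re z > - 3 / 4}"
    using open_contains_cball[of "{z. Re z > - 3 / 4}"] by (auto simp: open_halfspace_Re_gt)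
  have "uniform_limit (cball z d) (\<lambda>N z. \<Sum>k<N. fc (z + 1 + of_nat k)) S sequentially"
    using d(2) by (intro S_uniform_limit bounded_cball) auto
  thus "\<exists>d>0. cball z d \<subseteq> {z. Re z > - 3 / 4} \<and>
          uniform_limit (cball z d) (\<lambda>N z. \<Sum>k<N. fc (z + 1 + of_nat k)) S sequentially"
    using d by blast
qed

section \<open>The well-poised sum \<open>V\<close> and its continuation\<close>

definition tau :: "complex \<Rightarrow> nat \<Rightarrow> complex" where
  "tau z n = (\<Prod>j=1..<n. (of_nat j + z) / (of_nat j - z))"

definition vt :: "complex \<Rightarrow> nat \<Rightarrow> complex" where
  "vt z n = of_nat n * (tau z n / (of_nat n - z)) ^ 3"

text \<open>The remainder of the summation by parts in \<open>sum_vt\<close>. Two additional powers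
  of n in the denominator carry convergence past Re z = 1/6.\<close>

definition H :: "complex \<Rightarrow> complex" where
  "H z = (\<Sum>n. vt z n / (4 * of_nat n ^ 2 - 1))"

text \<open>The continuation of \<open>\<Sum>n. vt z n\<close>, which converges only for \<open>Re z < 1/6\<close>.\<close>

definition V :: "complex \<Rightarrow> complex" where
  "V z = (2 - (1 - 2 * z) ^ 3 * H z) / (1 - 6 * z)"

lemma tau_Suc: "n \<ge> 1 \<Longrightarrow> tau z (Suc n) = tau z n * ((of_nat n + z) / (of_nat n - z))"
  by (simp add: tau_def)

lemma tau_1: "tau z 1 = 1" "tau z (Suc 0) = 1"
  by (simp_all add: tau_def)

lemma of_nat_neq_Re_less_1: "n \<ge> 1 \<Longrightarrow> Re z < 1 \<Longrightarrow> of_nat n - z \<noteq> 0"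
  by (auto simp: complex_eq_iff)

lemma of_nat_half: "of_nat n - 1 / 2 \<noteq> (0 :: complex)" "of_nat n + 1 / 2 \<noteq> (0 :: complex)"
  "4 * of_nat n ^ 2 - 1 \<noteq> (0 :: complex)"
proof -
  have "2 * int n \<noteq> 1" by presburger
  hence 1: "2 * real n \<noteq> 1" by (metis of_int_eq_iff of_int_mult of_int_numeral of_int_of_nat_eq of_int_1)
  thus "of_nat n - 1 / 2 \<noteq> (0 :: complex)" by (auto simp: complex_eq_iff)
  show "of_nat n + 1 / 2 \<noteq> (0 :: complex)" by (auto simp: complex_eq_iff)
  have "4 * of_nat n ^ 2 - 1 = (2 * of_nat n - 1) * (2 * of_nat n + 1 :: complex)"
    by (simp add: algebra_simps power2_eq_square)
  moreover have "2 * of_nat n - 1 \<noteq> (0 :: complex)" "2 * of_nat n + 1 \<noteq> (0 :: complex)"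
    using 1 by (auto simp: complex_eq_iff)
  ultimately show "4 * of_nat n ^ 2 - 1 \<noteq> (0 :: complex)" by simp
qed

text \<open>Summation by parts against tau^3 / (n - 1/2). The centre 1/2 makes (c - z)^3 (c + 1/2) -
  (c + z)^3 (c - 1/2) odd in c, so it is c times an even quadratic. Dividing that quadratic by c^2 -
  1/4 returns the summand with factor 1 - 6z and leaves a remainder that decays faster by
  n^(-2).\<close>

lemma sum_vt:
  assumes "Re z < 1" "N \<ge> 1"
  shows "(1 - 6 * z) * (\<Sum>n<N. vt z n)
     = 2 - tau z N ^ 3 / (of_nat N - 1 / 2) - (1 - 2 * z) ^ 3 * (\<Sum>n<N. vt z n / (4 * of_nat n ^ 2 - 1))"
  using assms(2)
proof (induction N rule: nat_induct_at_least)
  case base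
  show ?case by (simp add: vt_def tau_1)
next
  case (Suc n)
  define c t where "c = (of_nat n :: complex)" and "t = tau z n"
  have nz: "c - z \<noteq> 0" "c - 1 / 2 \<noteq> 0" "c + 1 / 2 \<noteq> 0" "4 * c ^ 2 - 1 \<noteq> 0"
    using of_nat_neq_Re_less_1[of n z] of_nat_half[of n] Suc.hyps assms(1) by (auto simp: c_def)
  have step: "t ^ 3 / (c - 1 / 2) - (t * ((c + z) / (c - z))) ^ 3 / (c + 1 / 2)
      = c * (t / (c - z)) ^ 3 * ((1 - 6 * z) + (1 - 2 * z) ^ 3 / (4 * c ^ 2 - 1))"
  proof -
    have f: "4 * c ^ 2 - 1 = 4 * ((c - 1 / 2) * (c + 1 / 2))" by (simp add: power2_eq_square algebra_simps)
    have "t ^ 3 / (c - 1 / 2) - (t * ((c + z) / (c - z))) ^ 3 / (c + 1 / 2)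
        = (t / (c - z)) ^ 3 * ((c - z) ^ 3 / (c - 1 / 2) - (c + z) ^ 3 / (c + 1 / 2))"
      using nz by (simp add: power_mult_distrib power_divide right_diff_distrib)
    also have "(c - z) ^ 3 / (c - 1 / 2) - (c + z) ^ 3 / (c + 1 / 2)
        = ((c - z) ^ 3 * (c + 1 / 2) - (c + z) ^ 3 * (c - 1 / 2)) / ((c - 1 / 2) * (c + 1 / 2))"
      using nz by (simp add: diff_frac_eq)
    also have "(c - z) ^ 3 * (c + 1 / 2) - (c + z) ^ 3 * (c - 1 / 2)
        = c * ((1 - 6 * z) * ((c - 1 / 2) * (c + 1 / 2)) + (1 - 2 * z) ^ 3 / 4)"
      by (simp add: power3_eq_cube field_simps)
    also have "c * ((1 - 6 * z) * ((c - 1 / 2) * (c + 1 / 2)) + (1 - 2 * z) ^ 3 / 4) / ((c - 1 / 2) * (c + 1 / 2))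
        = c * ((1 - 6 * z) + (1 - 2 * z) ^ 3 / (4 * c ^ 2 - 1))"
    proof -
      have "c * (a * p + q / 4) / p = c * (a + q / (4 * p))" if "p \<noteq> 0" for a p q :: complex
        using that by (simp add: field_simps)
      thus ?thesis unfolding f using nz by simp
    qed
    finally show ?thesis by simp
  qed
  define v h Y where "v = vt z n" and "h = vt z n / (4 * of_nat n ^ 2 - 1)"
    and "Y = tau z (Suc n) ^ 3 / (of_nat (Suc n) - 1 / 2)"
  have "tau z (Suc n) = t * ((c + z) / (c - z))" "of_nat (Suc n) - 1 / 2 = c + 1 / 2"
    using tau_Suc[OF Suc.hyps] by (simp_all add: c_def t_def)
  moreover have "v = c * (t / (c - z)) ^ 3" by (simp add: v_def vt_def c_def t_def)
  ultimately have "tau z n ^ 3 / (of_nat n - 1 / 2) - Y = (1 - 6 * z) * v + (1 - 2 * z) ^ 3 * h"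
    using step unfolding Y_def h_def v_def[symmetric] t_def[symmetric] c_def[symmetric]
    by (simp only: distrib_left times_divide_eq_right times_divide_eq_left mult.commute)
  thus ?case using Suc.IH
    unfolding sum.lessThan_Suc h_def[symmetric] unfolding v_def[symmetric] Y_def[symmetric] by algebra
qed

text \<open>\<open>Gamma_series\<close> at n has the n + 1 factors of index 0 to n, which match the
  factors j = 1 to n + 1 of \<open>tau z (n + 2)\<close>. The two powers of n combine to
  n^(-2z).\<close>

lemma tau_asymp:
  assumes "Re z < 1"
  shows "(\<lambda>n. tau z (n + 2) * exp (- 2 * z * of_real (ln (real n)))) \<longlonglongrightarrow> Gamma (1 - z) * rGamma (1 + z)"
proof -
  have "tau z (n + 2) * exp (- 2 * z * of_real (ln (real n))) = Gamma_series (1 - z) n * rGamma_series (1 + z) n" for n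
  proof -
    have "tau z (n + 2) = (\<Prod>j=0..<n + 1. (of_nat (Suc j) + z) / (of_nat (Suc j) - z))"
      unfolding tau_def
      by (rule prod.reindex_bij_witness[of _ Suc "\<lambda>j. j - 1"]) auto
    also have "\<dots> = pochhammer (1 + z) (n + 1) / pochhammer (1 - z) (n + 1)"
      unfolding pochhammer_prod prod_dividef by (simp add: algebra_simps)
    finally have t: "tau z (n + 2) = pochhammer (1 + z) (n + 1) / pochhammer (1 - z) (n + 1)" .
    have "exp ((1 - z) * of_real (ln (real n))) / exp ((1 + z) * of_real (ln (real n)))
            = exp (- 2 * z * of_real (ln (real n)))"
      by (simp add: exp_diff[symmetric] algebra_simps)
    thus ?thesis unfolding t Gamma_series_def rGamma_series_def
      by (simp add: field_simps)
  qed
  thus ?thesis by (simp add: tendsto_intros)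
qed

lemma tau_norm_bound:
  assumes "Re z < 1"
  obtains C where "C > 0" "\<And>n. n \<ge> 1 \<Longrightarrow> norm (tau z n) \<le> C * real n powr (2 * Re z)"
proof -
  let ?f = "\<lambda>n. tau z (n + 2) * exp (- 2 * z * of_real (ln (real n)))"
  have "bounded (range ?f)"
    using tau_asymp[OF assms] by (intro convergent_imp_bounded)
  then obtain B where B: "\<And>n. norm (?f n) \<le> B" by (auto simp: bounded_iff)
  have "(\<lambda>n. real n powr (2 * Re z) / real (n + 2) powr (2 * Re z)) \<longlonglongrightarrow> 1"
    by real_asymp
  hence "bounded (range (\<lambda>n. real n powr (2 * Re z) / real (n + 2) powr (2 * Re z)))"
    by (intro convergent_imp_bounded)
  then obtain B' where B': "\<And>n. norm (real n powr (2 * Re z) / real (n + 2) powr (2 * Re z)) \<le> B'"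
    by (auto simp: bounded_iff)
  have B0: "B \<ge> 0" "B' \<ge> 0" using B[of 0] B'[of 0] norm_ge_zero order_trans by blast+
  have large: "norm (tau z (n + 2)) \<le> B * B' * real (n + 2) powr (2 * Re z)" if "n \<ge> 1" for n
  proof -
    have "norm (?f n) = norm (tau z (n + 2)) * real n powr (- 2 * Re z)"
      using that by (simp add: norm_mult powr_def)
    hence "norm (tau z (n + 2)) * real n powr (- 2 * Re z) * real n powr (2 * Re z) \<le> B * real n powr (2 * Re z)"
      using B[of n] by (intro mult_right_mono) auto
    hence "norm (tau z (n + 2)) \<le> B * real n powr (2 * Re z)"
      using that by (simp add: mult.assoc flip: powr_add)
    also have "real n powr (2 * Re z) \<le> B' * real (n + 2) powr (2 * Re z)"
      using B'[of n] by (simp add: divide_le_eq)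
    finally show ?thesis using B0 by (simp add: mult_left_mono mult.assoc)
  qed
  \<comment> \<open>The limit, used along n + 2 with n >= 1, gives nothing for the indices 1 and 2;
    their values are added to the constant.\<close>
  define C where "C = B * B' + norm (tau z 1) + norm (tau z 2) / 2 powr (2 * Re z) + norm (tau z 1) + 1"
  have "norm (tau z n) \<le> C * real n powr (2 * Re z)" if n1: "n \<ge> 1" for n
  proof -
    consider "n = 1" | "n = 2" | "n \<ge> 3" using n1 by force
    thus ?thesis
    proof cases
      case 1
      thus ?thesis using B0 by (simp add: C_def)
    next
      case 2
      have "norm (tau z 2) = norm (tau z 2) / 2 powr (2 * Re z) * 2 powr (2 * Re z)" by simp
      also have "\<dots> \<le> C * 2 powr (2 * Re z)" using B0 by (intro mult_right_mono) (auto simp: C_def)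
      finally show ?thesis using 2 by simp
    next
      case 3
      have "norm (tau z n) \<le> B * B' * real n powr (2 * Re z)" proof -
        have "n - 2 + 2 = n" "n - 2 \<ge> 1" using 3 by auto
        thus ?thesis using large[of "n - 2"] by (simp only:)
      qed
      also have "\<dots> \<le> C * real n powr (2 * Re z)" by (intro mult_right_mono) (auto simp: C_def)
      finally show ?thesis .
    qed
  qed
  moreover have "C > 0" using B0 by (simp add: C_def add_nonneg_pos)
  ultimately show ?thesis using that by blast
qed

text \<open>Turns the bound at one real point into a bound on a half plane. For Re z > 0 each factor
  is, for given real part, largest on the real axis, and there it increases; for Re z <= 0 it is at
  most 1.\<close>

lemma norm_tau_le:
  assumes "Re z \<le> s" "0 \<le> s" "s < 1"
  shows "norm (tau z n) \<le> norm (tau (of_real s) n)"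
  unfolding tau_def prod_norm[symmetric]
proof (intro prod_mono conjI norm_ge_zero)
  fix j assume j: "j \<in> {1..<n}"
  define a b where "a = Re z" and "b = Im z"
  have j1: "real j \<ge> 1" using j by simp
  have js: "real j - s > 0" "real j + s > 0" "real j - a > 0" using j1 assms by (auto simp: a_def)
  have "norm (of_nat j + z) / norm (of_nat j - z) \<le> (real j + s) / (real j - s)"
  proof (cases "a \<le> 0")
    case True
    have "(real j + a)\<^sup>2 \<le> (real j - a)\<^sup>2" using mult_nonpos_nonneg[OF True, of "real j"]
      by (simp add: power2_eq_square algebra_simps)
    hence "norm (of_nat j + z) \<le> norm (of_nat j - z)"
      by (simp add: cmod_def a_def)
    hence "norm (of_nat j + z) / norm (of_nat j - z) \<le> 1" by (simp add: divide_le_eq_1)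
    also have "1 \<le> (real j + s) / (real j - s)" using js assms by (simp add: le_divide_eq)
    finally show ?thesis .
  next
    case False
    have "((real j + a)\<^sup>2 + b\<^sup>2) * (real j - a)\<^sup>2 \<le> (real j + a)\<^sup>2 * ((real j - a)\<^sup>2 + b\<^sup>2)"
    proof -
      have "(real j - a)\<^sup>2 \<le> (real j + a)\<^sup>2" using False j1 by (simp add: power2_eq_square algebra_simps)
      hence "(real j - a)\<^sup>2 * b\<^sup>2 \<le> (real j + a)\<^sup>2 * b\<^sup>2" by (intro mult_right_mono) auto
      thus ?thesis by (simp add: algebra_simps)
    qed
    hence "sqrt (((real j + a)\<^sup>2 + b\<^sup>2) * (real j - a)\<^sup>2) \<le> sqrt ((real j + a)\<^sup>2 * ((real j - a)\<^sup>2 + b\<^sup>2))"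
      by (rule real_sqrt_le_mono)
    hence "norm (of_nat j + z) * (real j - a) \<le> (real j + a) * norm (of_nat j - z)"
      using js False by (simp add: real_sqrt_mult cmod_def a_def b_def)
    moreover have "norm (of_nat j - z) > 0" using js by (auto simp: a_def)
    ultimately have "norm (of_nat j + z) / norm (of_nat j - z) \<le> (real j + a) / (real j - a)"
      using js by (simp add: field_simps)
    also have "\<dots> \<le> (real j + s) / (real j - s)"
      using js assms False by (intro frac_le) (auto simp: a_def)
    finally show ?thesis .
  qed
  also have "(real j + s) / (real j - s) = norm ((of_nat j + of_real s) / (of_nat j - of_real s :: complex))"
  proof -
    have "norm (of_nat j + of_real s :: complex) = real j + s"
      using js by (metis of_real_add of_real_of_nat_eq norm_of_real abs_of_pos)
    moreover have "norm (of_nat j - of_real s :: complex) = real j - s"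
      using js by (metis of_real_diff of_real_of_nat_eq norm_of_real abs_of_pos)
    ultimately show ?thesis by (simp add: norm_divide)
  qed
  finally show "norm ((of_nat j + z) / (of_nat j - z)) \<le> norm ((of_nat j + of_real s) / (of_nat j - of_real s :: complex))"
    by (simp add: norm_divide)
qed

lemma vt_norm_bound:
  assumes "0 \<le> s" "s \<le> 1 / 2"
  obtains C where "C > 0"
    "\<And>z n. Re z \<le> s \<Longrightarrow> norm (vt z n) \<le> C * real n powr (6 * s - 2)"
proof -
  obtain B where B: "B > 0" "\<And>n. n \<ge> 1 \<Longrightarrow> norm (tau (of_real s) n) \<le> B * real n powr (2 * Re (of_real s))"
    using tau_norm_bound[of "of_real s"] assms by auto
  have "norm (vt z n) \<le> (8 * B ^ 3) * real n powr (6 * s - 2)" if z: "Re z \<le> s" for z n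
  proof (cases "n = 0")
    case False
    have "norm (of_nat n - z) \<ge> Re (of_nat n - z)" by (rule complex_Re_le_cmod)
    hence n: "norm (of_nat n - z) \<ge> real n / 2" using False z assms by simp
    have "norm (tau z n) \<le> B * real n powr (2 * s)"
      using norm_tau_le[OF z, of n] B(2)[of n] assms False by simp
    hence "norm (tau z n) / norm (of_nat n - z) \<le> B * real n powr (2 * s) / (real n / 2)"
      using n False B(1) by (intro frac_le) auto
    hence "norm (tau z n / (of_nat n - z)) ^ 3 \<le> (B * real n powr (2 * s) / (real n / 2)) ^ 3"
      by (intro power_mono) (auto simp: norm_divide)
    hence "norm (vt z n) \<le> real n * (B * real n powr (2 * s) / (real n / 2)) ^ 3"
      by (simp add: vt_def norm_mult norm_power mult_left_mono)
    also have "\<dots> = 8 * B ^ 3 * (real n powr (6 * s) / real n ^ 2)"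
    proof -
      have "(real n powr (2 * s)) ^ 3 = real n powr (6 * s)"
        using False by (simp add: powr_power mult.commute)
      thus ?thesis using False by (simp add: power_mult_distrib power_divide eval_nat_numeral)
    qed
    also have "real n powr (6 * s) / real n ^ 2 = real n powr (6 * s - 2)"
      using False by (simp add: powr_diff)
    finally show ?thesis by simp
  qed (simp add: vt_def)
  thus ?thesis using that[of "8 * B ^ 3"] B by simp
qed

lemma H_bounds:
  obtains M where "summable M" "\<And>n. M n \<ge> 0"
    "\<And>z n. Re z \<le> 1 / 3 \<Longrightarrow> norm (vt z n / (4 * of_nat n ^ 2 - 1)) \<le> M n"
proof -
  \<comment> \<open>At s = 1/3 the exponent 6 s - 2 is 0: the numerators stay bounded, and 4 n^2 - 1
    alone makes the series converge.\<close>
  obtain C where C: "C > 0" "\<And>z n. Re z \<le> 1 / 3 \<Longrightarrow> norm (vt z n) \<le> C * real n powr (6 * (1 / 3) - 2)"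
    using vt_norm_bound[of "1 / 3"] by auto
  define M where "M n = C * (1 / real n ^ 2)" for n
  have "summable M" unfolding M_def by (intro summable_mult inverse_power_summable[unfolded inverse_eq_divide]) simp
  moreover have "norm (vt z n / (4 * of_nat n ^ 2 - 1)) \<le> M n" if "Re z \<le> 1 / 3" for z n
  proof (cases "n = 0")
    case False
    have n2: "real n ^ 2 \<ge> 1" using False by simp
    have "norm (4 * of_nat n ^ 2 - 1 :: complex) = 4 * real n ^ 2 - 1"
    proof -
      have "4 * of_nat n ^ 2 - 1 = complex_of_real (4 * real n ^ 2 - 1)" by simp
      thus ?thesis using n2 by (simp only: norm_of_real)
    qed
    moreover have "norm (vt z n) \<le> C" using C(2)[OF that, of n] False by simp
    ultimately have "norm (vt z n) / norm (4 * of_nat n ^ 2 - 1 :: complex) \<le> C / real n ^ 2"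
      using C(1) n2 by (intro frac_le) linarith+
    hence "norm (vt z n / (4 * of_nat n ^ 2 - 1)) \<le> C / real n ^ 2" by (simp only: norm_divide)
    thus ?thesis by (simp add: M_def)
  qed (simp add: vt_def M_def)
  moreover have "M n \<ge> 0" for n using C by (simp add: M_def)
  ultimately show ?thesis using that by blast
qed

lemma tau_holomorphic: "(\<lambda>z. tau z n) holomorphic_on {z. Re z < 1}"
  unfolding tau_def
  by (intro holomorphic_intros) (use of_nat_neq_Re_less_1 in force)

lemma vt_holomorphic: "(\<lambda>z. vt z n) holomorphic_on {z. Re z < 1}"
proof (cases "n = 0")
  case False
  thus ?thesis unfolding vt_def
    by (intro holomorphic_intros tau_holomorphic) (use of_nat_neq_Re_less_1[of n] in force)
qed (simp add: vt_def)

lemma H_uniform_limit: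
  "uniform_limit {z. Re z \<le> 1 / 3} (\<lambda>N z. \<Sum>n<N. vt z n / (4 * of_nat n ^ 2 - 1)) H sequentially"
proof -
  obtain M where "summable M" "\<And>n. M n \<ge> 0"
    "\<And>z n. Re z \<le> 1 / 3 \<Longrightarrow> norm (vt z n / (4 * of_nat n ^ 2 - 1)) \<le> M n"
    using H_bounds by metis
  thus ?thesis unfolding H_def[abs_def] by (intro Weierstrass_m_test[of _ _ M]) auto
qed

lemma H_tendsto: "Re z \<le> 1 / 3 \<Longrightarrow> (\<lambda>N. \<Sum>n<N. vt z n / (4 * of_nat n ^ 2 - 1)) \<longlonglongrightarrow> H z"
  using tendsto_uniform_limitI[OF H_uniform_limit] by auto

lemma H_holomorphic: "H holomorphic_on {z. Re z < 1 / 3}"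
proof (rule holomorphic_uniform_sequence)
  show "open {z. Re z < 1 / 3}" by (rule open_halfspace_Re_lt)
  show "(\<lambda>z. \<Sum>n<N. vt z n / (4 * of_nat n ^ 2 - 1)) holomorphic_on {z. Re z < 1 / 3}" for N
    by (intro holomorphic_on_sum holomorphic_intros holomorphic_on_subset[OF vt_holomorphic])
      (auto simp: of_nat_half)
  fix z :: complex assume "z \<in> {z. Re z < 1 / 3}"
  then obtain d where d: "d > 0" "cball z d \<subseteq> {z. Re z < 1 / 3}"
    using open_contains_cball[of "{z. Re z < 1 / 3}"] using open_halfspace_Re_lt[of "1 / 3"] by blast
  have "uniform_limit (cball z d) (\<lambda>N z. \<Sum>n<N. vt z n / (4 * of_nat n ^ 2 - 1)) H sequentially"
    using d(2) by (intro uniform_limit_on_subset[OF H_uniform_limit]) force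
  thus "\<exists>d>0. cball z d \<subseteq> {z. Re z < 1 / 3} \<and>
          uniform_limit (cball z d) (\<lambda>N z. \<Sum>n<N. vt z n / (4 * of_nat n ^ 2 - 1)) H sequentially"
    using d by blast
qed

lemma H_norm_bound: obtains C where "C > 0" "\<And>z. Re z \<le> 1 / 3 \<Longrightarrow> norm (H z) \<le> C"
proof -
  obtain M where M: "summable M" "\<And>n. M n \<ge> 0"
    "\<And>z n. Re z \<le> 1 / 3 \<Longrightarrow> norm (vt z n / (4 * of_nat n ^ 2 - 1)) \<le> M n"
    using H_bounds by metis
  have "norm (H z) \<le> suminf M + 1" if "Re z \<le> 1 / 3" for z
    unfolding H_def using norm_suminf_le[OF M(3)[OF that] M(1)] by simp
  moreover have "suminf M + 1 > 0" using suminf_nonneg[OF M(1,2)] by linarith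
  ultimately show ?thesis using that by blast
qed


section \<open>The difference equations of \<open>V\<close> and \<open>G\<close>\<close>

lemma tendsto_zero_if_tau_bound:
  assumes "Re z < 1" "6 * Re z + a < 0"
  shows "(\<lambda>n. tau z n ^ 3 * of_real (real n powr a)) \<longlonglongrightarrow> 0"
proof -
  obtain C where C: "C > 0" "\<And>n. n \<ge> 1 \<Longrightarrow> norm (tau z n) \<le> C * real n powr (2 * Re z)"
    using tau_norm_bound[OF assms(1)] by blast
  have lim: "(\<lambda>n. C ^ 3 * real n powr (6 * Re z + a)) \<longlonglongrightarrow> C ^ 3 * 0"
    by (intro tendsto_mult tendsto_const tendsto_neg_powr assms filterlim_real_sequentially)
  have "eventually (\<lambda>n. norm (tau z n ^ 3 * of_real (real n powr a)) \<le> C ^ 3 * real n powr (6 * Re z + a)) sequentially"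
    using eventually_ge_at_top[of 1]
  proof eventually_elim
    case (elim n)
    have "norm (tau z n) ^ 3 \<le> (C * real n powr (2 * Re z)) ^ 3"
      using C(2)[OF elim] by (intro power_mono) auto
    also have "\<dots> = C ^ 3 * real n powr (6 * Re z)"
      using elim by (simp add: power_mult_distrib powr_power mult.commute)
    finally have "norm (tau z n) ^ 3 * real n powr a \<le> C ^ 3 * real n powr (6 * Re z) * real n powr a"
      by (intro mult_right_mono) auto
    thus ?case by (simp add: norm_mult norm_power powr_add mult.assoc)
  qed
  from Lim_null_comparison[OF this] lim show ?thesis by simp
qed

text \<open>Replacing z by z + 1 moves numerator and denominator by one index, so that only end
  factors survive. The minus sign belongs to the factor 0 - z that enters the denominator.\<close>

lemma tau_shift:
  assumes "n \<ge> 1" "Re z < 0" "z \<noteq> - 1"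
  shows "tau (z + 1) n = - tau z n * ((of_nat n + z) * (of_nat n - 1 - z)) / (z * (1 + z))"
  using assms(1)
proof (induction n rule: nat_induct_at_least)
  case base
  have "z \<noteq> 0" "1 + z \<noteq> 0" using assms by (auto simp: add_eq_0_iff)
  hence "(1 + z) * z / (z * (1 + z)) = 1" by (simp add: mult.commute)
  thus ?case by (simp add: tau_1)
next
  case (Suc n)
  have nz: "z \<noteq> 0" "1 + z \<noteq> 0" "of_nat n - z \<noteq> 0" "of_nat n - 1 - z \<noteq> 0" "of_nat n - (z + 1) \<noteq> 0"
    using assms Suc.hyps of_nat_neq_Re_less_1[of n z] of_nat_neq_Re_less_1[of n "z + 1"]
    by (auto simp: add_eq_0_iff algebra_simps)
  have "tau (z + 1) (Suc n) = - tau z n * ((of_nat n + z) * (of_nat n - 1 - z)) / (z * (1 + z))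
          * ((of_nat n + (z + 1)) / (of_nat n - (z + 1)))"
    using tau_Suc[OF Suc.hyps] Suc.IH by simp
  also have "of_nat n - (z + 1) = of_nat n - 1 - z" by simp
  also have "- tau z n * ((of_nat n + z) * (of_nat n - 1 - z)) / (z * (1 + z)) * ((of_nat n + (z + 1)) / (of_nat n - 1 - z))
     = - (tau z n * ((of_nat n + z) / (of_nat n - z))) * ((of_nat (Suc n) + z) * (of_nat (Suc n) - 1 - z)) / (z * (1 + z))"
  proof -
    have "- t * (a * b) / w * (c / b) = - (t * (a / d)) * (c * d) / w" if "b \<noteq> 0" "d \<noteq> 0" for t a b c d w :: complex
      using that by (simp add: field_simps)
    from this[OF nz(4) nz(3), of "tau z n" "of_nat n + z" "z * (1 + z)" "of_nat n + (z + 1)"]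
    show ?thesis by (simp add: add_ac)
  qed
  finally show ?case using tau_Suc[OF Suc.hyps] by simp
qed

text \<open>The WZ certificate behind the difference equation of \<open>V\<close>, found from the ansatz of an odd
  polynomial in \<open>m = n - 1/2\<close>.\<close>

definition wz_cert :: "complex \<Rightarrow> complex \<Rightarrow> complex" where
  "wz_cert x m = (- 18 * (6 * x + 1) * m ^ 5 + 15 * (6 * x + 1) * (2 * x + 1) ^ 2 * m ^ 3
      - (444 * x ^ 5 + 930 * x ^ 4 + 750 * x ^ 3 + 285 * x ^ 2 + 195 / 4 * x + 21 / 8) * m)
      / (x ^ 3 * (2 * x + 1) ^ 5)"

text \<open>The telescoping relation for 48 times vt x n - rho * vt (x + 1) n, after division by
  (tau x n / (n - x))^3. The cube of n^2 - x^2 comes from \<open>tau_shift\<close>, whose minus sign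
  turns the difference into a sum.\<close>

lemma wz_cert_eq:
  fixes x n :: complex
  assumes "x \<noteq> 0" "2 * x + 1 \<noteq> 0"
  shows "48 * n * (1 + 3 * (6 * x + 1) * (6 * x + 5) / (8 * x ^ 3 * (2 * x + 1) ^ 5) * (n ^ 2 - x ^ 2) ^ 3)
    = (n - x) ^ 3 * wz_cert x (n - 1 / 2) - (n + x) ^ 3 * wz_cert x (n + 1 / 2)"
proof -
  define W where "W = x ^ 3 * (2 * x + 1) ^ 5"
  have W: "W \<noteq> 0" using assms by (simp add: W_def)
  define N where "N m = - 18 * (6 * x + 1) * m ^ 5 + 15 * (6 * x + 1) * (2 * x + 1) ^ 2 * m ^ 3
      - (444 * x ^ 5 + 930 * x ^ 4 + 750 * x ^ 3 + 285 * x ^ 2 + 195 / 4 * x + 21 / 8) * m" for m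
  have "48 * n * W + 18 * n * (6 * x + 1) * (6 * x + 5) * (n ^ 2 - x ^ 2) ^ 3
      = (n - x) ^ 3 * N (n - 1 / 2) - (n + x) ^ 3 * N (n + 1 / 2)"
    unfolding W_def N_def by (simp add: field_simps) algebra
  moreover have "wz_cert x m = N m / W" for m by (simp add: wz_cert_def N_def W_def)
  moreover have kk: "8 * x ^ 3 * (2 * x + 1) ^ 5 = 8 * W"
    by (simp add: W_def mult.assoc)
  moreover have "48 * n * (1 + 3 * (6 * x + 1) * (6 * x + 5) / (8 * W) * (n ^ 2 - x ^ 2) ^ 3)
      = (48 * n * W + 18 * n * (6 * x + 1) * (6 * x + 5) * (n ^ 2 - x ^ 2) ^ 3) / W"
    using W by (simp add: field_simps)
  ultimately show ?thesis unfolding kk by (simp add: diff_divide_distrib)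
qed

text \<open>For these x the series for \<open>V (x + 1)\<close> diverges, because Re (x + 1) > 1/6.
  The proof therefore works with truncated sums and keeps track of their boundary terms. The
  condition Re x < -2/3 places x + 1 where \<open>H\<close> converges.\<close>

lemma V_rec:
  assumes "- 3 / 4 < Re x" "Re x < - 2 / 3"
  defines "\<rho> \<equiv> 3 * (6 * x + 1) * (6 * x + 5) * (x + 1) ^ 3 / (8 * (2 * x + 1) ^ 5)"
  shows "48 * V x - \<rho> * (48 * V (x + 1)) = wz_cert x (1 / 2)"
proof -
  have nz: "x \<noteq> 0" "x + 1 \<noteq> 0" "2 * x + 1 \<noteq> 0" "1 - 6 * x \<noteq> 0" "1 - 6 * (x + 1) \<noteq> 0" "6 * x + 5 \<noteq> 0" "x \<noteq> - 1"
    using assms by (auto simp: complex_eq_iff)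
  define Z where "Z y N = tau y N ^ 3 / (of_nat N - 1 / 2)" for y N
  define A where "A y N = (\<Sum>n<N. vt y n)" for y N
  define Vp where "Vp y N = (2 - (1 - 2 * y) ^ 3 * (\<Sum>n<N. vt y n / (4 * of_nat n ^ 2 - 1))) / (1 - 6 * y)" for y N
  have Vp: "(\<lambda>N. Vp y N) \<longlonglongrightarrow> V y" if "Re y \<le> 1 / 3" "1 - 6 * y \<noteq> 0" for y
    unfolding Vp_def V_def using that by (intro tendsto_intros H_tendsto) auto
  have AVp: "A y N = Vp y N - Z y N / (1 - 6 * y)" if "Re y < 1" "1 - 6 * y \<noteq> 0" "N \<ge> 1" for y N
  proof -
    define D where "D = (1 - 2 * y) ^ 3 * (\<Sum>n<N. vt y n / (4 * of_nat n ^ 2 - 1))"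
    have "(1 - 6 * y) * A y N = (2 - D) - Z y N"
      using sum_vt[OF that(1,3)] by (simp add: A_def Z_def D_def)
    hence "A y N = ((2 - D) - Z y N) / (1 - 6 * y)" using that(2) by (simp add: eq_divide_eq mult.commute)
    thus ?thesis by (simp only: Vp_def D_def diff_divide_distrib)
  qed
  \<comment> \<open>This is rho without the cube of x (1 + x), by which \<open>tau_shift\<close>
    divides.\<close>
  define k where "k = 3 * (6 * x + 1) * (6 * x + 5) / (8 * x ^ 3 * (2 * x + 1) ^ 5)"
  have rk: "\<rho> = k * (x * (1 + x)) ^ 3"
    using nz by (simp add: assms(3) k_def power_mult_distrib add.commute)
  define U where "U N = tau x N ^ 3 * wz_cert x (of_nat N - 1 / 2)" for N
  have tele: "48 * A x N - 48 * \<rho> * A (x + 1) N = U 1 - U N" if "N \<ge> 1" for N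
    using that
  proof (induction N rule: nat_induct_at_least)
    case base
    show ?case by (simp add: A_def vt_def)
  next
    case (Suc n)
    define c t where "c = (of_nat n :: complex)" and "t = tau x n"
    have cz: "c - x \<noteq> 0" "c - 1 - x \<noteq> 0"
      using of_nat_neq_Re_less_1[of n x] of_nat_neq_Re_less_1[of n "x + 1"] Suc.hyps assms(1,2)
      by (auto simp: c_def algebra_simps)
    have "tau (x + 1) n / (c - (x + 1)) = - (t / (c - x)) * ((c ^ 2 - x ^ 2) / (x * (1 + x)))"
    proof -
      have "tau (x + 1) n = - t * ((c + x) * (c - 1 - x)) / (x * (1 + x))"
        using tau_shift[OF Suc.hyps _ nz(7)] assms by (simp add: c_def t_def)
      moreover have "c - (x + 1) = c - 1 - x" by simp
      moreover have "c ^ 2 - x ^ 2 = (c + x) * (c - x)" by (simp add: power2_eq_square algebra_simps)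
      moreover have "- t * (p * b) / w / b = - (t / a) * ((p * a) / w)" if "a \<noteq> 0" "b \<noteq> 0" for p a b w
        using that by simp
      ultimately show ?thesis using cz by (simp only:)
    qed
    hence "vt (x + 1) n = - c * (t / (c - x)) ^ 3 * ((c ^ 2 - x ^ 2) ^ 3 / (x * (1 + x)) ^ 3)"
      by (simp add: vt_def c_def[symmetric] power_mult_distrib power_divide)
    hence "\<rho> * vt (x + 1) n = - c * (t / (c - x)) ^ 3 * (k * (c ^ 2 - x ^ 2) ^ 3)"
      using nz unfolding rk by (simp add: add.commute)
    moreover have "vt x n = c * (t / (c - x)) ^ 3" by (simp add: vt_def c_def t_def)
    ultimately have "48 * vt x n - 48 * (\<rho> * vt (x + 1) n)
         = (t / (c - x)) ^ 3 * (48 * c * (1 + k * (c ^ 2 - x ^ 2) ^ 3))"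
      by (simp add: algebra_simps)
    also have "\<dots> = (t / (c - x)) ^ 3 * ((c - x) ^ 3 * wz_cert x (c - 1 / 2) - (c + x) ^ 3 * wz_cert x (c + 1 / 2))"
      unfolding k_def wz_cert_eq[OF nz(1,3)] ..
    also have "\<dots> = t ^ 3 * wz_cert x (c - 1 / 2) - (t * ((c + x) / (c - x))) ^ 3 * wz_cert x (c + 1 / 2)"
      using cz by (simp add: right_diff_distrib power_divide power_mult_distrib)
    also have "\<dots> = U n - U (Suc n)"
      using tau_Suc[OF Suc.hyps, of x] by (simp add: U_def c_def t_def add.commute)
    finally have "48 * vt x n - 48 * \<rho> * vt (x + 1) n = U n - U (Suc n)" by (simp add: mult.assoc)
    thus ?case using Suc.IH unfolding A_def sum.lessThan_Suc by algebra
  qed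
  define R where "R N = U N - 48 * Z x N / (1 - 6 * x) + 48 * \<rho> * Z (x + 1) N / (1 - 6 * (x + 1))" for N
  have R_eq: "48 * Vp x N - \<rho> * (48 * Vp (x + 1) N) = U 1 - R N" if "N \<ge> 1" for N
  proof -
    have "Re x < 1" "Re (x + 1) < 1" using assms by simp_all
    hence "A x N = Vp x N - Z x N / (1 - 6 * x)" "A (x + 1) N = Vp (x + 1) N - Z (x + 1) N / (1 - 6 * (x + 1))"
      using AVp[OF _ nz(4) that] AVp[OF _ nz(5) that] by blast+
    moreover have "R N = U N - 48 * (Z x N / (1 - 6 * x)) + 48 * \<rho> * (Z (x + 1) N / (1 - 6 * (x + 1)))"
      by (simp only: R_def times_divide_eq_right)
    ultimately show ?thesis using tele[OF that] by algebra
  qed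
  \<comment> \<open>\<open>U N\<close> alone grows like N^(5 + 6 Re x), with positive exponent here.
    The boundary term of the shifted sum cancels its part of degree 5 in m = N - 1/2; what is left
    is tau^3 times c3 m^3 + c1 m + cm / m, which tends to 0 as 6 Re x + 3 < 0.\<close>
  have "R \<longlonglongrightarrow> 0"
  proof -
    define c3 c1 cm where "c3 = 3 / 2 * (6 * x + 1) * (2 * x + 1) ^ 2 / (x ^ 3 * (2 * x + 1) ^ 5)"
      and "c1 = - (444 * x ^ 5 + 930 * x ^ 4 + 750 * x ^ 3 + 285 * x ^ 2 + 195 / 4 * x + 21 / 8)
                 / (x ^ 3 * (2 * x + 1) ^ 5) + 54 * (6 * x + 1) * (x + 1 / 2) ^ 4 / (x ^ 3 * (2 * x + 1) ^ 5)"
      and "cm = - 18 * (6 * x + 1) * (x + 1 / 2) ^ 6 / (x ^ 3 * (2 * x + 1) ^ 5) - 48 / (1 - 6 * x)"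
    have "R N = tau x N ^ 3 * (c3 * (of_nat N - 1 / 2) ^ 3 + c1 * (of_nat N - 1 / 2) + cm / (of_nat N - 1 / 2))"
      if "N \<ge> 1" for N
    proof -
      define m where "m = of_nat N - (1 / 2 :: complex)"
      have m: "m \<noteq> 0" using of_nat_half[of N] by (simp add: m_def)
      have "tau (x + 1) N = - tau x N * ((of_nat N + x) * (of_nat N - 1 - x)) / (x * (1 + x))"
        using tau_shift[OF that _ nz(7)] assms by simp
      also have "(of_nat N + x) * (of_nat N - 1 - x) = m ^ 2 - (x + 1 / 2) ^ 2"
        by (simp add: m_def power2_eq_square field_simps)
      finally have "\<rho> * tau (x + 1) N ^ 3 = - k * tau x N ^ 3 * (m ^ 2 - (x + 1 / 2) ^ 2) ^ 3"
        using nz unfolding rk by (simp add: power_divide power_mult_distrib add.commute)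
      hence "48 * \<rho> * Z (x + 1) N / (1 - 6 * (x + 1)) = 48 * (- k * tau x N ^ 3 * (m ^ 2 - (x + 1 / 2) ^ 2) ^ 3) / m / (1 - 6 * (x + 1))"
        by (simp add: Z_def m_def[symmetric] mult.assoc)
      also have "\<dots> = tau x N ^ 3 * (18 * (6 * x + 1) / (x ^ 3 * (2 * x + 1) ^ 5)) * ((m ^ 2 - (x + 1 / 2) ^ 2) ^ 3 / m)"
      proof -
        have "1 - 6 * (x + 1) = - (6 * x + 5)" by simp
        moreover have "48 * (- (3 * a * b / (8 * p * q)) * T * r) / m / (- b) = T * (18 * a / (p * q)) * (r / m)"
          if "b \<noteq> 0" "p \<noteq> 0" "q \<noteq> 0" for a b p q r T :: complex
          using that m by (simp add: field_simps)
        ultimately show ?thesis unfolding k_def using nz by (simp only: power_eq_0_iff not_False_eq_True simp_thms)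
      qed
      finally have XX: "48 * \<rho> * Z (x + 1) N / (1 - 6 * (x + 1)) = tau x N ^ 3 * (18 * (6 * x + 1) / (x ^ 3 * (2 * x + 1) ^ 5)) * ((m ^ 2 - (x + 1 / 2) ^ 2) ^ 3 / m)" .
      have "T * w - 48 * (T / m) / d + T * p * q = T * (w - 48 / m / d + p * q)" for T w d p q
        by (simp add: distrib_left right_diff_distrib)
      hence "R N = tau x N ^ 3 * (wz_cert x m - 48 / m / (1 - 6 * x)
          + 18 * (6 * x + 1) / (x ^ 3 * (2 * x + 1) ^ 5) * ((m ^ 2 - (x + 1 / 2) ^ 2) ^ 3 / m))"
        unfolding R_def XX unfolding U_def Z_def m_def[symmetric] by (simp only:)
      also have "wz_cert x m - 48 / m / (1 - 6 * x)
          + 18 * (6 * x + 1) / (x ^ 3 * (2 * x + 1) ^ 5) * ((m ^ 2 - (x + 1 / 2) ^ 2) ^ 3 / m)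
          = c3 * m ^ 3 + c1 * m + cm / m"
      proof -
        define W where "W = x ^ 3 * (2 * x + 1) ^ 5"
        have W: "W \<noteq> 0" using nz by (simp add: W_def)
        have "(m ^ 2 - (x + 1 / 2) ^ 2) ^ 3 / m = m ^ 5 - 3 * (x + 1 / 2) ^ 2 * m ^ 3 + 3 * (x + 1 / 2) ^ 4 * m - (x + 1 / 2) ^ 6 / m"
        proof -
          have "(m ^ 2 - y) ^ 3 = m * (m ^ 5 - 3 * y * m ^ 3 + 3 * y ^ 2 * m) - y ^ 3" for y
            by algebra
          from this[of "(x + 1 / 2) ^ 2"] show ?thesis
            using m by (simp add: diff_divide_distrib flip: power_mult)
        qed
        moreover have "(2 * x + 1) ^ 2 = 4 * (x + 1 / 2) ^ 2" by (simp add: power2_eq_square field_simps)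
        moreover have "(- 18 * a * m ^ 5 + 15 * a * (4 * y ^ 2) * m ^ 3 - K * m) / W - 48 / m / d
            + 18 * a / W * (m ^ 5 - 3 * y ^ 2 * m ^ 3 + 3 * y ^ 4 * m - y ^ 6 / m)
          = 3 / 2 * a * (4 * y ^ 2) / W * m ^ 3 + (- K / W + 54 * a * y ^ 4 / W) * m
            + (- 18 * a * y ^ 6 / W - 48 / d) / m" for a y K d
          unfolding divide_inverse by (simp add: algebra_simps)
        ultimately show ?thesis unfolding wz_cert_def c3_def c1_def cm_def W_def[symmetric]
          by (simp only:)
      qed
      finally show ?thesis by (simp add: m_def)
    qed
    hence ev: "eventually (\<lambda>N. tau x N ^ 3 * (c3 * (of_nat N - 1 / 2) ^ 3 + c1 * (of_nat N - 1 / 2) + cm / (of_nat N - 1 / 2)) = R N) sequentially"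
      by (auto intro: eventually_mono[OF eventually_ge_at_top[of 1]])
    have l3: "(\<lambda>N. complex_of_real ((real N - 1 / 2) ^ 3 / real N ^ 3)) \<longlonglongrightarrow> of_real 1"
      by (intro tendsto_of_real) real_asymp
    have l1: "(\<lambda>N. complex_of_real ((real N - 1 / 2) / real N ^ 3)) \<longlonglongrightarrow> of_real 0"
      by (intro tendsto_of_real) real_asymp
    have lm: "(\<lambda>N. complex_of_real (1 / (real N - 1 / 2) / real N ^ 3)) \<longlonglongrightarrow> of_real 0"
      by (intro tendsto_of_real) real_asymp
    have "(\<lambda>N. tau x N ^ 3 * of_real (real N powr 3)) \<longlonglongrightarrow> 0"
      using assms(1,2) by (intro tendsto_zero_if_tau_bound) auto
    hence "(\<lambda>N. (tau x N ^ 3 * of_real (real N powr 3)) * (c3 * of_real ((real N - 1 / 2) ^ 3 / real N ^ 3)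
            + c1 * of_real ((real N - 1 / 2) / real N ^ 3) + cm * of_real (1 / (real N - 1 / 2) / real N ^ 3)))
        \<longlonglongrightarrow> 0 * (c3 * of_real 1 + c1 * of_real 0 + cm * of_real 0)"
      by (intro tendsto_mult tendsto_add tendsto_const l3 l1 lm)
    hence "(\<lambda>N. (tau x N ^ 3 * of_real (real N powr 3)) * (c3 * of_real ((real N - 1 / 2) ^ 3 / real N ^ 3)
            + c1 * of_real ((real N - 1 / 2) / real N ^ 3) + cm * of_real (1 / (real N - 1 / 2) / real N ^ 3)))
        \<longlonglongrightarrow> 0" by simp
    moreover have "eventually (\<lambda>N. (tau x N ^ 3 * of_real (real N powr 3)) * (c3 * of_real ((real N - 1 / 2) ^ 3 / real N ^ 3)
            + c1 * of_real ((real N - 1 / 2) / real N ^ 3) + cm * of_real (1 / (real N - 1 / 2) / real N ^ 3))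
            = tau x N ^ 3 * (c3 * (of_nat N - 1 / 2) ^ 3 + c1 * (of_nat N - 1 / 2) + cm / (of_nat N - 1 / 2))) sequentially"
      using eventually_ge_at_top[of 1]
    proof eventually_elim
      case (elim N)
      have e: "p * r * (c3 * (a / r) + c1 * (b / r) + cm * (d / r)) = p * (c3 * a + c1 * b + cm * d)"
        if "r \<noteq> 0" for p r a b d :: complex using that by (simp add: field_simps)
      have "complex_of_real (real N powr 3) = of_nat N ^ 3" using elim by simp
      moreover have "of_nat N ^ 3 \<noteq> (0 :: complex)" using elim by simp
      moreover have "complex_of_real ((real N - 1 / 2) ^ 3 / real N ^ 3) = (of_nat N - 1 / 2) ^ 3 / of_nat N ^ 3"
        "complex_of_real ((real N - 1 / 2) / real N ^ 3) = (of_nat N - 1 / 2) / of_nat N ^ 3"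
        "complex_of_real (1 / (real N - 1 / 2) / real N ^ 3) = 1 / (of_nat N - 1 / 2) / of_nat N ^ 3"
        by simp_all
      moreover have "cm * (1 / (of_nat N - 1 / 2)) = cm / (of_nat N - 1 / 2)" by simp
      ultimately show ?case
        using e[of "of_nat N ^ 3" "tau x N ^ 3" "(of_nat N - 1 / 2) ^ 3" "of_nat N - 1 / 2" "1 / (of_nat N - 1 / 2)"]
        by (simp only: simp_thms)
    qed
    ultimately have "(\<lambda>N. tau x N ^ 3 * (c3 * (of_nat N - 1 / 2) ^ 3 + c1 * (of_nat N - 1 / 2) + cm / (of_nat N - 1 / 2))) \<longlonglongrightarrow> 0"
      by (rule Lim_transform_eventually)
    thus ?thesis using ev by (rule Lim_transform_eventually)
  qed
  hence "(\<lambda>N. U 1 - R N) \<longlonglongrightarrow> U 1 - 0" by (intro tendsto_intros)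
  moreover have "eventually (\<lambda>N. U 1 - R N = 48 * Vp x N - \<rho> * (48 * Vp (x + 1) N)) sequentially"
    using R_eq by (auto intro!: eventually_mono[OF eventually_ge_at_top[of 1]])
  ultimately have "(\<lambda>N. 48 * Vp x N - \<rho> * (48 * Vp (x + 1) N)) \<longlonglongrightarrow> U 1 - 0"
    by (rule Lim_transform_eventually)
  moreover have "(\<lambda>N. 48 * Vp x N - \<rho> * (48 * Vp (x + 1) N)) \<longlonglongrightarrow> 48 * V x - \<rho> * (48 * V (x + 1))"
    using nz assms by (intro tendsto_intros Vp) auto
  ultimately have "48 * V x - \<rho> * (48 * V (x + 1)) = U 1" using LIMSEQ_unique by fastforce
  thus ?thesis by (simp add: U_def tau_1)
qed

definition G :: "complex \<Rightarrow> complex" where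
  "G z = P z * (48 * V z + 9 / z ^ 2)"

lemma G_rec:
  assumes "- 3 / 4 < Re x" "Re x < - 2 / 3"
  shows "G x = fc (x + 1) + G (x + 1)"
proof -
  define \<rho> where "\<rho> = 3 * (6 * x + 1) * (6 * x + 5) * (x + 1) ^ 3 / (8 * (2 * x + 1) ^ 5)"
  have nz: "x \<noteq> 0" "x + 1 \<noteq> 0" "2 * x + 1 \<noteq> 0" "6 * x + 5 \<noteq> 0"
    using assms by (auto simp: complex_eq_iff)
  have ni: "x + 1 / 6 \<notin> \<int>\<^sub>\<le>\<^sub>0"
  proof
    assume "x + 1 / 6 \<in> \<int>\<^sub>\<le>\<^sub>0"
    then obtain n where n: "x + 1 / 6 = - of_nat n" by (rule nonpos_Ints_cases')
    hence "Re (x + 1 / 6) = Re (- of_nat n)" by (rule arg_cong)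
    hence "Re x + 1 / 6 = - real n" by simp
    hence "real n < 1" "real n > 0" using assms by linarith+
    thus False by simp
  qed
  have "8 * (2 * x + 1) ^ 5 * P (x + 1) = 3 * (6 * x + 1) * (6 * x + 5) * (x + 1) ^ 3 * P x"
    using assms by (intro P_plus1[OF ni] Re_pos_notin_nonpos_Ints) auto
  hence P1: "P (x + 1) = \<rho> * P x" using nz by (simp add: \<rho>_def field_simps)
  \<comment> \<open>This identity dictates the term 9 / z^2: the boundary value of the telescoping
    equals rho times the rational factor of \<open>fc\<close> at x + 1, up to the coboundary of 9 /
    z^2.\<close>
  have "wz_cert x (1 / 2) + 9 / x ^ 2 = \<rho> * ((74 * (x + 1) ^ 2 - 47 * (x + 1) + 8) / ((6 * x + 5) * (x + 1) ^ 3) + 9 / (x + 1) ^ 2)"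
  proof -
    have \<rho>1: "\<rho> * ((74 * (x + 1) ^ 2 - 47 * (x + 1) + 8) / ((6 * x + 5) * (x + 1) ^ 3) + 9 / (x + 1) ^ 2)
      = (3 * (6 * x + 1) * (74 * (x + 1) ^ 2 - 47 * (x + 1) + 8) + 27 * (6 * x + 1) * (6 * x + 5) * (x + 1)) / (8 * (2 * x + 1) ^ 5)"
      using nz by (simp add: \<rho>_def divide_simps) algebra
    show ?thesis unfolding \<rho>1 wz_cert_def using nz by (simp add: divide_simps) algebra
  qed
  moreover have "6 * (x + 1) - 1 = 6 * x + 5" by simp
  ultimately have eq: "48 * V x + 9 / x ^ 2 = \<rho> * ((74 * (x + 1) ^ 2 - 47 * (x + 1) + 8) / ((6 * (x + 1) - 1) * (x + 1) ^ 3)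
      + (48 * V (x + 1) + 9 / (x + 1) ^ 2))"
    using V_rec[OF assms, folded \<rho>_def] by (simp add: algebra_simps)
  show ?thesis unfolding G_def fc_def eq P1 by (simp add: algebra_simps)
qed

section \<open>Periodic functions of moderate growth\<close>

text \<open>\<open>W\<close> repeats one period of \<open>Q\<close> over the whole plane. As
  \<open>Q\<close> is holomorphic and periodic slightly beyond that period, the copies fit together
  across their seams, and Liouville's theorem applies.\<close>

lemma periodic_bounded_imp_constant:
  fixes Q :: "complex \<Rightarrow> complex"
  assumes \<alpha>: "a < \<alpha>" "\<alpha> + 1 < b"
    and holo: "Q holomorphic_on {z. a < Re z \<and> Re z < b}"
    and per: "\<And>z. a < Re z \<Longrightarrow> Re z < b - 1 \<Longrightarrow> Q (z + 1) = Q z"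
    and bnd: "\<And>z. \<alpha> \<le> Re z \<Longrightarrow> Re z \<le> \<alpha> + 1 \<Longrightarrow> norm (Q z) \<le> B"
  obtains c where "\<And>z. \<alpha> \<le> Re z \<Longrightarrow> Re z < \<alpha> + 1 \<Longrightarrow> Q z = c"
proof -
  define W where "W z = Q (z - of_int \<lfloor>Re z - \<alpha>\<rfloor>)" for z
  have "W analytic_on UNIV"
    unfolding analytic_on_def
  proof (intro ballI)
    fix z :: complex
    define m where "m = \<lfloor>Re z - \<alpha>\<rfloor>"
    define r where "r = Re z - \<alpha> - of_int m"
    have r: "0 \<le> r" "r < 1" by (auto simp: r_def m_def) linarith+
    \<comment> \<open>The ball does not reach the next seam on the right. It may cross one seam on
      the left, where \<open>Q\<close> is still holomorphic and periodicity identifies it with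
      \<open>W\<close>.\<close>
    define \<delta> where "\<delta> = min (1 - r) (min (\<alpha> - a) (b - 1 - \<alpha>))"
    have \<delta>: "\<delta> > 0" "\<delta> \<le> 1 - r" "\<delta> \<le> \<alpha> - a" "\<delta> \<le> b - 1 - \<alpha>" using r \<alpha> by (auto simp: \<delta>_def)
    have "(\<lambda>w. Q (w - of_int m)) holomorphic_on ball z \<delta>"
    proof (rule holomorphic_on_compose_gen[OF _ holo, unfolded o_def])
      show "(\<lambda>w. w - of_int m) holomorphic_on ball z \<delta>" by (intro holomorphic_intros)
      show "(\<lambda>w. w - of_int m) ` ball z \<delta> \<subseteq> {z. a < Re z \<and> Re z < b}"
      proof safe
        fix w assume "w \<in> ball z \<delta>"
        hence "\<bar>Re (z - w)\<bar> < \<delta>" using abs_Re_le_cmod[of "z - w"] by (simp add: dist_norm)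
        thus "a < Re (w - of_int m)" "Re (w - of_int m) < b" using \<delta> r \<alpha> by (auto simp: r_def)
      qed
    qed
    moreover have "Q (w - of_int m) = W w" if "w \<in> ball z \<delta>" for w
    proof -
      have w: "\<bar>Re (z - w)\<bar> < \<delta>" using that abs_Re_le_cmod[of "z - w"] by (simp add: dist_norm)
      show ?thesis
      proof (cases "Re w - \<alpha> \<ge> of_int m")
        case True
        hence "\<lfloor>Re w - \<alpha>\<rfloor> = m" using w \<delta> by (intro floor_unique) (auto simp: r_def)
        thus ?thesis by (simp add: W_def)
      next
        case False
        hence f: "\<lfloor>Re w - \<alpha>\<rfloor> = m - 1" using w \<delta> r \<alpha>
          by (intro floor_unique) (auto simp: r_def)
        have "Q (w - of_int m + 1) = Q (w - of_int m)"
          using False w \<delta> r \<alpha> by (intro per) (auto simp: r_def)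
        moreover have "w - of_int (m - 1) = w - of_int m + 1" by simp
        ultimately show ?thesis by (simp only: W_def f)
      qed
    qed
    ultimately have "W holomorphic_on ball z \<delta>" by (rule holomorphic_transform)
    thus "\<exists>\<epsilon>>0. W holomorphic_on ball z \<epsilon>" using \<delta> by blast
  qed
  hence "W holomorphic_on UNIV" by (rule analytic_imp_holomorphic)
  moreover have "bounded (range W)"
  proof (rule boundedI[of _ B], safe)
    fix z
    define k where "k = \<lfloor>Re z - \<alpha>\<rfloor>"
    have "of_int k \<le> Re z - \<alpha>" "Re z - \<alpha> < of_int k + 1" unfolding k_def by linarith+
    thus "norm (W z) \<le> B" unfolding W_def k_def[symmetric] by (intro bnd) auto
  qed
  ultimately have "W constant_on UNIV" by (rule Liouville_theorem)
  then obtain c where c: "\<And>z. W z = c" by (auto simp: constant_on_def)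
  have "Q z = c" if "\<alpha> \<le> Re z" "Re z < \<alpha> + 1" for z
  proof -
    have "\<lfloor>Re z - \<alpha>\<rfloor> = 0" using that by (intro floor_unique) auto
    thus ?thesis using c[of z] by (simp add: W_def)
  qed
  thus ?thesis using that by blast
qed

lemma norm_sin_ge:
  "norm (sin z) ^ 2 \<ge> (exp (2 * \<bar>Im z\<bar>) - 2) / 4"
proof -
  have "exp (2 * \<bar>Im z\<bar>) \<le> exp (2 * Im z) + inverse (exp (2 * Im z))"
    by (cases "Im z \<ge> 0") (auto simp: exp_minus[symmetric] add_increasing)
  moreover have "cos (2 * Re z) \<le> 1" by simp
  moreover have "(a - 2) / 4 \<le> (b + c - 2 * d) / 4" if "a \<le> b + c" "d \<le> 1" for a b c d :: real
    using that by simp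
  ultimately show ?thesis unfolding norm_sin_squared by blast
qed

text \<open>Polynomial growth is far below that of the sine, so D - D z0 divided by a sine vanishing
  at z0 tends to 0 at both ends of the strip. The quotient is antiperiodic; its square
  \<open>Q\<close> is periodic and bounded, hence constant, and the constant is 0.\<close>

lemma periodic_growth_imp_constant:
  fixes D :: "complex \<Rightarrow> complex"
  assumes \<alpha>: "a < \<alpha>" "\<alpha> + 1 < b" "- 1 < a" "b < 1"
    and holo: "D holomorphic_on {z. a < Re z \<and> Re z < b}"
    and per: "\<And>z. a < Re z \<Longrightarrow> Re z < b - 1 \<Longrightarrow> D (z + 1) = D z"
    and bnd: "\<And>z. \<alpha> \<le> Re z \<Longrightarrow> Re z \<le> \<alpha> + 1 \<Longrightarrow> \<bar>Im z\<bar> \<ge> 1 \<Longrightarrow> norm (D z) \<le> C * (1 + norm z) ^ 12"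
  obtains c where "\<And>z. \<alpha> \<le> Re z \<Longrightarrow> Re z < \<alpha> + 1 \<Longrightarrow> D z = c"
proof -
  define U where "U = {z. a < Re z \<and> Re z < b}"
  have "open U" unfolding U_def
    by (intro open_Collect_conj open_halfspace_Re_gt open_halfspace_Re_lt)
  define z0 :: complex where "z0 = of_real ((a + b) / 2)"
  have z0: "z0 \<in> U" using \<alpha> by (auto simp: U_def z0_def)
  have sin_nz: "sin (of_real pi * (z - z0)) \<noteq> 0" if "z \<in> U" "z \<noteq> z0" for z
  proof
    assume "sin (of_real pi * (z - z0)) = 0"
    then obtain n :: int where "of_real pi * (z - z0) = of_real (of_int n * pi)" by (auto simp: sin_eq_0)
    hence "of_real pi * (z - z0) = of_real pi * of_int n" by (simp add: mult.commute)
    hence n: "z - z0 = of_int n" by simp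
    hence "Re (z - z0) = of_int n" by simp
    hence e: "Re z - (a + b) / 2 = of_int n" by (simp add: z0_def)
    have "a < Re z" "Re z < b" using that(1) by (auto simp: U_def)
    hence "real_of_int n < 1 \<and> real_of_int n > - 1" using e \<alpha> by argo
    hence "n = 0" by linarith
    thus False using n that by simp
  qed
  define F where "F z = (D z - D z0) / sin (of_real pi * (z - z0))" for z
  have "F holomorphic_on U - {z0}" unfolding F_def
    using holo[folded U_def] sin_nz by (intro holomorphic_intros) (auto intro: holomorphic_on_subset)
  moreover have "((\<lambda>z. (z - z0) * F z) \<longlongrightarrow> 0) (at z0)"
  proof -
    have "isCont D z0"
      using holo[folded U_def] z0 \<open>open U\<close> holomorphic_on_imp_continuous_on continuous_on_interior interior_open by blast
    hence "((\<lambda>z. D z - D z0) \<longlongrightarrow> D z0 - D z0) (at z0)"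
      by (intro tendsto_diff tendsto_const) (simp add: isCont_def)
    moreover have "((\<lambda>z. (sin (of_real pi * (z - z0)) - sin (of_real pi * (z0 - z0))) / (z - z0)) \<longlongrightarrow> of_real pi) (at z0)"
    proof -
      have "((\<lambda>z. sin (of_real pi * (z - z0))) has_field_derivative of_real pi) (at z0)"
        by (auto intro!: derivative_eq_intros)
      thus ?thesis by (simp add: has_field_derivative_iff)
    qed
    ultimately have "((\<lambda>z. (D z - D z0) / (sin (of_real pi * (z - z0)) / (z - z0))) \<longlongrightarrow> 0 / of_real pi) (at z0)"
      by (intro tendsto_divide) auto
    thus ?thesis by (simp add: F_def mult.commute)
  qed
  ultimately obtain F' where F': "F' holomorphic_on U" "\<And>z. z \<in> U - {z0} \<Longrightarrow> F' z = F z"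
    using holomorphic_on_extend_lim[of F U z0] z0 \<open>open U\<close> by (auto simp: interior_open)
  define Q where "Q z = F' z ^ 2" for z
  have Q: "Q holomorphic_on U" unfolding Q_def by (intro holomorphic_intros F')
  have Q_eq: "Q z = ((D z - D z0) / sin (of_real pi * (z - z0))) ^ 2" if "z \<in> U" "z \<noteq> z0" for z
    using F'(2)[of z] that by (simp add: Q_def F_def)
  have Q_per: "Q (z + 1) = Q z" if "a < Re z" "Re z < b - 1" for z
  proof -
    have "z \<in> U" "z + 1 \<in> U" "z \<noteq> z0" "z + 1 \<noteq> z0" using that \<alpha> by (auto simp: U_def z0_def complex_eq_iff)
    moreover have "sin (of_real pi * (z + 1 - z0)) = - sin (of_real pi * (z - z0))"
    proof -
      have "of_real pi * (z + 1 - z0) = of_real pi * (z - z0) + of_real pi" by (simp add: algebra_simps)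
      thus ?thesis by (simp only: sin_add) (simp flip: sin_of_real cos_of_real)
    qed
    ultimately show ?thesis using per[OF that] by (simp add: Q_eq power_divide)
  qed
  \<comment> \<open>Majorant of |Q| at height y. The estimate pi > 3 yields exp(6 y) for the squared
    sine; exp(2 y) compensates the divisions by exp y, which make each summand visibly tend to
    0.\<close>
  define h where "h y = (\<bar>C\<bar> * ((2 + y) ^ 12 / exp y) + norm (D z0) * (1 / exp y)) ^ 2 * (4 * exp (2 * y) / (exp (6 * y) - 2))" for y :: real
  have h_lim: "(h \<longlongrightarrow> 0) at_top"
  proof -
    have "((\<lambda>y. (\<bar>C\<bar> * ((2 + y) ^ 12 / exp y) + norm (D z0) * (1 / exp y)) ^ 2 * (4 * exp (2 * y) / (exp (6 * y) - 2)))
       \<longlongrightarrow> (\<bar>C\<bar> * 0 + norm (D z0) * 0) ^ 2 * 0) at_top"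
      by (intro tendsto_mult tendsto_add tendsto_power tendsto_const; real_asymp)
    thus ?thesis by (simp add: h_def[abs_def])
  qed
  have Q_le: "norm (Q z) \<le> h \<bar>Im z\<bar>" if z: "\<alpha> \<le> Re z" "Re z \<le> \<alpha> + 1" "\<bar>Im z\<bar> \<ge> 1" for z
  proof -
    define y where "y = \<bar>Im z\<bar>"
    have y: "y \<ge> 1" using z by (simp add: y_def)
    have zU: "z \<in> U" using z \<alpha> by (auto simp: U_def)
    have "Im z0 = 0" by (simp add: z0_def)
    hence "z \<noteq> z0" using z(3) by auto
    note zU = zU this
    have "norm z \<le> \<bar>Re z\<bar> + \<bar>Im z\<bar>" by (rule cmod_le)
    hence nz: "1 + norm z \<le> 2 + y" using z \<alpha> by (simp add: y_def)
    have "norm (D z - D z0) \<le> norm (D z) + norm (D z0)" by (rule norm_triangle_ineq4)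
    also have "norm (D z) \<le> C * (1 + norm z) ^ 12" by (rule bnd[OF z])
    also have "\<dots> \<le> \<bar>C\<bar> * (2 + y) ^ 12"
      using nz by (intro mult_mono power_mono) auto
    finally have 1: "norm (D z - D z0) \<le> \<bar>C\<bar> * (2 + y) ^ 12 + norm (D z0)" by simp
    have "exp (6 * y) \<le> exp (2 * \<bar>Im (of_real pi * (z - z0))\<bar>)"
      using mult_right_mono[of 3 pi y] y pi_gt3 by (simp add: z0_def y_def abs_mult)
    hence e: "exp (6 * y) \<le> exp (2 * \<bar>Im (of_real pi * (z - z0))\<bar>)" .
    have 2: "(exp (6 * y) - 2) / 4 \<le> norm (sin (of_real pi * (z - z0))) ^ 2"
    proof -
      have "(A - 2) / 4 \<le> n" if "A \<le> B" "(B - 2) / 4 \<le> n" for A B n :: real using that by simp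
      from this[OF e norm_sin_ge] show ?thesis .
    qed
    have "1 + 6 * y \<le> exp (6 * y)" by (rule exp_ge_add_one_self)
    hence 3: "exp (6 * y) - 2 > 0" using y by argo
    have "norm (Q z) = norm (D z - D z0) ^ 2 / norm (sin (of_real pi * (z - z0))) ^ 2"
      using Q_eq[OF zU] by (simp add: norm_divide norm_power power_divide)
    also have "\<dots> \<le> (\<bar>C\<bar> * (2 + y) ^ 12 + norm (D z0)) ^ 2 / ((exp (6 * y) - 2) / 4)"
      using 1 2 3 by (intro frac_le power_mono) auto
    also have "\<dots> = h y"
    proof -
      have e: "exp (2 * y) = exp y * exp y" by (simp flip: exp_add)
      have "\<bar>C\<bar> * ((2 + y) ^ 12 / exp y) + norm (D z0) * (1 / exp y) = (\<bar>C\<bar> * (2 + y) ^ 12 + norm (D z0)) / exp y"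
        by (simp add: add_divide_distrib)
      thus ?thesis unfolding h_def e by (simp add: power_divide power2_eq_square)
    qed
    finally show ?thesis by (simp add: y_def)
  qed
  obtain Y where Y: "Y \<ge> 1" "\<And>y. y \<ge> Y \<Longrightarrow> h y \<le> 1"
  proof -
    have "eventually (\<lambda>y. h y < 1 \<and> y \<ge> 1) at_top"
      by (intro eventually_conj order_tendstoD(2)[OF h_lim] eventually_ge_at_top) simp
    then obtain Y0 where "\<And>y. y \<ge> Y0 \<Longrightarrow> h y < 1 \<and> y \<ge> 1" by (auto simp: eventually_at_top_linorder)
    thus ?thesis using that[of "max Y0 1"] by force
  qed
  define K where "K = cbox (Complex \<alpha> (- Y)) (Complex (\<alpha> + 1) Y)"
  have "K \<subseteq> U" using \<alpha> by (auto simp: K_def U_def in_cbox_complex_iff)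
  hence "compact (Q ` K)"
    using Q by (intro compact_continuous_image holomorphic_on_imp_continuous_on) (auto simp: K_def intro: holomorphic_on_subset)
  hence "bounded (Q ` K)" by (rule compact_imp_bounded)
  then obtain B where B: "\<And>z. z \<in> K \<Longrightarrow> norm (Q z) \<le> B" by (auto simp: bounded_iff)
  have "norm (Q z) \<le> max 1 B" if "\<alpha> \<le> Re z" "Re z \<le> \<alpha> + 1" for z
  proof (cases "\<bar>Im z\<bar> \<ge> Y")
    case True
    thus ?thesis using Q_le[of z] Y(1) Y(2)[of "\<bar>Im z\<bar>"] that by simp
  next
    case False
    hence "z \<in> K" using that by (auto simp: K_def in_cbox_complex_iff)
    thus ?thesis using B[of z] by simp
  qed
  then obtain q where q: "\<And>z. \<alpha> \<le> Re z \<Longrightarrow> Re z < \<alpha> + 1 \<Longrightarrow> Q z = q"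
    using periodic_bounded_imp_constant[OF \<alpha>(1,2) Q[unfolded U_def] Q_per] by metis
  have "q = 0"
  proof -
    have "((\<lambda>y. Q (Complex \<alpha> y)) \<longlongrightarrow> 0) at_top"
    proof (rule Lim_null_comparison[OF _ h_lim])
      show "eventually (\<lambda>y. norm (Q (Complex \<alpha> y)) \<le> h y) at_top"
        using eventually_ge_at_top[of 1]
      proof eventually_elim
        case (elim y)
        thus ?case using Q_le[of "Complex \<alpha> y"] by simp
      qed
    qed
    moreover have "Q (Complex \<alpha> y) = q" for y by (rule q) auto
    ultimately show ?thesis by (simp add: tendsto_const_iff)
  qed
  have "D z = D z0" if "\<alpha> \<le> Re z" "Re z < \<alpha> + 1" for z
  proof (cases "z = z0")
    case False
    have zU: "z \<in> U" using that \<alpha> by (auto simp: U_def)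
    have "((D z - D z0) / sin (of_real pi * (z - z0))) ^ 2 = 0"
      using q[OF that] Q_eq[OF zU False] \<open>q = 0\<close> by simp
    thus ?thesis using sin_nz[OF zU False] by simp
  qed simp
  thus ?thesis using that by blast
qed


section \<open>Connection of the series with the hypergeometric sum\<close>

text \<open>A 1-periodic function, bounded for large |Im z|, with the principal parts of
  \<open>G\<close> at 0, 1/6 and -1/6 up to sign: -9/z^2 from the first term, and residues 3 sqrt 3
  pi and -3 sqrt 3 pi from the zeros of 2 cos(2 pi z) - 1 in the second.\<close>

definition trig :: "complex \<Rightarrow> complex" where
  "trig z = - 9 * of_real pi ^ 2 / sin (of_real pi * z) ^ 2 - 18 * of_real pi ^ 2 / (2 * cos (2 * of_real pi * z) - 1)"

section \<open>Convergence to \<open>V\<close> and special values at 1/6 and -1/6\<close>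

lemma V_holomorphic: "V holomorphic_on {z. Re z < 1 / 3} - {1 / 6}"
proof -
  have "H holomorphic_on {z. Re z < 1 / 3} - {1 / 6}"
    by (rule holomorphic_on_subset[OF H_holomorphic]) auto
  moreover have "1 - 6 * z \<noteq> 0" if "z \<noteq> 1 / 6" for z :: complex
    using that by (auto simp: field_simps)
  ultimately show ?thesis unfolding V_def[abs_def] by (intro holomorphic_intros) auto
qed

lemma tau_scaled_tendsto:
  assumes "Re z < 1"
  shows "(\<lambda>n. (tau z (n + 2) * exp (- 2 * z * of_real (ln (real n)))) ^ 3) \<longlonglongrightarrow> (Gamma (1 - z) * rGamma (1 + z)) ^ 3"
  by (intro tendsto_power tau_asymp assms)

lemma sum_vt_tendsto_V:
  assumes "Re z < 1 / 6"
  shows "(\<lambda>N. \<Sum>n<N. vt z n) \<longlonglongrightarrow> V z"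
proof -
  have nz: "1 - 6 * z \<noteq> 0" using assms by (auto simp: complex_eq_iff)
  define h where "h N = (\<Sum>n<N. vt z n / (4 * of_nat n ^ 2 - 1))" for N
  have "(\<lambda>N. tau z N ^ 3 * of_real (real N powr (- 1)) * of_real (real N / (real N - 1 / 2))) \<longlonglongrightarrow> 0 * of_real 1"
    using assms by (intro tendsto_mult tendsto_zero_if_tau_bound tendsto_of_real) (auto, real_asymp)
  moreover have "eventually (\<lambda>N. tau z N ^ 3 * of_real (real N powr (- 1)) * of_real (real N / (real N - 1 / 2))
      = tau z N ^ 3 / (of_nat N - 1 / 2)) sequentially"
    using eventually_gt_at_top[of 0]
    by eventually_elim (simp add: powr_minus field_simps)
  ultimately have "(\<lambda>N. tau z N ^ 3 / (of_nat N - 1 / 2)) \<longlonglongrightarrow> 0"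
    by (auto intro: Lim_transform_eventually)
  hence "(\<lambda>N. (2 - tau z N ^ 3 / (of_nat N - 1 / 2) - (1 - 2 * z) ^ 3 * h N) / (1 - 6 * z))
      \<longlonglongrightarrow> (2 - 0 - (1 - 2 * z) ^ 3 * H z) / (1 - 6 * z)"
    unfolding h_def using assms nz by (intro tendsto_intros H_tendsto) auto
  moreover have "eventually (\<lambda>N. (2 - tau z N ^ 3 / (of_nat N - 1 / 2) - (1 - 2 * z) ^ 3 * h N) / (1 - 6 * z)
       = (\<Sum>n<N. vt z n)) sequentially"
    using eventually_ge_at_top[of 1]
  proof eventually_elim
    case (elim N)
    have "Re z < 1" using assms by simp
    from sum_vt[OF this elim] nz show ?case
      unfolding h_def by (metis nonzero_mult_div_cancel_left)
  qed
  ultimately show ?thesis unfolding V_def by (auto intro: Lim_transform_eventually)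
qed

text \<open>As -1/6 is the pole of \<open>P\<close>, the residue of \<open>G\<close> needs
  \<open>V\<close> there in closed form. At this point the summand is itself 27/2 times a difference
  of values of (n - 1/2) tau^3, whose limit exists because tau^3 behaves like a constant over
  n.\<close>

lemma V_minus_sixth: "V (- 1 / 6) = 27 / 2 * ((Gamma (7 / 6) * rGamma (5 / 6)) ^ 3 - 1 / 2)"
proof -
  let ?z = "- 1 / 6 :: complex"
  have tele: "(\<Sum>n<N. vt ?z n) = 27 / 2 * ((of_nat N - 1 / 2) * tau ?z N ^ 3 - 1 / 2)" if "N \<ge> 1" for N
    using that
  proof (induction N rule: nat_induct_at_least)
    case base
    show ?case by (simp add: vt_def tau_1)
  next
    case (Suc n)
    define c t where "c = (of_nat n :: complex)" and "t = tau ?z n"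
    have nz: "c - ?z \<noteq> 0" using of_nat_neq_Re_less_1[of n ?z] Suc.hyps by (simp add: c_def)
    have "c * (t / (c - ?z)) ^ 3 = 27 / 2 * ((c + 1 / 2) * (t * ((c + ?z) / (c - ?z))) ^ 3 - (c - 1 / 2) * t ^ 3)"
    proof -
      have "c = 27 / 2 * ((c + 1 / 2) * (c + ?z) ^ 3 - (c - 1 / 2) * (c - ?z) ^ 3)"
        by (simp add: field_simps power3_eq_cube)
      hence "c * (t / (c - ?z)) ^ 3 = 27 / 2 * ((c + 1 / 2) * (c + ?z) ^ 3 - (c - 1 / 2) * (c - ?z) ^ 3) * (t / (c - ?z)) ^ 3"
        by (rule arg_cong)
      also have "\<dots> = 27 / 2 * ((c + 1 / 2) * ((c + ?z) * (t / (c - ?z))) ^ 3 - (c - 1 / 2) * ((c - ?z) * (t / (c - ?z))) ^ 3)"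
      proof -
        have "27 / 2 * (p * a ^ 3 - r * b ^ 3) * q ^ 3 = 27 / 2 * (p * (a * q) ^ 3 - r * (b * q) ^ 3)" for a b p q r :: complex
          by (simp add: power_mult_distrib algebra_simps)
        thus ?thesis by blast
      qed
      also have "(c - ?z) * (t / (c - ?z)) = t" using nz by simp
      also have "(c + ?z) * (t / (c - ?z)) = t * ((c + ?z) / (c - ?z))" by simp
      finally show ?thesis .
    qed
    moreover have "vt ?z n = c * (t / (c - ?z)) ^ 3" by (simp only: vt_def c_def t_def)
    moreover have "tau ?z (Suc n) = t * ((c + ?z) / (c - ?z))" using tau_Suc[OF Suc.hyps] by (simp only: c_def t_def)
    moreover have "of_nat (Suc n) - 1 / 2 = c + 1 / 2" by (simp add: c_def)
    ultimately show ?case using Suc.IH unfolding sum.lessThan_Suc c_def[symmetric] t_def[symmetric] by algebra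
  qed
  have "(\<lambda>n. (tau ?z (n + 2) * exp (- 2 * ?z * of_real (ln (real n)))) ^ 3 * of_real ((real n + 3 / 2) / real n))
      \<longlonglongrightarrow> (Gamma (1 - ?z) * rGamma (1 + ?z)) ^ 3 * of_real 1"
    by (intro tendsto_mult tau_scaled_tendsto tendsto_of_real) (simp, real_asymp)
  moreover have "eventually (\<lambda>n. (tau ?z (n + 2) * exp (- 2 * ?z * of_real (ln (real n)))) ^ 3 * of_real ((real n + 3 / 2) / real n)
     = (of_nat (n + 2) - 1 / 2) * tau ?z (n + 2) ^ 3) sequentially"
    using eventually_gt_at_top[of 0]
  proof eventually_elim
    case (elim n)
    have "exp (- 2 * ?z * of_real (ln (real n))) ^ 3 = exp (of_nat 3 * (- 2 * ?z * of_real (ln (real n))))"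
      by (rule exp_of_nat_mult[symmetric])
    also have "of_nat 3 * (- 2 * ?z * of_real (ln (real n))) = of_real (ln (real n))" by simp
    also have "exp (complex_of_real (ln (real n))) = of_nat n" using elim by (simp add: exp_of_real)
    finally have "exp (- 2 * ?z * of_real (ln (real n))) ^ 3 = of_nat n" .
    moreover have "complex_of_real ((real n + 3 / 2) / real n) = (of_nat (n + 2) - 1 / 2) / of_nat n" by simp
    moreover have "complex_of_nat n \<noteq> 0" using elim by simp
    ultimately show ?case unfolding power_mult_distrib by (simp only:) simp
  qed
  ultimately have "(\<lambda>n. (of_nat (n + 2) - 1 / 2) * tau ?z (n + 2) ^ 3) \<longlonglongrightarrow> (Gamma (1 - ?z) * rGamma (1 + ?z)) ^ 3 * of_real 1"
    by (rule Lim_transform_eventually)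
  hence "(\<lambda>n. 27 / 2 * ((of_nat (n + 2) - 1 / 2) * tau ?z (n + 2) ^ 3 - 1 / 2))
      \<longlonglongrightarrow> 27 / 2 * ((Gamma (1 - ?z) * rGamma (1 + ?z)) ^ 3 * of_real 1 - 1 / 2)"
    by (rule tendsto_mult[OF tendsto_const tendsto_diff[OF _ tendsto_const]])
  moreover have "(\<lambda>n. 27 / 2 * ((of_nat (n + 2) - 1 / 2) * tau ?z (n + 2) ^ 3 - 1 / 2)) \<longlonglongrightarrow> V ?z"
  proof -
    have "(\<lambda>n. \<Sum>k<n + 2. vt ?z k) \<longlonglongrightarrow> V ?z"
      by (rule LIMSEQ_ignore_initial_segment[OF sum_vt_tendsto_V]) simp
    moreover have "(\<Sum>k<n + 2. vt ?z k) = 27 / 2 * ((of_nat (n + 2) - 1 / 2) * tau ?z (n + 2) ^ 3 - 1 / 2)" for n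
      by (rule tele) simp
    ultimately show ?thesis by (simp only:)
  qed
  ultimately have "V ?z = 27 / 2 * ((Gamma (1 - ?z) * rGamma (1 + ?z)) ^ 3 * of_real 1 - 1 / 2)"
    by (rule LIMSEQ_unique[rotated])
  thus ?thesis by simp
qed

text \<open>At z = 1/6 the factor 1 - 6z in \<open>sum_vt\<close> vanishes, so that formula
  evaluates the truncated sum of \<open>H\<close> itself. Up to the factor -1/6 the left-hand side
  is the residue of \<open>V\<close>.\<close>

lemma H_sixth: "2 - (2 / 3) ^ 3 * H (1 / 6) = (Gamma (5 / 6) * rGamma (7 / 6)) ^ 3"
proof -
  let ?z = "1 / 6 :: complex"
  have "(\<lambda>N. 2 - (2 / 3) ^ 3 * (\<Sum>n<N + 2. vt ?z n / (4 * of_nat n ^ 2 - 1))) \<longlonglongrightarrow> 2 - (2 / 3) ^ 3 * H ?z"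
    by (intro tendsto_intros LIMSEQ_ignore_initial_segment[OF H_tendsto]) simp
  moreover have "2 - (2 / 3) ^ 3 * (\<Sum>n<N + 2. vt ?z n / (4 * of_nat n ^ 2 - 1)) = tau ?z (N + 2) ^ 3 / (of_nat (N + 2) - 1 / 2)" for N
  proof -
    have "1 - 6 * ?z = 0" "1 - 2 * ?z = 2 / 3" by simp_all
    moreover have "Re ?z < 1" "N + 2 \<ge> 1" by simp_all
    ultimately have "0 = 2 - tau ?z (N + 2) ^ 3 / (of_nat (N + 2) - 1 / 2)
        - (2 / 3) ^ 3 * (\<Sum>n<N + 2. vt ?z n / (4 * of_nat n ^ 2 - 1))"
      using sum_vt[of ?z "N + 2"] by (simp only: mult_zero_left)
    thus ?thesis by algebra
  qed
  ultimately have 1: "(\<lambda>N. tau ?z (N + 2) ^ 3 / (of_nat (N + 2) - 1 / 2)) \<longlonglongrightarrow> 2 - (2 / 3) ^ 3 * H ?z" by simp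
  have "(\<lambda>n. (tau ?z (n + 2) * exp (- 2 * ?z * of_real (ln (real n)))) ^ 3 * of_real (real n / (real n + 3 / 2)))
      \<longlonglongrightarrow> (Gamma (1 - ?z) * rGamma (1 + ?z)) ^ 3 * of_real 1"
    by (intro tendsto_mult tau_scaled_tendsto tendsto_of_real) (simp, real_asymp)
  moreover have "eventually (\<lambda>n. (tau ?z (n + 2) * exp (- 2 * ?z * of_real (ln (real n)))) ^ 3 * of_real (real n / (real n + 3 / 2))
     = tau ?z (n + 2) ^ 3 / (of_nat (n + 2) - 1 / 2)) sequentially"
    using eventually_gt_at_top[of 0]
  proof eventually_elim
    case (elim n)
    have "exp (- 2 * ?z * of_real (ln (real n))) ^ 3 = exp (of_nat 3 * (- 2 * ?z * of_real (ln (real n))))"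
      by (rule exp_of_nat_mult[symmetric])
    also have "of_nat 3 * (- 2 * ?z * of_real (ln (real n))) = - of_real (ln (real n))" by simp
    also have "exp (- complex_of_real (ln (real n))) = 1 / of_nat n"
      using elim by (simp add: exp_minus exp_of_real inverse_eq_divide)
    finally have "exp (- 2 * ?z * of_real (ln (real n))) ^ 3 = 1 / of_nat n" .
    moreover have "complex_of_real (real n / (real n + 3 / 2)) = of_nat n / (of_nat (n + 2) - 1 / 2)" by simp
    moreover have "complex_of_nat n \<noteq> 0" using elim by simp
    ultimately show ?case unfolding power_mult_distrib by (simp only:) simp
  qed
  ultimately have "(\<lambda>n. tau ?z (n + 2) ^ 3 / (of_nat (n + 2) - 1 / 2)) \<longlonglongrightarrow> (Gamma (1 - ?z) * rGamma (1 + ?z)) ^ 3 * of_real 1"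
    by (rule Lim_transform_eventually)
  from LIMSEQ_unique[OF 1 this] show ?thesis by simp
qed

lemma tendsto_divide_simple_zero:
  fixes f :: "complex \<Rightarrow> complex"
  assumes "(f has_field_derivative d) (at a)" "f a = 0" "d \<noteq> 0"
  shows "((\<lambda>z. (z - a) / f z) \<longlongrightarrow> 1 / d) (at a)"
proof -
  have "((\<lambda>z. f z / (z - a)) \<longlongrightarrow> d) (at a)"
    using assms(1,2) by (simp add: has_field_derivative_iff)
  hence "((\<lambda>z. 1 / (f z / (z - a))) \<longlongrightarrow> 1 / d) (at a)"
    using assms(3) by (intro tendsto_intros)
  thus ?thesis by simp
qed

lemma holomorphic_tendsto:
  "f holomorphic_on U \<Longrightarrow> open U \<Longrightarrow> a \<in> U \<Longrightarrow> (f \<longlongrightarrow> f a) (at a)"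
  using holomorphic_on_imp_continuous_on continuous_on_eq_continuous_at isCont_def by blast

text \<open>Two duplications and the reflection formula reduce Gamma(1/6) and Gamma(5/6) to
  Gamma(1/3) and Gamma(2/3), whose product is elementary. In the residues of \<open>G\<close> only
  sqrt 3 and pi then remain.\<close>

lemma Gamma_third_relations:
  fixes s e :: complex
  defines "s \<equiv> of_real (sqrt pi)" and "e \<equiv> exp (of_real (ln 2) / 3)"
  shows "Gamma (1 / 6) * Gamma (2 / 3) = e ^ 2 * s * Gamma (1 / 3 :: complex)"
    and "Gamma (1 / 3) * Gamma (5 / 6) = e * s * Gamma (2 / 3 :: complex)"
    and "Gamma (1 / 3) * Gamma (2 / 3) = complex_of_real (2 * pi / sqrt 3)"
    and "e ^ 3 = 2" and "s ^ 2 = of_real pi"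
proof -
  have "1 / 6 \<notin> (\<int>\<^sub>\<le>\<^sub>0 :: complex set)" "1 / 6 + 1 / 2 \<notin> (\<int>\<^sub>\<le>\<^sub>0 :: complex set)"
    by (auto intro!: Re_pos_notin_nonpos_Ints)
  from Gamma_legendre_duplication[OF this]
  have "Gamma (1 / 6) * Gamma (2 / 3) = exp (2 / 3 * of_real (ln 2)) * s * Gamma (1 / 3 :: complex)"
    by (simp add: s_def)
  moreover have "exp (2 / 3 * of_real (ln 2)) = e ^ 2"
    by (simp add: e_def exp_of_nat_mult[symmetric])
  ultimately show "Gamma (1 / 6) * Gamma (2 / 3) = e ^ 2 * s * Gamma (1 / 3 :: complex)" by simp
  have "1 / 3 \<notin> (\<int>\<^sub>\<le>\<^sub>0 :: complex set)" "1 / 3 + 1 / 2 \<notin> (\<int>\<^sub>\<le>\<^sub>0 :: complex set)"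
    by (auto intro!: Re_pos_notin_nonpos_Ints)
  from Gamma_legendre_duplication[OF this]
  show "Gamma (1 / 3) * Gamma (5 / 6) = e * s * Gamma (2 / 3 :: complex)"
    by (simp add: s_def e_def)
  have "Gamma (1 / 3) * Gamma (1 - 1 / 3 :: complex) = of_real pi / sin (of_real pi * (1 / 3))"
    by (rule Gamma_reflection_complex)
  also have "sin (of_real pi * (1 / 3 :: complex)) = of_real (sin (pi / 3))"
    by (simp flip: sin_of_real)
  also have "\<dots> = of_real (sqrt 3 / 2)" by (simp add: sin_60)
  finally show "Gamma (1 / 3) * Gamma (2 / 3) = complex_of_real (2 * pi / sqrt 3)" by simp
  show "e ^ 3 = 2" by (simp add: e_def exp_of_nat_mult[symmetric] exp_of_real)
  show "s ^ 2 = of_real pi" by (simp add: s_def flip: of_real_power)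
qed

lemma ln_27_64: "ln (27 / 64 :: real) = 6 * ln (sqrt 3 / 2)"
proof -
  have "(sqrt 3) ^ 6 = ((sqrt 3) ^ 2) ^ (3 :: nat)" by (simp only: power_mult[symmetric]) simp
  hence "(sqrt 3 / 2) ^ 6 = (27 / 64 :: real)" by (simp add: power_divide)
  hence "(27 / 64 :: real) = (sqrt 3 / 2) ^ 6" by simp
  thus ?thesis by (simp only: ln_realpow)
qed

lemma pi_powr_three_halves: "complex_of_real (pi powr (3 / 2) / 2) = of_real (sqrt pi) ^ 3 / 2"
proof -
  have "pi powr (3 / 2) = (pi powr (1 / 2)) ^ 3" by (simp add: powr_power)
  thus ?thesis by (simp add: powr_half_sqrt)
qed

lemma cos_two_pi_zero:
  "2 * cos (2 * of_real pi * z) - 1 = - 4 * sin (of_real pi * (z + 1 / 6)) * sin (of_real pi * (z - 1 / 6))" for z :: complex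
proof -
  have c: "cos (of_real pi / 3 :: complex) = 1 / 2"
    using cos_of_real[of "pi / 3", where 'a = complex] by (simp add: cos_60)
  have "sin (of_real pi * (z + 1 / 6)) * sin (of_real pi * (z - 1 / 6))
      = (cos (of_real pi * (z + 1 / 6) - of_real pi * (z - 1 / 6)) - cos (of_real pi * (z + 1 / 6) + of_real pi * (z - 1 / 6))) / 2"
    by (rule sin_times_sin)
  also have "of_real pi * (z + 1 / 6) - of_real pi * (z - 1 / 6) = of_real pi / 3" by (simp add: field_simps)
  also have "of_real pi * (z + 1 / 6) + of_real pi * (z - 1 / 6) = 2 * of_real pi * z" by (simp add: algebra_simps)
  finally show ?thesis by (simp add: c field_simps)
qed

lemma sin_pi_nonzero:
  fixes z :: complex
  assumes "\<And>n::int. z \<noteq> of_int n"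
  shows "sin (of_real pi * z) \<noteq> 0"
proof
  assume "sin (of_real pi * z) = 0"
  then obtain n :: int where "of_real pi * z = of_real (of_int n * pi)" by (auto simp: sin_eq_0)
  hence "of_real pi * z = of_real pi * of_int n" by (simp add: mult.commute)
  thus False using assms[of n] by simp
qed

lemma sin_pi_nonzero_strip:
  fixes z :: complex
  assumes "- 1 < Re z" "Re z < 1" "z \<noteq> 0"
  shows "sin (of_real pi * z) \<noteq> 0"
proof (rule sin_pi_nonzero)
  fix n :: int
  show "z \<noteq> of_int n"
  proof
    assume z: "z = of_int n"
    hence "Re z = of_int n" by simp
    hence "n = 0" using assms(1,2) by linarith
    thus False using z assms(3) by simp
  qed
qed

text \<open>The left edge is the limit of the estimates for \<open>S\<close>, the right edge that of
  the estimates for \<open>H\<close>. The width 13/12 exceeds the period by just 1/12.\<close>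

definition strip :: "complex set" where
  "strip = {z. - 3 / 4 < Re z \<and> Re z < 1 / 3}"

lemma open_strip: "open strip"
  unfolding strip_def by (intro open_Collect_conj open_halfspace_Re_gt open_halfspace_Re_lt)

lemma trig_nonzero:
  assumes "z \<in> strip" "z \<noteq> 0" "z \<noteq> 1 / 6" "z \<noteq> - 1 / 6"
  shows "sin (of_real pi * z) \<noteq> 0" "2 * cos (2 * of_real pi * z) - 1 \<noteq> 0"
proof -
  show "sin (of_real pi * z) \<noteq> 0" using assms by (intro sin_pi_nonzero_strip) (auto simp: strip_def)
  have "z + 1 / 6 \<noteq> 0" "z - 1 / 6 \<noteq> 0" using assms by (auto simp: add_eq_0_iff2)
  moreover have "- 1 < Re (z + 1 / 6)" "Re (z + 1 / 6) < 1" "- 1 < Re (z - 1 / 6)" "Re (z - 1 / 6) < 1"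
    using assms(1) by (auto simp: strip_def)
  ultimately have "sin (of_real pi * (z + 1 / 6)) \<noteq> 0" "sin (of_real pi * (z - 1 / 6)) \<noteq> 0"
    by - (rule sin_pi_nonzero_strip; assumption)+
  thus "2 * cos (2 * of_real pi * z) - 1 \<noteq> 0" unfolding cos_two_pi_zero by simp
qed

section \<open>The singularities of the difference at 0, 1/6 and -1/6 are removable\<close>

definition SG :: "complex \<Rightarrow> complex" where
  "SG z = S z - G z - trig z"

lemma SG_holomorphic: "SG holomorphic_on strip - {0} - {1 / 6} - {- 1 / 6}"
proof -
  have "S holomorphic_on strip - {0} - {1 / 6} - {- 1 / 6}"
    by (rule holomorphic_on_subset[OF S_holomorphic]) (auto simp: strip_def)
  moreover have "P holomorphic_on strip - {0} - {1 / 6} - {- 1 / 6}"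
    by (rule holomorphic_on_subset[OF P_holomorphic]) (auto simp: strip_def)
  moreover have "V holomorphic_on strip - {0} - {1 / 6} - {- 1 / 6}"
    by (rule holomorphic_on_subset[OF V_holomorphic]) (auto simp: strip_def)
  ultimately show ?thesis unfolding SG_def[abs_def] G_def trig_def
    by (intro holomorphic_intros) (use trig_nonzero in auto)
qed

text \<open>The poles here are double, so the coefficient of 1/z must vanish as well as that of
  1/z^2. It does, because the derivative of \<open>P\<close> at 0 is 0 and \<open>trig\<close> is
  even.\<close>

lemma SG_at_0: "((\<lambda>z. (z - 0) * SG z) \<longlongrightarrow> 0) (at 0)"
proof -
  let ?p = "complex_of_real pi"
  have S: "(S \<longlongrightarrow> S 0) (at 0)"
    by (rule holomorphic_tendsto[OF S_holomorphic]) (auto simp: open_halfspace_Re_gt)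
  have P: "(P \<longlongrightarrow> P 0) (at 0)"
    by (rule holomorphic_tendsto[OF P_holomorphic]) (auto intro!: open_Diff open_halfspace_Re_gt)
  have V: "(V \<longlongrightarrow> V 0) (at 0)"
    by (rule holomorphic_tendsto[OF V_holomorphic open_Diff[OF open_halfspace_Re_lt closed_singleton]]) auto
  have P0: "P 0 = 1" by (subst P_eq_Gamma) auto
  \<comment> \<open>The derivative at 0 is Digamma 1 times 6 + 9 - 3 - 6 * 2 = 0.\<close>
  have P': "((\<lambda>z. (P z - 1) / z) \<longlongrightarrow> 0) (at 0)"
  proof -
    have "((\<lambda>z. Gamma (1 + 6 * z) * Gamma (1 + z) ^ 9 / (Gamma (1 + 3 * z) * Gamma (1 + 2 * z) ^ 6))
            has_field_derivative 0) (at (0 :: complex))"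
      by (auto intro!: derivative_eq_intros simp: Re_pos_notin_nonpos_Ints algebra_simps)
    hence "(P has_field_derivative 0) (at 0)"
    proof (rule has_field_derivative_transform_within_open)
      show "open {z. Re z > - 1 / 6}" by (rule open_halfspace_Re_gt)
    qed (auto simp: P_eq_Gamma)
    thus ?thesis by (simp add: has_field_derivative_iff P0)
  qed
  have sin1: "((\<lambda>z. sin (?p * z) / z) \<longlongrightarrow> ?p) (at 0)"
  proof -
    have "((\<lambda>z. sin (?p * z)) has_field_derivative ?p) (at 0)"
      by (auto intro!: derivative_eq_intros)
    thus ?thesis by (simp add: has_field_derivative_iff)
  qed
  have sin2: "((\<lambda>z. (sin (?p * z) - ?p * z) / z ^ 2) \<longlongrightarrow> 0) (at 0)"
  proof (rule Lim_null_comparison)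
    show "((\<lambda>z. exp \<bar>Im (?p * z)\<bar> * pi ^ 3 / 2 * norm z) \<longlongrightarrow> 0) (at (0::complex))"
      by (auto intro!: tendsto_eq_intros)
    show "eventually (\<lambda>z. norm ((sin (?p * z) - ?p * z) / z ^ 2) \<le> exp \<bar>Im (?p * z)\<bar> * pi ^ 3 / 2 * norm z) (at 0)"
      using eventually_neq_at_within[of 0]
    proof eventually_elim
      case (elim z)
      have "norm (sin (?p * z) - (\<Sum>k\<le>2. complex_of_real (sin_coeff k) * (?p * z) ^ k))
        \<le> exp \<bar>Im (?p * z)\<bar> * norm (?p * z) ^ Suc 2 / fact 2" by (rule Taylor_sin)
      moreover have "(\<Sum>k\<le>2. complex_of_real (sin_coeff k) * (?p * z) ^ k) = ?p * z"
        by (simp add: sin_coeff_def eval_nat_numeral)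
      ultimately have "norm (sin (?p * z) - ?p * z) \<le> exp \<bar>Im (?p * z)\<bar> * (pi * norm z) ^ 3 / 2"
        by (simp add: norm_mult eval_nat_numeral)
      thus ?case using elim
        by (simp add: norm_divide norm_power norm_mult field_simps eval_nat_numeral)
    qed
  qed
  \<comment> \<open>This is 9/z - 9 pi^2 z / sin^2(pi z), factored as a difference of squares; the
    factors require only that sin(pi z) - pi z is o(z^2).\<close>
  have sq: "((\<lambda>z. 9 * ((sin (?p * z) - ?p * z) / z ^ 2) * (sin (?p * z) / z + ?p) / (sin (?p * z) / z) ^ 2)
      \<longlongrightarrow> 9 * 0 * (?p + ?p) / ?p ^ 2) (at 0)"
    by (intro tendsto_intros sin1 sin2) auto
  have "((\<lambda>z. z * S z - 48 * z * P z * V z - 9 * ((P z - 1) / z)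
      - 9 * ((sin (?p * z) - ?p * z) / z ^ 2) * (sin (?p * z) / z + ?p) / (sin (?p * z) / z) ^ 2
      + 18 * ?p ^ 2 * z / (2 * cos (2 * ?p * z) - 1))
    \<longlongrightarrow> 0 * S 0 - 48 * 0 * P 0 * V 0 - 9 * 0 - 9 * 0 * (?p + ?p) / ?p ^ 2 + 18 * ?p ^ 2 * 0 / (2 * cos (2 * ?p * 0) - 1)) (at 0)"
    by (intro tendsto_intros S P V P' sq) auto
  moreover have "eventually (\<lambda>z. z * S z - 48 * z * P z * V z - 9 * ((P z - 1) / z)
      - 9 * ((sin (?p * z) - ?p * z) / z ^ 2) * (sin (?p * z) / z + ?p) / (sin (?p * z) / z) ^ 2
      + 18 * ?p ^ 2 * z / (2 * cos (2 * ?p * z) - 1) = (z - 0) * SG z) (at 0)"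
  proof -
    have "eventually (\<lambda>z. z \<in> strip) (at 0)"
      by (intro eventually_at_in_open' open_strip) (simp add: strip_def)
    thus ?thesis using eventually_neq_at_within[of 0]
    proof eventually_elim
      case (elim z)
      have s: "sin (?p * z) \<noteq> 0" using elim by (intro sin_pi_nonzero_strip) (auto simp: strip_def)
      have "9 * ((sin (?p * z) - ?p * z) / z ^ 2) * (sin (?p * z) / z + ?p) / (sin (?p * z) / z) ^ 2
          = 9 / z - 9 * ?p ^ 2 * z / sin (?p * z) ^ 2"
        using s elim by (simp add: divide_simps) (simp add: algebra_simps power2_eq_square)
      moreover have "z * S0 - 48 * z * P0 * V0 - 9 * ((P0 - 1) / z) - (9 / z - 9 * ?p ^ 2 * z / s) + 18 * ?p ^ 2 * z / c
          = (z - 0) * (S0 - P0 * (48 * V0 + 9 / z ^ 2) - (- 9 * ?p ^ 2 / s - 18 * ?p ^ 2 / c))" for S0 P0 V0 s c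
      proof -
        have "z * (9 / z ^ 2) = 9 / z" by (simp add: power2_eq_square)
        moreover have "z * (P0 * (48 * V0 + w)) = 48 * z * P0 * V0 + P0 * (z * w)" for w by algebra
        ultimately have "z * (P0 * (48 * V0 + 9 / z ^ 2)) = 48 * z * P0 * V0 + P0 * (9 / z)"
          by (simp only:)
        moreover have "9 * ((P0 - 1) / z) = P0 * (9 / z) - 9 / z" by (simp add: algebra_simps diff_divide_distrib)
        ultimately show ?thesis by (simp add: right_diff_distrib algebra_simps)
      qed
      ultimately show ?case unfolding SG_def G_def trig_def by (simp only:)
    qed
  qed
  ultimately have "((\<lambda>z. (z - 0) * SG z) \<longlongrightarrow> 0 * S 0 - 48 * 0 * P 0 * V 0 - 9 * 0 - 9 * 0 * (?p + ?p) / ?p ^ 2 + 18 * ?p ^ 2 * 0 / (2 * cos (2 * ?p * 0) - 1)) (at 0)"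
    by (rule Lim_transform_eventually)
  thus ?thesis by simp
qed

lemma trig_pole:
  assumes "a = 1 / 6 \<or> a = - 1 / 6"
  shows "((\<lambda>z. (z - a) * trig z) \<longlongrightarrow> of_real (3 * sqrt 3 * pi * (if a = 1 / 6 then 1 else - 1))) (at a)"
proof -
  let ?p = "complex_of_real pi"
  have a: "Im a = 0" "Re a = 1 / 6 \<or> Re a = - 1 / 6" "a \<noteq> 0" using assms by (elim disjE; hypsubst; simp)+
  have "- 1 < Re a" "Re a < 1" using a(2) by auto
  hence s: "sin (?p * a) \<noteq> 0" using a(3) by (intro sin_pi_nonzero_strip)
  define d where "d = - (4 * ?p * sin (2 * ?p * a))"
  have d: "d = - of_real (2 * sqrt 3 * pi * (if a = 1 / 6 then 1 else - 1))"
  proof -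
    have s60: "sin (?p / 3) = of_real (sqrt 3 / 2)"
      using sin_of_real[of "pi / 3", where 'a = complex] by (simp add: sin_60)
    have s3: "2 * sin (?p / 3) = of_real (sqrt 3)" unfolding s60 by simp
    from assms show ?thesis
    proof
      assume a: "a = 1 / 6"
      show ?thesis unfolding d_def a by (simp add: s3)
    next
      assume a: "a = - 1 / 6"
      show ?thesis unfolding d_def a by (simp add: s3)
    qed
  qed
  have "((\<lambda>z. 2 * cos (2 * ?p * z) - 1) has_field_derivative d) (at a)"
    by (auto intro!: derivative_eq_intros simp: d_def)
  moreover have "2 * cos (2 * ?p * a) - 1 = 0" unfolding cos_two_pi_zero using assms
    by (elim disjE; hypsubst; simp)
  moreover have "d \<noteq> 0" by (simp add: d)
  ultimately have lim: "((\<lambda>z. (z - a) / (2 * cos (2 * ?p * z) - 1)) \<longlongrightarrow> 1 / d) (at a)"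
    by (rule tendsto_divide_simple_zero)
  have "((\<lambda>z. - 9 * ?p ^ 2 * (z - a) / sin (?p * z) ^ 2 - 18 * ?p ^ 2 * ((z - a) / (2 * cos (2 * ?p * z) - 1)))
      \<longlongrightarrow> - 9 * ?p ^ 2 * (a - a) / sin (?p * a) ^ 2 - 18 * ?p ^ 2 * (1 / d)) (at a)"
    using s by (intro tendsto_intros lim) auto
  also have "- 9 * ?p ^ 2 * (a - a) / sin (?p * a) ^ 2 - 18 * ?p ^ 2 * (1 / d)
      = of_real (3 * sqrt 3 * pi * (if a = 1 / 6 then 1 else - 1))"
  proof -
    have "18 * pi ^ 2 / (2 * sqrt 3 * pi) = 3 * sqrt 3 * pi"
      by (simp add: field_simps power2_eq_square)
    hence "complex_of_real (18 * pi ^ 2 / (2 * sqrt 3 * pi)) = of_real (3 * sqrt 3 * pi)"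
      by (rule arg_cong)
    hence "18 * ?p ^ 2 / of_real (2 * sqrt 3 * pi) = of_real (3 * sqrt 3 * pi)"
      by (simp only: of_real_divide of_real_mult of_real_numeral of_real_power)
    thus ?thesis by (simp add: d)
  qed
  finally show ?thesis by (simp add: trig_def algebra_simps diff_divide_distrib)
qed

lemma SG_at_sixth: "((\<lambda>z. (z - 1 / 6) * SG z) \<longlongrightarrow> 0) (at (1 / 6))"
proof -
  have S: "(S \<longlongrightarrow> S (1 / 6)) (at (1 / 6))"
    by (rule holomorphic_tendsto[OF S_holomorphic]) (auto simp: open_halfspace_Re_gt)
  have P: "(P \<longlongrightarrow> P (1 / 6)) (at (1 / 6))"
    by (rule holomorphic_tendsto[OF P_holomorphic]) (auto intro!: open_Diff open_halfspace_Re_gt)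
  have H: "(H \<longlongrightarrow> H (1 / 6)) (at (1 / 6))"
    by (rule holomorphic_tendsto[OF H_holomorphic open_halfspace_Re_lt]) auto
  \<comment> \<open>Here 8 = 48/6, since (z - 1/6) * V z is -1/6 times the bracket whose limit
    \<open>H_sixth\<close> gives.\<close>
  have val: "8 * P (1 / 6) * (Gamma (5 / 6) * rGamma (7 / 6)) ^ 3 = of_real (3 * sqrt 3 * pi)"
  proof -
    define A B Y Z s e q where "A = Gamma (1 / 3 :: complex)" and "B = Gamma (2 / 3 :: complex)"
      and "Y = Gamma (5 / 6 :: complex)" and "Z = Gamma (7 / 6 :: complex)"
      and "s = complex_of_real (sqrt pi)" and "e = exp (complex_of_real (ln 2) / 3)" and "q = complex_of_real (sqrt 3)"
    note rel = Gamma_third_relations[folded A_def B_def Y_def s_def e_def]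
    have nz: "A \<noteq> 0" "B \<noteq> 0" "Z \<noteq> 0" "q \<noteq> 0" "s \<noteq> 0"
      by (auto simp: A_def B_def Z_def q_def s_def Gamma_eq_zero_iff dest: Re_pos_notin_nonpos_Ints[THEN notE, rotated])
    have q2: "q ^ 2 = 3" by (simp add: q_def flip: of_real_power)
    have E: "exp (1 / 6 * complex_of_real (ln (27 / 64))) = q / 2"
      unfolding ln_27_64 by (simp add: exp_of_real q_def)
    have Pv: "P (1 / 6) = s ^ 3 / 2 * (q / 2) * A * 1 * Z ^ 3 * (1 / B) ^ 5"
      unfolding P_def pi_powr_three_halves E
      by (simp add: A_def B_def Z_def s_def Gamma_def inverse_eq_divide)
    have rg: "rGamma (7 / 6) = 1 / Z" by (simp add: Z_def Gamma_def inverse_eq_divide)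
    have "8 * P (1 / 6) * (Gamma (5 / 6) * rGamma (7 / 6)) ^ 3 = 2 * s ^ 3 * q * A * Y ^ 3 / B ^ 5"
      unfolding Pv rg Y_def[symmetric] using nz by (simp add: field_simps power_mult_distrib power_divide)
    also have "Y = e * s * B / A" using rel(2) nz by (simp add: field_simps)
    also have "2 * s ^ 3 * q * A * (e * s * B / A) ^ 3 / B ^ 5 = 2 * q * e ^ 3 * (s ^ 2) ^ 3 / (A * B) ^ 2"
      using nz by (simp add: field_simps power_mult_distrib power_divide eval_nat_numeral)
    also have "\<dots> = 4 * q * of_real pi ^ 3 / of_real (2 * pi / sqrt 3) ^ 2"
      unfolding rel(3,4,5) by simp
    also have "\<dots> = of_real (3 * sqrt 3 * pi)"
    proof -
      have "4 * sqrt 3 * pi ^ 3 / (2 * pi / sqrt 3) ^ 2 = 3 * sqrt 3 * pi"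
        by (simp add: field_simps power_divide eval_nat_numeral)
      hence "complex_of_real (4 * sqrt 3 * pi ^ 3 / (2 * pi / sqrt 3) ^ 2) = of_real (3 * sqrt 3 * pi)"
        by (rule arg_cong)
      thus ?thesis unfolding q_def
        by (simp only: of_real_divide of_real_mult of_real_numeral of_real_power)
    qed
    finally show ?thesis .
  qed
  have "((\<lambda>z. (z - 1 / 6) * S z + 8 * P z * (2 - (1 - 2 * z) ^ 3 * H z) - (z - 1 / 6) * P z * (9 / z ^ 2) - (z - 1 / 6) * trig z)
     \<longlongrightarrow> (1 / 6 - 1 / 6) * S (1 / 6) + 8 * P (1 / 6) * (2 - (1 - 2 * (1 / 6)) ^ 3 * H (1 / 6))
        - (1 / 6 - 1 / 6) * P (1 / 6) * (9 / (1 / 6) ^ 2) - of_real (3 * sqrt 3 * pi * (if (1 / 6 :: complex) = 1 / 6 then 1 else - 1))) (at (1 / 6))"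
    by (intro tendsto_intros S P H trig_pole) auto
  moreover have "eventually (\<lambda>z. (z - 1 / 6) * S z + 8 * P z * (2 - (1 - 2 * z) ^ 3 * H z) - (z - 1 / 6) * P z * (9 / z ^ 2) - (z - 1 / 6) * trig z
      = (z - 1 / 6) * SG z) (at (1 / 6))"
    using eventually_neq_at_within[of "1 / 6"]
  proof eventually_elim
    case (elim z)
    have "(z - 1 / 6) * V z = - (2 - (1 - 2 * z) ^ 3 * H z) / 6"
    proof -
      have "1 - 6 * z = - 6 * (z - 1 / 6)" by simp
      moreover have "z - 1 / 6 \<noteq> 0" using elim by simp
      ultimately show ?thesis unfolding V_def by (simp only:) (simp add: field_simps)
    qed
    moreover have "(z - 1 / 6) * (P z * (48 * V z)) = 48 * P z * ((z - 1 / 6) * V z)" by simp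
    moreover have "48 * P z * (- w / 6) = - 8 * P z * w" for w by simp
    ultimately have "(z - 1 / 6) * (P z * (48 * V z)) = - 8 * P z * (2 - (1 - 2 * z) ^ 3 * H z)"
      by (simp only:)
    moreover have "(z - 1 / 6) * a + 8 * p * w - (z - 1 / 6) * p * y - (z - 1 / 6) * t
        = (z - 1 / 6) * (a - p * (u + y) - t)"
      if "(z - 1 / 6) * (p * u) = - 8 * p * w" for a p w y t u
    proof -
      have "(z - 1 / 6) * (a - p * (u + y) - t)
          = (z - 1 / 6) * a - (z - 1 / 6) * (p * u) - (z - 1 / 6) * p * y - (z - 1 / 6) * t"
        by (simp add: right_diff_distrib distrib_left mult.assoc)
      thus ?thesis unfolding that by simp
    qed
    ultimately show ?case unfolding SG_def G_def by blast
  qed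
  ultimately have "((\<lambda>z. (z - 1 / 6) * SG z) \<longlongrightarrow> (1 / 6 - 1 / 6) * S (1 / 6) + 8 * P (1 / 6) * (2 - (1 - 2 * (1 / 6)) ^ 3 * H (1 / 6))
        - (1 / 6 - 1 / 6) * P (1 / 6) * (9 / (1 / 6) ^ 2) - of_real (3 * sqrt 3 * pi * (if (1 / 6 :: complex) = 1 / 6 then 1 else - 1))) (at (1 / 6))"
    by (rule Lim_transform_eventually)
  moreover have "1 - 2 * (1 / 6 :: complex) = 2 / 3" by simp
  ultimately show ?thesis using val H_sixth by simp
qed

lemma SG_at_minus_sixth: "((\<lambda>z. (z - (- 1 / 6)) * SG z) \<longlongrightarrow> 0) (at (- 1 / 6))"
proof -
  let ?a = "- 1 / 6 :: complex"
  \<comment> \<open>With Gamma(z + 7/6) in place of Gamma(z + 1/6), \<open>Q z\<close> is (z + 1/6)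
    * P z and is regular at -1/6.\<close>
  define Q where "Q z = of_real (pi powr (3 / 2) / 2) * exp (z * of_real (ln (27 / 64))) *
     Gamma (z + 7 / 6) * Gamma (z + 5 / 6) * Gamma (z + 1) ^ 3 * rGamma (z + 1 / 2) ^ 5" for z :: complex
  have S: "(S \<longlongrightarrow> S ?a) (at ?a)"
    by (rule holomorphic_tendsto[OF S_holomorphic]) (auto simp: open_halfspace_Re_gt)
  have V: "(V \<longlongrightarrow> V ?a) (at ?a)"
    by (rule holomorphic_tendsto[OF V_holomorphic open_Diff[OF open_halfspace_Re_lt closed_singleton]]) auto
  have Q: "(Q \<longlongrightarrow> Q ?a) (at ?a)"
  proof (rule holomorphic_tendsto)
    show "Q holomorphic_on {z. Re z > - 5 / 6}" unfolding Q_def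
      by (intro holomorphic_intros) (auto intro!: Re_pos_notin_nonpos_Ints)
  qed (auto simp: open_halfspace_Re_gt)
  have val: "Q ?a * (48 * V ?a + 9 / ?a ^ 2) = of_real (3 * sqrt 3 * pi)"
  proof -
    define A B X Y s e q where "A = Gamma (1 / 3 :: complex)" and "B = Gamma (2 / 3 :: complex)"
      and "X = Gamma (1 / 6 :: complex)" and "Y = Gamma (5 / 6 :: complex)"
      and "s = complex_of_real (sqrt pi)" and "e = exp (complex_of_real (ln 2) / 3)" and "q = complex_of_real (sqrt 3)"
    note rel = Gamma_third_relations[folded A_def B_def X_def s_def e_def]
    have nz: "A \<noteq> 0" "B \<noteq> 0" "Y \<noteq> 0" "q \<noteq> 0" "s \<noteq> 0"
      by (auto simp: A_def B_def Y_def q_def s_def Gamma_eq_zero_iff dest: Re_pos_notin_nonpos_Ints[THEN notE, rotated])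
    have q2: "q ^ 2 = 3" by (simp add: q_def flip: of_real_power)
    have "exp (?a * complex_of_real (ln (27 / 64))) = exp (- of_real (ln (sqrt 3 / 2)))"
      unfolding ln_27_64 by simp
    also have "\<dots> = 2 / q" by (simp add: exp_minus exp_of_real q_def)
    finally have E: "exp (?a * complex_of_real (ln (27 / 64))) = 2 / q" .
    have Qv: "Q ?a = s ^ 3 / 2 * (2 / q) * 1 * B * Y ^ 3 * (1 / A) ^ 5"
      unfolding Q_def pi_powr_three_halves E
      by (simp add: A_def B_def Y_def s_def Gamma_def inverse_eq_divide)
    have Vv: "48 * V ?a + 9 / ?a ^ 2 = 3 * X ^ 3 / Y ^ 3"
    proof -
      have g: "Gamma (7 / 6 :: complex) = X / 6"
        using Gamma_plus1[of "1 / 6 :: complex"] Re_pos_notin_nonpos_Ints[of "1 / 6"] by (simp add: X_def)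
      have rg: "rGamma (5 / 6) = 1 / Y" by (simp add: Y_def Gamma_def inverse_eq_divide)
      show ?thesis unfolding V_minus_sixth g rg
        using nz by (simp add: power_divide power2_eq_square field_simps)
    qed
    have "Q ?a * (48 * V ?a + 9 / ?a ^ 2) = 3 * s ^ 3 * B * X ^ 3 / (q * A ^ 5)"
      unfolding Qv Vv using nz by (simp add: field_simps)
    also have "X = e ^ 2 * s * A / B" using rel(1) nz by (simp add: field_simps)
    also have "3 * s ^ 3 * B * (e ^ 2 * s * A / B) ^ 3 / (q * A ^ 5) = 3 * (e ^ 3) ^ 2 * (s ^ 2) ^ 3 / (q * (A * B) ^ 2)"
      using nz by (simp add: field_simps power_mult_distrib power_divide eval_nat_numeral)
    also have "\<dots> = 12 * of_real pi ^ 3 / (q * of_real (2 * pi / sqrt 3) ^ 2)"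
      unfolding rel(3,4,5) by simp
    also have "\<dots> = of_real (3 * sqrt 3 * pi)"
    proof -
      have "12 * pi ^ 3 / (sqrt 3 * (2 * pi / sqrt 3) ^ 2) = 3 * sqrt 3 * pi"
        by (simp add: field_simps power_divide eval_nat_numeral)
      hence "complex_of_real (12 * pi ^ 3 / (sqrt 3 * (2 * pi / sqrt 3) ^ 2)) = of_real (3 * sqrt 3 * pi)"
        by (rule arg_cong)
      thus ?thesis unfolding q_def
        by (simp only: of_real_divide of_real_mult of_real_numeral of_real_power)
    qed
    finally show ?thesis .
  qed
  have "((\<lambda>z. (z - ?a) * S z - Q z * (48 * V z + 9 / z ^ 2) - (z - ?a) * trig z)
     \<longlongrightarrow> (?a - ?a) * S ?a - Q ?a * (48 * V ?a + 9 / ?a ^ 2) - of_real (3 * sqrt 3 * pi * (if ?a = 1 / 6 then 1 else - 1))) (at ?a)"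
    by (intro tendsto_intros S Q V trig_pole) auto
  moreover have "eventually (\<lambda>z. (z - ?a) * S z - Q z * (48 * V z + 9 / z ^ 2) - (z - ?a) * trig z = (z - ?a) * SG z) (at ?a)"
  proof -
    have "eventually (\<lambda>z. z \<in> {z. Re z > - 5 / 6}) (at ?a)"
      by (intro eventually_at_in_open' open_halfspace_Re_gt) auto
    thus ?thesis using eventually_neq_at_within[of ?a]
    proof eventually_elim
      case (elim z)
      have "z + 1 / 6 \<notin> \<int>\<^sub>\<le>\<^sub>0"
      proof
        assume "z + 1 / 6 \<in> \<int>\<^sub>\<le>\<^sub>0"
        then obtain n where n: "z + 1 / 6 = - of_nat n" by (rule nonpos_Ints_cases')
        hence "Re (z + 1 / 6) = Re (- of_nat n)" by (rule arg_cong)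
        hence "Re z + 1 / 6 = - real n" by simp
        hence "n = 0" using elim by simp
        thus False using n elim by (simp add: eq_neg_iff_add_eq_0)
      qed
      from Gamma_plus1[OF this] have "Gamma (z + 7 / 6) = (z - ?a) * Gamma (z + 1 / 6)" by (simp add: add.commute)
      hence "Q z = (z - ?a) * P z" by (simp add: Q_def P_def)
      moreover have "(z - ?a) * a - (z - ?a) * p * w - (z - ?a) * t = (z - ?a) * (a - p * w - t)" for a p w t
        by (simp add: right_diff_distrib)
      ultimately show ?case unfolding SG_def G_def by (simp only:)
    qed
  qed
  ultimately have "((\<lambda>z. (z - ?a) * SG z) \<longlongrightarrow> (?a - ?a) * S ?a - Q ?a * (48 * V ?a + 9 / ?a ^ 2) - of_real (3 * sqrt 3 * pi * (if ?a = 1 / 6 then 1 else - 1))) (at ?a)"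
    by (rule Lim_transform_eventually)
  thus ?thesis unfolding val by simp
qed


section \<open>Growth and periodicity of the difference, and its constancy\<close>

lemma norm_sin_pi_ge_1:
  assumes "\<bar>Im z\<bar> \<ge> 1"
  shows "norm (sin (of_real pi * z)) \<ge> 1"
proof -
  have "3 * 1 \<le> pi * \<bar>Im z\<bar>" using assms pi_gt3 by (intro mult_mono) auto
  hence "6 \<le> 2 * \<bar>Im (of_real pi * z)\<bar>" by (simp add: abs_mult)
  moreover have "1 + 2 * \<bar>Im (of_real pi * z)\<bar> \<le> exp (2 * \<bar>Im (of_real pi * z)\<bar>)"
    by (rule exp_ge_add_one_self)
  moreover have "(exp (2 * \<bar>Im (of_real pi * z)\<bar>) - 2) / 4 \<le> norm (sin (of_real pi * z)) ^ 2"
    by (rule norm_sin_ge)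
  moreover have "1 ^ 2 \<le> d" if "6 \<le> a" "1 + a \<le> b" "(b - 2) / 4 \<le> d" for a b d :: real
    using that by simp
  ultimately have "1 ^ 2 \<le> norm (sin (of_real pi * z)) ^ 2" by blast
  thus ?thesis by (rule power2_le_imp_le) simp
qed

text \<open>The exponent 12 is 9 for \<open>P\<close> plus 3 for the factor (1 - 2z)^3 in
  \<open>V\<close>; \<open>S\<close> and \<open>trig\<close> grow more slowly.\<close>

lemma SG_norm_bound:
  obtains C where "\<And>z. - 7 / 10 \<le> Re z \<Longrightarrow> Re z \<le> 3 / 10 \<Longrightarrow> \<bar>Im z\<bar> \<ge> 1 \<Longrightarrow> norm (SG z) \<le> C * (1 + norm z) ^ 12"
proof -
  obtain CS where CS: "CS > 0" "\<And>z. Re z \<ge> - 3 / 4 \<Longrightarrow> norm (S z) \<le> CS * (1 + norm z) ^ 6"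
    using S_norm_bound by blast
  obtain CP where CP: "CP > 0" "\<And>z. Re z \<ge> - 3 / 4 \<Longrightarrow> \<bar>Im z\<bar> \<ge> 1 \<Longrightarrow> norm (P z) \<le> CP * (1 + norm z) ^ 9"
    using P_strip_bound by blast
  obtain CH where CH: "CH > 0" "\<And>z. Re z \<le> 1 / 3 \<Longrightarrow> norm (H z) \<le> CH"
    using H_norm_bound by blast
  define K where "K = 48 * (2 + 8 * CH) + 9"
  have "norm (SG z) \<le> (CS + CP * K + 27 * pi ^ 2) * (1 + norm z) ^ 12"
    if z: "- 7 / 10 \<le> Re z" "Re z \<le> 3 / 10" "\<bar>Im z\<bar> \<ge> 1" for z
  proof -
    define R where "R = 1 + norm z"
    have R: "R \<ge> 1" by (simp add: R_def)
    have S: "norm (S z) \<le> CS * R ^ 12"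
    proof -
      have "norm (S z) \<le> CS * R ^ 6" using CS(2)[of z] z by (simp add: R_def)
      also have "\<dots> \<le> CS * R ^ 12" using R CS(1) by (intro mult_left_mono power_increasing) auto
      finally show ?thesis .
    qed
    have V: "norm (V z) \<le> (2 + 8 * CH) * R ^ 3"
    proof -
      have "norm (1 - 2 * z) \<le> 2 * R" using norm_triangle_ineq4[of 1 "2 * z"] by (simp add: R_def)
      hence "norm ((1 - 2 * z) ^ 3 * H z) \<le> (2 * R) ^ 3 * CH"
        unfolding norm_mult norm_power using CH(2)[of z] z R by (intro mult_mono power_mono) auto
      hence "norm (2 - (1 - 2 * z) ^ 3 * H z) \<le> 2 + (2 * R) ^ 3 * CH"
        using norm_triangle_ineq4[of 2 "(1 - 2 * z) ^ 3 * H z"] by simp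
      moreover have "norm (1 - 6 * z) \<ge> 1" using abs_Im_le_cmod[of "1 - 6 * z"] z by simp
      ultimately have "norm (V z) \<le> (2 + (2 * R) ^ 3 * CH) / 1"
        unfolding V_def norm_divide using CH(1) R by (intro frac_le) auto
      also have "\<dots> \<le> 2 * R ^ 3 + (2 * R) ^ 3 * CH" using one_le_power[OF R, of 3] by simp
      also have "\<dots> = (2 + 8 * CH) * R ^ 3" by (simp add: power_mult_distrib algebra_simps)
      finally show ?thesis .
    qed
    have z2: "norm (9 / z ^ 2) \<le> 9 * R ^ 3"
    proof -
      have "1 \<le> norm z" using abs_Im_le_cmod[of z] z by simp
      hence "1 \<le> norm z ^ 2" by (rule one_le_power)
      hence "norm (9 / z ^ 2) \<le> 9 / 1" unfolding norm_divide norm_power by (intro frac_le) auto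
      also have "9 / 1 \<le> 9 * R ^ 3" using one_le_power[OF R, of 3] by simp
      finally show ?thesis .
    qed
    have G: "norm (G z) \<le> CP * K * R ^ 12"
    proof -
      have "norm (48 * V z + 9 / z ^ 2) \<le> 48 * norm (V z) + norm (9 / z ^ 2)"
        using norm_triangle_ineq[of "48 * V z" "9 / z ^ 2"] by (simp add: norm_mult)
      also have "\<dots> \<le> 48 * ((2 + 8 * CH) * R ^ 3) + 9 * R ^ 3" using V z2 by (intro add_mono mult_left_mono) auto
      also have "\<dots> = K * R ^ 3" by (simp add: K_def algebra_simps)
      finally have "norm (48 * V z + 9 / z ^ 2) \<le> K * R ^ 3" .
      moreover have "norm (P z) \<le> CP * R ^ 9" using CP(2)[of z] z by (simp add: R_def)
      ultimately have "norm (G z) \<le> (CP * R ^ 9) * (K * R ^ 3)"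
        unfolding G_def norm_mult using CP(1) R by (intro mult_mono) auto
      thus ?thesis by (simp add: mult_ac flip: power_add)
    qed
    have t: "norm (trig z) \<le> 27 * pi ^ 2 * R ^ 12"
    proof -
      have s: "1 \<le> norm (sin (of_real pi * z)) ^ 2"
        by (rule one_le_power[OF norm_sin_pi_ge_1[OF z(3)]])
      have "1 \<le> norm (sin (of_real pi * (z + 1 / 6)))" "1 \<le> norm (sin (of_real pi * (z - 1 / 6)))"
        using z by (auto intro!: norm_sin_pi_ge_1)
      hence "1 * 1 \<le> norm (sin (of_real pi * (z + 1 / 6))) * norm (sin (of_real pi * (z - 1 / 6)))"
        by (intro mult_mono) auto
      hence c: "1 \<le> norm (2 * cos (2 * of_real pi * z) - 1)" unfolding cos_two_pi_zero by (simp add: norm_mult)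
      have "norm (trig z) \<le> norm (- 9 * of_real pi ^ 2 / sin (of_real pi * z) ^ 2) + norm (18 * of_real pi ^ 2 / (2 * cos (2 * of_real pi * z) - 1))"
        unfolding trig_def by (rule norm_triangle_ineq4)
      also have "\<dots> \<le> 9 * pi ^ 2 / 1 + 18 * pi ^ 2 / 1"
      proof (intro add_mono)
        show "norm (- 9 * of_real pi ^ 2 / sin (of_real pi * z) ^ 2) \<le> 9 * pi ^ 2 / 1"
          unfolding norm_divide norm_power using s by (intro frac_le) (auto simp: norm_mult norm_power)
        show "norm (18 * of_real pi ^ 2 / (2 * cos (2 * of_real pi * z) - 1)) \<le> 18 * pi ^ 2 / 1"
          unfolding norm_divide using c by (intro frac_le) (auto simp: norm_mult norm_power)
      qed
      also have "\<dots> = 27 * pi ^ 2 * 1" by simp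
      also have "\<dots> \<le> 27 * pi ^ 2 * R ^ 12" using one_le_power[OF R, of 12] by (intro mult_left_mono) auto
      finally show ?thesis .
    qed
    have "norm (SG z) \<le> norm (S z) + norm (G z) + norm (trig z)"
      unfolding SG_def using norm_triangle_ineq4[of "S z - G z" "trig z"] norm_triangle_ineq4[of "S z" "G z"] by linarith
    also have "\<dots> \<le> CS * R ^ 12 + CP * K * R ^ 12 + 27 * pi ^ 2 * R ^ 12" using S G t by (intro add_mono)
    also have "\<dots> = (CS + CP * K + 27 * pi ^ 2) * (1 + norm z) ^ 12" by (simp add: R_def algebra_simps)
    finally show ?thesis .
  qed
  thus ?thesis using that by blast
qed

lemma SG_periodic:
  assumes "- 3 / 4 < Re z" "Re z < - 2 / 3"
  shows "SG (z + 1) = SG z"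
proof -
  have "S z = fc (z + 1) + S (z + 1)" using assms by (intro S_rec) auto
  moreover have "G z = fc (z + 1) + G (z + 1)" using assms by (intro G_rec) auto
  moreover have "trig (z + 1) = trig z"
  proof -
    have "of_real pi * (z + 1) = of_real pi * z + of_real pi"
      "2 * of_real pi * (z + 1) = 2 * of_real pi * z + of_real (2 * pi)" by (simp_all add: algebra_simps)
    moreover have "sin (w + of_real pi) = - sin w" "cos (w + of_real (2 * pi)) = cos w" for w :: complex
      by (simp_all only: sin_add cos_add sin_of_real cos_of_real) simp_all
    ultimately show ?thesis unfolding trig_def by (simp only:) simp
  qed
  ultimately show ?thesis by (simp add: SG_def)
qed

text \<open>The three singularities are filled one after another, each by the extension theorem for
  a single point. The radius 1/6 keeps z off the points 1/6 and -1/6.\<close>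

theorem S_eq_G_plus_trig:
  obtains c where "\<And>z. z \<noteq> 0 \<Longrightarrow> norm z < 1 / 6 \<Longrightarrow> S z = G z + trig z + c"
proof -
  have op: "open (strip - A)" if "finite A" for A
    using open_strip finite_imp_closed[OF that] by (rule open_Diff)
  have mem: "0 \<in> strip" "1 / 6 \<in> strip" "- 1 / 6 \<in> strip" by (auto simp: strip_def)
  define U1 where "U1 = strip - {1 / 6, - 1 / 6}"
  define U2 where "U2 = strip - {- 1 / 6}"
  have opU: "open U1" "open U2" unfolding U1_def U2_def by (rule op; simp)+
  have "SG holomorphic_on U1 - {0}"
    by (rule holomorphic_on_subset[OF SG_holomorphic]) (auto simp: U1_def)
  moreover have "0 \<in> interior U1" using mem opU by (simp add: interior_open U1_def)
  ultimately obtain g1 where g1: "g1 holomorphic_on U1" "\<forall>z\<in>U1 - {0}. g1 z = SG z"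
    using holomorphic_on_extend_lim SG_at_0 by blast
  have "g1 holomorphic_on U2 - {1 / 6}"
    by (rule holomorphic_on_subset[OF g1(1)]) (auto simp: U1_def U2_def)
  moreover have "1 / 6 \<in> interior U2" using mem opU by (simp add: interior_open U2_def)
  moreover have "((\<lambda>z. (z - 1 / 6) * g1 z) \<longlongrightarrow> 0) (at (1 / 6))"
  proof (rule Lim_transform_eventually[OF SG_at_sixth])
    have "eventually (\<lambda>z. z \<in> strip - {0, - 1 / 6}) (at (1 / 6))"
      using mem by (intro eventually_at_in_open' op) auto
    thus "eventually (\<lambda>z. (z - 1 / 6) * SG z = (z - 1 / 6) * g1 z) (at (1 / 6))"
      using eventually_neq_at_within[of "1 / 6"]
    proof eventually_elim
      case (elim z)
      hence "z \<in> U1 - {0}" by (auto simp: U1_def)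
      thus ?case using g1(2) by simp
    qed
  qed
  ultimately obtain g2 where g2: "g2 holomorphic_on U2" "\<forall>z\<in>U2 - {1 / 6}. g2 z = g1 z"
    using holomorphic_on_extend_lim by blast
  have "g2 holomorphic_on strip - {- 1 / 6}" using g2(1) by (simp add: U2_def)
  moreover have "- 1 / 6 \<in> interior strip" using mem open_strip by (simp add: interior_open)
  moreover have "((\<lambda>z. (z - (- 1 / 6)) * g2 z) \<longlongrightarrow> 0) (at (- 1 / 6))"
  proof (rule Lim_transform_eventually[OF SG_at_minus_sixth])
    have "eventually (\<lambda>z. z \<in> strip - {0, 1 / 6}) (at (- 1 / 6))"
      using mem by (intro eventually_at_in_open' op) auto
    thus "eventually (\<lambda>z. (z - (- 1 / 6)) * SG z = (z - (- 1 / 6)) * g2 z) (at (- 1 / 6))"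
      using eventually_neq_at_within[of "- 1 / 6"]
    proof eventually_elim
      case (elim z)
      hence "z \<in> U1 - {0}" "z \<in> U2 - {1 / 6}" by (auto simp: U1_def U2_def)
      thus ?case using g1(2) g2(2) by simp
    qed
  qed
  ultimately obtain g where g: "g holomorphic_on strip" "\<forall>z\<in>strip - {- 1 / 6}. g z = g2 z"
    using holomorphic_on_extend_lim by blast
  have g_SG: "g z = SG z" if "z \<in> strip" "z \<noteq> 0" "z \<noteq> 1 / 6" "z \<noteq> - 1 / 6" for z
  proof -
    have "z \<in> U1 - {0}" "z \<in> U2 - {1 / 6}" "z \<in> strip - {- 1 / 6}" using that by (auto simp: U1_def U2_def)
    thus ?thesis using g1(2) g2(2) g(2) by simp
  qed
  obtain C where C: "\<And>z. - 7 / 10 \<le> Re z \<Longrightarrow> Re z \<le> 3 / 10 \<Longrightarrow> \<bar>Im z\<bar> \<ge> 1 \<Longrightarrow> norm (SG z) \<le> C * (1 + norm z) ^ 12"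
    using SG_norm_bound by blast
  \<comment> \<open>The interval from -7/10 to 3/10 is one period inside the strip, and it covers
    the real parts of the disc |z| < 1/6.\<close>
  obtain c where c: "\<And>z. - 7 / 10 \<le> Re z \<Longrightarrow> Re z < - 7 / 10 + 1 \<Longrightarrow> g z = c"
  proof (rule periodic_growth_imp_constant[of "- 3 / 4" "- 7 / 10" "1 / 3" g C])
    show "g holomorphic_on {z. - 3 / 4 < Re z \<and> Re z < 1 / 3}" using g(1) by (simp add: strip_def)
    show "g (z + 1) = g z" if "- 3 / 4 < Re z" "Re z < 1 / 3 - 1" for z
    proof -
      have "z \<in> strip" "z + 1 \<in> strip" using that by (auto simp: strip_def)
      moreover have "z \<noteq> 0" "z \<noteq> 1 / 6" "z \<noteq> - 1 / 6" "z + 1 \<noteq> 0" "z + 1 \<noteq> 1 / 6" "z + 1 \<noteq> - 1 / 6"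
        using that by (auto simp: complex_eq_iff)
      ultimately show ?thesis using SG_periodic[of z] that by (simp add: g_SG)
    qed
    show "norm (g z) \<le> C * (1 + norm z) ^ 12" if "- 7 / 10 \<le> Re z" "Re z \<le> - 7 / 10 + 1" "1 \<le> \<bar>Im z\<bar>" for z
    proof -
      have "z \<in> strip" using that by (auto simp: strip_def)
      moreover have "Im z \<noteq> 0" using that by auto
      hence "z \<noteq> 0" "z \<noteq> 1 / 6" "z \<noteq> - 1 / 6" by (auto simp: complex_eq_iff)
      ultimately show ?thesis using C[of z] that by (simp add: g_SG)
    qed
  qed auto
  have "S z = G z + trig z + c" if "z \<noteq> 0" "norm z < 1 / 6" for z
  proof -
    have "\<bar>Re z\<bar> < 1 / 6" using abs_Re_le_cmod[of z] that(2) by simp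
    moreover from this have "z \<in> strip" "- 7 / 10 \<le> Re z" "Re z < - 7 / 10 + 1" by (auto simp: strip_def)
    moreover have ne: "z \<noteq> w" if "\<bar>Re w\<bar> = 1 / 6" for w
      using that \<open>\<bar>Re z\<bar> < 1 / 6\<close> by auto
    have "z \<noteq> 1 / 6" "z \<noteq> - 1 / 6" by (rule ne, simp)+
    ultimately have "SG z = c" using g_SG[of z] c[of z] that(1) by simp
    thus ?thesis by (simp add: SG_def algebra_simps)
  qed
  thus ?thesis using that by blast
qed

section \<open>Taylor coefficients\<close>

lemma fps_nth_eq_deriv: "f has_fps_expansion F \<Longrightarrow> (deriv ^^ m) f 0 = fact m * fps_nth F m"
  for f :: "complex \<Rightarrow> complex"
  by (simp add: fps_nth_fps_expansion)

lemma lin_hsum_Nil: "lin_hsum [] n = 0"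
  by (simp add: lin_hsum_def)

lemma lin_hsum_prefix_Suc:
  "lin_hsum (map (\<lambda>(c, w). (a * c, k # w)) L) (Suc n)
     = lin_hsum (map (\<lambda>(c, w). (a * c, k # w)) L) n + of_int a / real n ^ k * lin_hsum L n"
  by (induction L) (auto simp: lin_hsum_def algebra_simps)

lemma lin_hsum_prefix_0: "lin_hsum (map (\<lambda>(c, w). (a * c, k # w)) L) 0 = 0"
  by (induction L) (auto simp: lin_hsum_def)

lemma lin_hsum_concat_map:
  "lin_hsum (concat (map f xs)) n = (\<Sum>x\<leftarrow>xs. lin_hsum (f x) n)"
  by (induction xs) (auto simp: lin_hsum_def)

definition cube_coeff :: "nat \<Rightarrow> real" where
  "cube_coeff k = (if k = 0 then 1 else 4 * real k ^ 2 + 2)"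

lemma cube_words_pos:
  "m > 0 \<Longrightarrow> cube_words m = concat (map (\<lambda>k. if k = 0 \<or> k > m then [] else
       map (\<lambda>(c, w). ((4 * int k ^ 2 + 2) * c, k # w)) (cube_words (m - k))) [0..<Suc m])"
  by (subst cube_words.simps) (simp only: if_False neq0_conv[symmetric])

text \<open>Raising the truncation from n to n + 1 multiplies the generating series in m by the
  factor of index n. The term k = 0 is the old value, the other terms are the words beginning with
  k.\<close>

lemma lin_hsum_cube_words_Suc:
  "lin_hsum (cube_words m) (Suc n) = (\<Sum>k=0..m. cube_coeff k / real n ^ k * lin_hsum (cube_words (m - k)) n)"
proof (cases "m = 0")
  case True
  thus ?thesis by (simp add: cube_words.simps lin_hsum_def cube_coeff_def)
next
  case False
  let ?f = "\<lambda>k. if k = 0 \<or> k > m then [] else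
       map (\<lambda>(c, w). ((4 * int k ^ 2 + 2) * c, k # w)) (cube_words (m - k))"
  have sum: "lin_hsum (cube_words m) n' = (\<Sum>k=0..m. lin_hsum (?f k) n')" for n'
    unfolding cube_words_pos[OF False[unfolded neq0_conv]] lin_hsum_concat_map
    by (simp only: interv_sum_list_conv_sum_set_nat atLeastLessThanSuc_atLeastAtMost set_upt)
  have "lin_hsum (?f k) (Suc n) = lin_hsum (?f k) n + (if k = 0 then 0 else cube_coeff k / real n ^ k * lin_hsum (cube_words (m - k)) n)"
    if "k \<le> m" for k
    using that by (auto simp: lin_hsum_prefix_Suc cube_coeff_def lin_hsum_Nil)
  hence "lin_hsum (cube_words m) (Suc n) = lin_hsum (cube_words m) n
      + (\<Sum>k=0..m. if k = 0 then 0 else cube_coeff k / real n ^ k * lin_hsum (cube_words (m - k)) n)"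
    unfolding sum by (simp add: sum.distrib)
  also have "(\<Sum>k=0..m. if k = 0 then 0 else cube_coeff k / real n ^ k * lin_hsum (cube_words (m - k)) n)
      = (\<Sum>k=1..m. cube_coeff k / real n ^ k * lin_hsum (cube_words (m - k)) n)"
    by (rule sum.mono_neutral_cong_right) auto
  also have "lin_hsum (cube_words m) n + \<dots> = (\<Sum>k=0..m. cube_coeff k / real n ^ k * lin_hsum (cube_words (m - k)) n)"
    by (subst (2) sum.atLeast_Suc_atMost) (auto simp: cube_coeff_def)
  finally show ?thesis .
qed

lemma lin_hsum_cube_words_0: "lin_hsum (cube_words m) 0 = (if m = 0 then 1 else 0)"
proof (cases "m = 0")
  case False
  have "lin_hsum (if k = 0 \<or> k > m then [] else
       map (\<lambda>(c, w). ((4 * int k ^ 2 + 2) * c, k # w)) (cube_words (m - k))) 0 = 0" for k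
    by (simp add: lin_hsum_prefix_0 lin_hsum_Nil)
  thus ?thesis using False
    unfolding cube_words_pos[OF False[unfolded neq0_conv]] lin_hsum_concat_map
    by (simp add: sum_list_0)
qed (simp add: cube_words.simps lin_hsum_def)

lemma lin_hsum_V_words:
  "lin_hsum (V_words m) N = (\<Sum>n<N. \<Sum>k=0..m. real ((k + 2) choose 2) / real n ^ (k + 2) * lin_hsum (cube_words (m - k)) n)"
proof -
  let ?f = "\<lambda>k. map (\<lambda>(c, w). (int ((k + 2) choose 2) * c, (k + 2) # w)) (cube_words (m - k))"
  have sum: "lin_hsum (V_words m) N = (\<Sum>k=0..m. lin_hsum (?f k) N)" for N
    unfolding V_words_def lin_hsum_concat_map
    by (simp only: interv_sum_list_conv_sum_set_nat atLeastLessThanSuc_atLeastAtMost set_upt)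
  show ?thesis
  proof (induction N)
    case 0
    show ?case unfolding sum by (simp add: lin_hsum_prefix_0)
  next
    case (Suc N)
    have "lin_hsum (V_words m) (Suc N) = lin_hsum (V_words m) N
        + (\<Sum>k=0..m. real ((k + 2) choose 2) / real N ^ (k + 2) * lin_hsum (cube_words (m - k)) N)"
      unfolding sum lin_hsum_prefix_Suc sum.distrib by simp
    thus ?case using Suc by simp
  qed
qed

text \<open>The scaled geometric-type series; for \<open>n = 0\<close> the conventions \<open>x / 0 = 0\<close> and \<open>0 ^ 0 = 1\<close>
  make \<open>cube_fps 0 = 1\<close> and \<open>inv_cube_fps 0 = 1\<close>.\<close>

definition cube_fps :: "nat \<Rightarrow> complex fps" where
  "cube_fps n = Abs_fps (\<lambda>k. of_real (cube_coeff k / real n ^ k))"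

definition inv_cube_fps :: "nat \<Rightarrow> complex fps" where
  "inv_cube_fps n = Abs_fps (\<lambda>k. of_real (real ((k + 2) choose 2) / real n ^ k))"

lemma fps_linear_cube:
  fixes a :: "'a :: comm_ring_1"
  shows "(1 + fps_const a * fps_X) ^ 3 = 1 + fps_const (3 * a) * fps_X + fps_const (3 * a ^ 2) * fps_X ^ 2 + fps_const (a ^ 3) * fps_X ^ 3"
  by (simp add: power3_eq_cube power2_eq_square algebra_simps fps_const_mult[symmetric] numeral_fps_const del: fps_const_mult)

lemma fps_times_linear_cube_nth:
  fixes a :: "'a :: comm_ring_1"
  shows "fps_nth (F * (1 + fps_const a * fps_X) ^ 3) k = fps_nth F k
    + 3 * a * (if k < 1 then 0 else fps_nth F (k - 1)) + 3 * a ^ 2 * (if k < 2 then 0 else fps_nth F (k - 2))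
    + a ^ 3 * (if k < 3 then 0 else fps_nth F (k - 3))"
proof -
  have "F * (1 + fps_const a * fps_X) ^ 3 = F + fps_const (3 * a) * (fps_X ^ 1 * F)
     + fps_const (3 * a ^ 2) * (fps_X ^ 2 * F) + fps_const (a ^ 3) * (fps_X ^ 3 * F)"
    unfolding fps_linear_cube by (simp add: algebra_simps)
  thus ?thesis by (simp only: fps_add_nth fps_mult_left_const_nth fps_X_power_mult_nth)
qed

lemma nat_cases_4:
  fixes k :: nat
  obtains "k = 0" | "k = 1" | "k = 2" | j where "k = Suc (Suc (Suc j))"
  by (metis One_nat_def Suc_1 not0_implies_Suc)

text \<open>Multiplication by (1 - X/n)^3 takes third differences of the scaled coefficients. These
  vanish on the quadratic 4k^2 + 2; only the first indices notice that \<open>cube_coeff 0\<close>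
  is 1 and not 2.\<close>

lemma cube_fps_mult:
  assumes "n > 0"
  shows "cube_fps n * (1 + fps_const (- 1 / of_nat n) * fps_X) ^ 3 = (1 + fps_const (1 / of_nat n) * fps_X) ^ 3"
proof (rule fps_ext)
  fix k
  have n: "complex_of_nat n \<noteq> 0" using assms by simp
  have r: "fps_nth ((1 + fps_const (1 / of_nat n) * fps_X) ^ 3 :: complex fps) k
     = (if k = 0 then 1 else if k = 1 then 3 / of_nat n else if k = 2 then 3 / of_nat n ^ 2 else if k = 3 then 1 / of_nat n ^ 3 else 0)"
    using fps_times_linear_cube_nth[of 1 "1 / of_nat n :: complex" k]
    by (auto simp: power_divide)
  show "fps_nth (cube_fps n * (1 + fps_const (- 1 / of_nat n) * fps_X) ^ 3) k
       = fps_nth ((1 + fps_const (1 / of_nat n) * fps_X) ^ 3) k"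
    unfolding r fps_times_linear_cube_nth
    using n by (cases k rule: nat_cases_4)
      (auto simp: cube_fps_def cube_coeff_def field_simps eval_nat_numeral)
qed

lemma inv_cube_fps_mult:
  assumes "n > 0"
  shows "inv_cube_fps n * (1 + fps_const (- 1 / of_nat n) * fps_X) ^ 3 = 1"
proof (rule fps_ext)
  fix k
  have n: "complex_of_nat n \<noteq> 0" using assms by simp
  have ch: "of_nat ((j + 2) choose 2) = (of_nat j + 1) * (of_nat j + 2) / (2 :: complex)" for j
  proof -
    have "2 * ((j + 2) choose 2) = (j + 1) * (j + 2)"
      by (induction j) (auto simp: numeral_2_eq_2)
    hence "of_nat (2 * ((j + 2) choose 2)) = (of_nat ((j + 1) * (j + 2)) :: complex)" by (rule arg_cong)
    thus ?thesis by (simp add: field_simps)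
  qed
  have nth: "fps_nth (inv_cube_fps n) j = (of_nat j + 1) * (of_nat j + 2) / (2 * of_nat n ^ j)" for j
    unfolding inv_cube_fps_def fps_nth_Abs_fps of_real_divide of_real_of_nat_eq ch by simp
  show "fps_nth (inv_cube_fps n * (1 + fps_const (- 1 / of_nat n) * fps_X) ^ 3) k = fps_nth 1 k"
    unfolding fps_times_linear_cube_nth nth
    using n by (cases k rule: nat_cases_4)
      (simp_all add: power2_eq_square power3_eq_cube field_simps del: of_nat_eq_0_iff)
qed

lemma has_fps_expansion_cube:
  assumes "n > 0"
  shows "(\<lambda>z. ((of_nat n + z) / (of_nat n - z)) ^ 3) has_fps_expansion cube_fps n"
    and "(\<lambda>z. 1 / (1 - z / of_nat n) ^ 3) has_fps_expansion inv_cube_fps n"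
proof -
  have n: "complex_of_nat n \<noteq> 0" using assms by simp
  define A where "A = (1 + fps_const (- 1 / of_nat n) * fps_X :: complex fps)"
  have A0: "fps_nth (A ^ 3) 0 = 1" by (simp add: A_def fps_nth_power_0)
  have eA: "(\<lambda>z. 1 - z / of_nat n) has_fps_expansion A"
  proof -
    have "(\<lambda>z. 1 + (- 1 / of_nat n) * z) has_fps_expansion A"
      unfolding A_def by (intro fps_expansion_intros)
    thus ?thesis by simp
  qed
  have inv: "(\<lambda>z. inverse ((1 - z / of_nat n) ^ 3)) has_fps_expansion inverse (A ^ 3)"
    using A0 by (intro fps_expansion_intros eA) auto
  have invA: "A ^ 3 * inverse (A ^ 3) = 1" using A0 by (intro inverse_mult_eq_1') auto
  have "inverse (A ^ 3) = inv_cube_fps n * (A ^ 3 * inverse (A ^ 3))"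
    using inv_cube_fps_mult[OF assms] by (simp add: A_def mult.assoc[symmetric])
  hence "inverse (A ^ 3) = inv_cube_fps n" using invA by simp
  thus 1: "(\<lambda>z. 1 / (1 - z / of_nat n) ^ 3) has_fps_expansion inv_cube_fps n"
    using inv by (simp add: inverse_eq_divide)
  define B where "B = (1 + fps_const (1 / of_nat n) * fps_X :: complex fps)"
  have eB: "(\<lambda>z. (1 + 1 / of_nat n * z) ^ 3) has_fps_expansion B ^ 3"
    unfolding B_def by (intro fps_expansion_intros)
  have "B ^ 3 * inverse (A ^ 3) = cube_fps n * (A ^ 3 * inverse (A ^ 3))"
    using cube_fps_mult[OF assms] by (simp add: A_def B_def mult.assoc[symmetric])
  hence "B ^ 3 * inverse (A ^ 3) = cube_fps n" using invA by simp
  moreover have "(\<lambda>z. (1 + 1 / of_nat n * z) ^ 3 * inverse ((1 - z / of_nat n) ^ 3)) has_fps_expansion B ^ 3 * inverse (A ^ 3)"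
    by (intro fps_expansion_intros eB inv)
  moreover have "(1 + 1 / of_nat n * z) ^ 3 * inverse ((1 - z / of_nat n) ^ 3) = ((of_nat n + z) / (of_nat n - z)) ^ 3" for z :: complex
  proof -
    have "1 + 1 / of_nat n * z = (of_nat n + z) / of_nat n" "1 - z / of_nat n = (of_nat n - z) / of_nat n"
      using n by (simp_all add: field_simps del: of_nat_eq_0_iff)
    thus ?thesis using n by (simp add: power_divide inverse_eq_divide)
  qed
  ultimately show "(\<lambda>z. ((of_nat n + z) / (of_nat n - z)) ^ 3) has_fps_expansion cube_fps n" by simp
qed

definition tau_fps :: "nat \<Rightarrow> complex fps" where
  "tau_fps n = Abs_fps (\<lambda>m. of_real (lin_hsum (cube_words m) n))"

lemma tau_fps_Suc: "tau_fps (Suc n) = cube_fps n * tau_fps n"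
  by (rule fps_ext) (simp add: tau_fps_def cube_fps_def fps_mult_nth lin_hsum_cube_words_Suc)

lemma tau_fps_0: "tau_fps 0 = 1" "tau_fps (Suc 0) = 1"
proof -
  show "tau_fps 0 = 1" by (rule fps_ext) (simp add: tau_fps_def lin_hsum_cube_words_0)
  moreover have "cube_fps 0 = 1"
    by (rule fps_ext) (simp add: cube_fps_def cube_coeff_def power_0_left)
  ultimately show "tau_fps (Suc 0) = 1" by (simp add: tau_fps_Suc)
qed

lemma has_fps_expansion_tau: "n > 0 \<Longrightarrow> (\<lambda>z. tau z n ^ 3) has_fps_expansion tau_fps n"
proof (induction n rule: nat_induct_non_zero)
  case 1
  thus ?case by (simp add: tau_1 tau_fps_0)
next
  case (Suc n)
  have "(\<lambda>z. ((of_nat n + z) / (of_nat n - z)) ^ 3 * tau z n ^ 3) has_fps_expansion cube_fps n * tau_fps n"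
    using Suc by (intro fps_expansion_intros has_fps_expansion_cube) auto
  moreover have "((of_nat n + z) / (of_nat n - z)) ^ 3 * tau z n ^ 3 = tau z (Suc n) ^ 3" for z
    using tau_Suc[of n z] Suc.hyps by (simp add: power_mult_distrib power_divide)
  ultimately show ?case by (simp add: tau_fps_Suc)
qed

definition vt_fps :: "nat \<Rightarrow> complex fps" where
  "vt_fps n = fps_const (1 / of_nat n ^ 2) * (inv_cube_fps n * tau_fps n)"

lemma has_fps_expansion_vt: "(\<lambda>z. vt z n) has_fps_expansion vt_fps n"
proof (cases "n = 0")
  case False
  have "(\<lambda>z. 1 / of_nat n ^ 2 * (1 / (1 - z / of_nat n) ^ 3 * tau z n ^ 3)) has_fps_expansion vt_fps n"
    unfolding vt_fps_def using False by (intro fps_expansion_intros has_fps_expansion_cube has_fps_expansion_tau) auto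
  moreover have "1 / of_nat n ^ 2 * (1 / (1 - z / of_nat n) ^ 3 * tau z n ^ 3) = vt z n" for z
  proof -
    have "1 - z / of_nat n = (of_nat n - z) / of_nat n" using False by (simp add: field_simps)
    thus ?thesis using False by (simp add: vt_def power_divide power2_eq_square power3_eq_cube)
  qed
  ultimately show ?thesis by simp
qed (simp add: vt_def vt_fps_def)

lemma sum_vt_fps_nth: "fps_nth (\<Sum>n<N. vt_fps n) m = of_real (lin_hsum (V_words m) N)"
proof -
  have "fps_nth (vt_fps n) m = of_real (\<Sum>k=0..m. real ((k + 2) choose 2) / real n ^ (k + 2) * lin_hsum (cube_words (m - k)) n)" for n
    unfolding vt_fps_def inv_cube_fps_def tau_fps_def fps_mult_left_const_nth fps_mult_nth[of "Abs_fps _"] fps_nth_Abs_fps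
    by (simp only: of_real_sum sum_distrib_left) (simp add: power_add power2_eq_square mult_ac)
  thus ?thesis by (simp add: fps_sum_nth lin_hsum_V_words)
qed

text \<open>On the disc of radius 1/12 the summands are O(n^(-3/2)) uniformly. The original series
  for \<open>V\<close> therefore converges uniformly and may be differentiated termwise at
  0.\<close>

lemma V_fps_nth:
  "(\<lambda>N. of_real (lin_hsum (V_words m) N)) \<longlonglongrightarrow> fps_nth (fps_expansion V 0) m"
proof -
  let ?A = "ball 0 (1 / 12) :: complex set"
  obtain C where C: "C > 0" "\<And>z n. Re z \<le> 1 / 12 \<Longrightarrow> norm (vt z n) \<le> C * real n powr (6 * (1 / 12) - 2)"
    using vt_norm_bound[of "1 / 12"] by auto
  have re: "Re z < 1 / 12" if "z \<in> ?A" for z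
    using that abs_Re_le_cmod[of z] by simp
  have "uniform_limit ?A (\<lambda>N z. \<Sum>n<N. vt z n) (\<lambda>z. \<Sum>n. vt z n) sequentially"
  proof (rule Weierstrass_m_test)
    show "summable (\<lambda>n. C * real n powr (6 * (1 / 12) - 2))"
      by (intro summable_mult) (simp add: summable_real_powr_iff)
    show "norm (vt z n) \<le> C * real n powr (6 * (1 / 12) - 2)" if "z \<in> ?A" for z n
      using C(2)[of z n] re[OF that] by simp
  qed
  moreover have "(\<Sum>n. vt z n) = V z" if "z \<in> ?A" for z
  proof -
    have "Re z < 1 / 6" using re[OF that] by simp
    have "(\<lambda>n. vt z n) sums V z" unfolding sums_def by (rule sum_vt_tendsto_V[OF \<open>Re z < 1 / 6\<close>])
    thus ?thesis by (simp add: sums_iff)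
  qed
  ultimately have ul: "uniform_limit ?A (\<lambda>N z. \<Sum>n<N. vt z n) V sequentially"
    using uniform_limit_cong'[of ?A "\<lambda>N z. \<Sum>n<N. vt z n" "\<lambda>N z. \<Sum>n<N. vt z n"
        "\<lambda>z. \<Sum>n. vt z n" V] by simp
  have "(\<lambda>N. (deriv ^^ m) (\<lambda>z. \<Sum>n<N. vt z n) 0) \<longlonglongrightarrow> (deriv ^^ m) V 0"
  proof (rule higher_deriv_complex_uniform_limit[OF ul])
    show "eventually (\<lambda>N. (\<lambda>z. \<Sum>n<N. vt z n) holomorphic_on ?A) sequentially"
      by (intro always_eventually allI holomorphic_on_sum holomorphic_on_subset[OF vt_holomorphic]) (use re in force)
  qed auto
  moreover have "(deriv ^^ m) (\<lambda>z. \<Sum>n<N. vt z n) 0 = fact m * of_real (lin_hsum (V_words m) N)" for N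
  proof -
    have "(\<lambda>z. \<Sum>n<N. vt z n) has_fps_expansion (\<Sum>n<N. vt_fps n)"
      by (intro has_fps_expansion_sum has_fps_expansion_vt)
    from fps_nth_eq_deriv[OF this] show ?thesis by (simp add: sum_vt_fps_nth)
  qed
  ultimately have "(\<lambda>N. fact m * of_real (lin_hsum (V_words m) N)) \<longlonglongrightarrow> (deriv ^^ m) V 0" by simp
  hence "(\<lambda>N. fact m * of_real (lin_hsum (V_words m) N) / fact m) \<longlonglongrightarrow> (deriv ^^ m) V 0 / fact m"
    by (intro tendsto_divide tendsto_const) auto
  thus ?thesis by (simp add: fps_expansion_def)
qed

abbreviation mzc :: "nat list \<Rightarrow> complex" where
  "mzc w \<equiv> of_real (mzv w)"

lemma lin_hsum_singleton: "lin_hsum [(1, w)] = hsum w"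
  by (simp add: lin_hsum_def fun_eq_iff)

text \<open>Makes every even zeta value that occurs a power of \<open>mzv [2]\<close>, so that the
  later comparisons are polynomial identities in fixed generators.\<close>

lemma mzv_4_6_8:
  shows "mzv [4] = 2 / 5 * mzv [2] ^ 2" "mzv [6] = 8 / 35 * mzv [2] ^ 3" "mzv [8] = 24 / 175 * mzv [2] ^ 4"
proof -
  have lim: "hsum [k] \<longlonglongrightarrow> mzv [k]" if "k \<ge> 2" for k
    by (rule hsum_tendsto_mzv) (use that in \<open>simp add: admissible_def\<close>)
  show "mzv [4] = 2 / 5 * mzv [2] ^ 2"
    using LIMSEQ_unique[OF lim mzv_certificate_sound[OF certificate_zeta_4, unfolded lin_hsum_singleton]]
    by (simp add: power2_eq_square)
  show "mzv [6] = 8 / 35 * mzv [2] ^ 3"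
    using LIMSEQ_unique[OF lim mzv_certificate_sound[OF certificate_zeta_6, unfolded lin_hsum_singleton]]
    by (simp add: power3_eq_cube)
  show "mzv [8] = 24 / 175 * mzv [2] ^ 4"
    using LIMSEQ_unique[OF lim mzv_certificate_sound[OF certificate_zeta_8, unfolded lin_hsum_singleton]]
    by (simp add: power4_eq_xxxx)
qed

lemma V_fps_nth_certificate:
  assumes "mzv_certificate d (V_words m) Q R"
  shows "fps_nth (fps_expansion V 0) m = of_real ((\<Sum>(c, us)\<leftarrow>Q. of_int c * (\<Prod>u\<leftarrow>us. mzv u)) / of_int d)"
  by (rule LIMSEQ_unique[OF V_fps_nth tendsto_of_real[OF mzv_certificate_sound[OF assms]]])

context
  fixes z2 z3 z5 z7 z9 d53 :: complex
  defines "z2 \<equiv> mzc [2]" and "z3 \<equiv> mzc [3]" and "z5 \<equiv> mzc [5]" and "z7 \<equiv> mzc [7]" and "z9 \<equiv> mzc [9]"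
    and "d53 \<equiv> mzc [5, 3]"
begin

lemma V_fps_values:
  "fps_nth (fps_expansion V 0) 0 = z2"
  "fps_nth (fps_expansion V 0) 1 = 9 * z3"
  "fps_nth (fps_expansion V 0) 2 = 24 * z2 ^ 2"
  "fps_nth (fps_expansion V 0) 3 = 50 * z2 * z3 + 280 * z5"
  "fps_nth (fps_expansion V 0) 4 = 15802 / 35 * z2 ^ 3 + 225 * z3 ^ 2"
  "fps_nth (fps_expansion V 0) 5 = 1200 * z2 ^ 2 * z3 + 1470 * z2 * z5 + 30135 / 4 * z7"
  "fps_nth (fps_expansion V 0) 6 = 1520548 / 175 * z2 ^ 4 + 1250 * z2 * z3 ^ 2 + 14000 * z3 * z5 + 154 * d53"
  "fps_nth (fps_expansion V 0) 7 = 158020 / 7 * z2 ^ 3 * z3 + 35280 * z2 ^ 2 * z5 + 39570 * z2 * z7 + 3750 * z3 ^ 3 + 635740 / 3 * z9"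
  unfolding z2_def z3_def z5_def z7_def z9_def d53_def
  using V_fps_nth_certificate[OF certificate_V_0] V_fps_nth_certificate[OF certificate_V_1]
    V_fps_nth_certificate[OF certificate_V_2] V_fps_nth_certificate[OF certificate_V_3]
    V_fps_nth_certificate[OF certificate_V_4] V_fps_nth_certificate[OF certificate_V_5]
    V_fps_nth_certificate[OF certificate_V_6] V_fps_nth_certificate[OF certificate_V_7]
  by (simp_all add: power2_eq_square power3_eq_cube power4_eq_xxxx algebra_simps add_divide_distrib)

end

section \<open>Taylor coefficients of \<open>P\<close>\<close>

definition log_coeff :: "nat \<Rightarrow> complex" where
  "log_coeff k = (if k = 0 then 0 else (- 1) ^ Suc k * mzc [Suc k] * (6 ^ Suc k + 9 - 3 ^ Suc k - 6 * 2 ^ Suc k))"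

lemma sums_mzv: "k \<ge> 2 \<Longrightarrow> (\<lambda>n. 1 / real (Suc n) ^ k) sums mzv [k]"
proof -
  assume k: "k \<ge> 2"
  have "(\<lambda>n. \<Sum>m<n. 1 / real m ^ k) = hsum [k]" by (simp add: fun_eq_iff)
  moreover have "hsum [k] \<longlonglongrightarrow> mzv [k]" using k by (intro hsum_tendsto_mzv) (simp add: admissible_def)
  ultimately have "(\<lambda>m. 1 / real m ^ k) sums mzv [k]" by (simp add: sums_def)
  thus ?thesis using k sums_Suc_iff[of "\<lambda>m. 1 / real m ^ k" "mzv [k]"] by (simp add: zero_power)
qed

lemma Polygamma_1_eq_mzv:
  assumes "k \<ge> 1"
  shows "Polygamma k (1 :: complex) = (- 1) ^ Suc k * fact k * mzc [Suc k]"
proof -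
  have "(\<lambda>n. inverse ((1 + of_nat n) ^ Suc k)) sums ((-1) ^ Suc k * Polygamma k (1 :: complex) / fact k)"
    by (rule Polygamma_LIMSEQ) (use assms in auto)
  moreover have "(\<lambda>n. inverse ((1 + of_nat n) ^ Suc k)) sums mzc [Suc k]"
    using sums_of_real[OF sums_mzv[of "Suc k"], where ?'a = complex] assms
    by (simp add: inverse_eq_divide of_real_divide add_ac)
  ultimately have "(-1) ^ Suc k * Polygamma k (1 :: complex) / fact k = mzc [Suc k]" by (rule sums_unique2)
  hence "(-1) ^ Suc k * Polygamma k (1 :: complex) = fact k * mzc [Suc k]" by (simp add: field_simps)
  hence "(-1) ^ Suc k * ((-1) ^ Suc k * Polygamma k (1 :: complex)) = (-1) ^ Suc k * fact k * mzc [Suc k]" by simp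
  thus ?thesis by (simp add: power_mult_distrib[symmetric] mult.assoc[symmetric] del: power_Suc)
qed

definition digamma_fps :: "complex fps" where
  "digamma_fps = Abs_fps (\<lambda>k. Polygamma k 1 / fact k)"

lemma has_fps_expansion_Digamma: "(\<lambda>z :: complex. Digamma (1 + c * z)) has_fps_expansion Abs_fps (\<lambda>k. c ^ k * fps_nth digamma_fps k)"
proof -
  have one: "(1 :: complex) \<notin> \<int>\<^sub>\<le>\<^sub>0" by simp
  have "Digamma analytic_on {1 :: complex}" by (rule analytic_on_Polygamma) simp
  hence "(\<lambda>z :: complex. Digamma (1 + z)) has_fps_expansion fps_expansion Digamma 1"
    by (rule analytic_at_imp_has_fps_expansion)
  moreover have "fps_expansion Digamma 1 = digamma_fps"
    unfolding fps_expansion_def digamma_fps_def by (simp add: higher_deriv_Polygamma)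
  ultimately have D: "(\<lambda>z :: complex. Digamma (1 + z)) has_fps_expansion digamma_fps" by simp
  have "(\<lambda>z :: complex. c * z) has_fps_expansion fps_const c * fps_X" by (intro fps_expansion_intros)
  from has_fps_expansion_compose[OF D this] show ?thesis by (simp add: o_def fps_compose_linear)
qed

definition log_deriv_P :: "complex \<Rightarrow> complex" where
  "log_deriv_P z = 6 * Digamma (1 + 6 * z) + 9 * Digamma (1 + 1 * z) - 3 * Digamma (1 + 3 * z) - 12 * Digamma (1 + 2 * z)"

text \<open>The constant term, where Digamma 1 would bring in Euler's constant, disappears because 6
  + 9 = 3 + 12. The higher Polygamma values at 1 are zeta values.\<close>

lemma has_fps_expansion_log_deriv_P: "log_deriv_P has_fps_expansion Abs_fps log_coeff"
proof -
  let ?D = "\<lambda>c. Abs_fps (\<lambda>k. c ^ k * fps_nth digamma_fps k)"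
  have "log_deriv_P has_fps_expansion fps_const 6 * ?D 6 + fps_const 9 * ?D 1 - fps_const 3 * ?D 3 - fps_const 12 * ?D 2"
    unfolding log_deriv_P_def[abs_def] by (intro fps_expansion_intros has_fps_expansion_Digamma)
  moreover have "fps_const 6 * ?D 6 + fps_const 9 * ?D 1 - fps_const 3 * ?D 3 - fps_const 12 * ?D 2 = Abs_fps log_coeff"
  proof (rule fps_ext)
    fix k
    show "fps_nth (fps_const 6 * ?D 6 + fps_const 9 * ?D 1 - fps_const 3 * ?D 3 - fps_const 12 * ?D 2) k = fps_nth (Abs_fps log_coeff) k"
      by (cases "k = 0") (simp_all add: log_coeff_def digamma_fps_def Polygamma_1_eq_mzv algebra_simps)
  qed
  ultimately show ?thesis by simp
qed

text \<open>Derivatives are kept in the form f * k, which passes to products, powers and quotients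
  by adding, multiplying and subtracting the k; the large quotient never has to be differentiated
  outright.\<close>

lemma P_logarithmic_derivative:
  assumes "norm z < 1 / 6"
  shows "deriv P z = P z * log_deriv_P z"
proof -
  define g where "g c w = Gamma (1 + c * w)" for c w :: complex
  define Q where "Q w = g 6 w * g 1 w ^ 9 / (g 3 w * g 2 w ^ 6)" for w
  have op: "open {w. Re w > - 1 / 6}" by (rule open_halfspace_Re_gt)
  have z: "Re z > - 1 / 6" using assms abs_Re_le_cmod[of z] by simp
  have Re: "Re (1 + c * z) > 0" if "c \<in> {1, 2, 3, 6}" for c using that z by auto
  have der: "(g c has_field_derivative g c z * (c * Digamma (1 + c * z))) (at z)"
    and nz: "g c z \<noteq> 0" if "c \<in> {1, 2, 3, 6}" for c
  proof -
    have n: "1 + c * z \<notin> \<int>\<^sub>\<le>\<^sub>0" using Re[OF that] by (rule Re_pos_notin_nonpos_Ints)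
    have "((\<lambda>w. Gamma (1 + c * w)) has_field_derivative Gamma (1 + c * z) * (c * Digamma (1 + c * z))) (at z)"
      by (rule derivative_eq_intros refl n | simp)+
    thus "(g c has_field_derivative g c z * (c * Digamma (1 + c * z))) (at z)" unfolding g_def .
    show "g c z \<noteq> 0" using n by (simp add: g_def Gamma_eq_zero_iff)
  qed
  have mult: "((\<lambda>w. a w * b w) has_field_derivative a z * b z * (k + l)) (at z)"
    if "(a has_field_derivative a z * k) (at z)" "(b has_field_derivative b z * l) (at z)" for a b k l
    using DERIV_mult[OF that] by (simp add: algebra_simps)
  have pow: "((\<lambda>w. a w ^ n) has_field_derivative a z ^ n * (of_nat n * k)) (at z)"
    if "(a has_field_derivative a z * k) (at z)" for a k n
  proof (induction n)
    case (Suc n)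
    from mult[OF that Suc] show ?case by (simp add: algebra_simps)
  qed simp
  have quot: "((\<lambda>w. a w / b w) has_field_derivative a z / b z * (k - l)) (at z)"
    if "(a has_field_derivative a z * k) (at z)" "(b has_field_derivative b z * l) (at z)" "b z \<noteq> 0" for a b k l
  proof -
    have eq: "(a z * k * b z - a z * (b z * l)) / (b z * b z) = a z / b z * (k - l)"
      using that(3) by (simp add: field_simps)
    show ?thesis using DERIV_divide[OF that] unfolding eq .
  qed
  have "(Q has_field_derivative Q z * (6 * Digamma (1 + 6 * z) + of_nat 9 * (1 * Digamma (1 + 1 * z))
      - (3 * Digamma (1 + 3 * z) + of_nat 6 * (2 * Digamma (1 + 2 * z))))) (at z)"
    unfolding Q_def by (intro quot mult pow der) (simp_all add: nz)
  hence "(Q has_field_derivative Q z * log_deriv_P z) (at z)"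
    by (simp add: log_deriv_P_def algebra_simps)
  moreover have "Q w = P w" if "w \<in> {w. Re w > - 1 / 6}" for w
    using P_eq_Gamma[of w] that by (simp add: Q_def g_def)
  ultimately have "(P has_field_derivative Q z * log_deriv_P z) (at z)"
    using has_field_derivative_transform_within_open[OF _ op] z by blast
  thus ?thesis using P_eq_Gamma[OF z] by (simp add: DERIV_imp_deriv Q_def g_def)
qed

lemma has_fps_expansion_P: "P has_fps_expansion fps_expansion P 0"
  by (rule has_fps_expansion_fps_expansion[OF _ _ P_holomorphic]) (auto intro!: open_Diff open_halfspace_Re_gt)

lemma has_fps_expansion_V: "V has_fps_expansion fps_expansion V 0"
  by (rule has_fps_expansion_fps_expansion[OF open_Diff[OF open_halfspace_Re_lt] _ V_holomorphic]) auto

lemma has_fps_expansion_S: "S has_fps_expansion fps_expansion S 0"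
  by (rule has_fps_expansion_fps_expansion[OF _ _ S_holomorphic]) (auto intro!: open_halfspace_Re_gt)

lemma eventually_norm_less_0: "e > 0 \<Longrightarrow> eventually (\<lambda>z :: complex. norm z < e) (nhds 0)"
  by (rule eventually_nhds_metric[THEN iffD2]) auto

text \<open>The equation P' = P * \<open>log_deriv_P\<close> read coefficientwise. It yields the
  coefficients one by one without composing with the exponential series.\<close>

lemma P_fps_rec: "of_nat (Suc n) * fps_nth (fps_expansion P 0) (Suc n) = (\<Sum>i=0..n. fps_nth (fps_expansion P 0) i * log_coeff (n - i))"
proof -
  have "(\<lambda>z. P z * log_deriv_P z) has_fps_expansion fps_expansion P 0 * Abs_fps log_coeff"
    by (intro fps_expansion_intros has_fps_expansion_P has_fps_expansion_log_deriv_P)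
  moreover have "eventually (\<lambda>z. deriv P z = P z * log_deriv_P z) (nhds 0)"
    using eventually_norm_less_0[of "1 / 6"] by (auto elim!: eventually_mono intro: P_logarithmic_derivative)
  ultimately have "deriv P has_fps_expansion fps_expansion P 0 * Abs_fps log_coeff"
    by (subst has_fps_expansion_cong) auto
  with has_fps_expansion_deriv[OF has_fps_expansion_P] have "fps_deriv (fps_expansion P 0) = fps_expansion P 0 * Abs_fps log_coeff"
    by (rule fps_expansion_unique_complex)
  hence "fps_nth (fps_deriv (fps_expansion P 0)) n = fps_nth (fps_expansion P 0 * Abs_fps log_coeff) n" by simp
  thus ?thesis by (simp add: fps_mult_nth)
qed

context
  fixes z2 z3 z5 z7 z9 :: complex
  defines "z2 \<equiv> mzc [2]" and "z3 \<equiv> mzc [3]" and "z5 \<equiv> mzc [5]" and "z7 \<equiv> mzc [7]" and "z9 \<equiv> mzc [9]"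
begin

lemma log_coeff_values:
  "log_coeff 0 = 0"
  "log_coeff 1 = 12 * z2"
  "log_coeff 2 = - 150 * z3"
  "log_coeff 3 = 2256 / 5 * z2 ^ 2"
  "log_coeff 4 = - 7350 * z5"
  "log_coeff 5 = 364416 / 35 * z2 ^ 3"
  "log_coeff 6 = - 276990 * z7"
  "log_coeff 7 = 40116672 / 175 * z2 ^ 4"
  "log_coeff 8 = - 10054950 * z9"
  using arg_cong[OF numeral_2_eq_2, of "\<lambda>k. mzv [k]"]
  by (simp_all add: log_coeff_def z2_def z3_def z5_def z7_def z9_def mzv_4_6_8)

lemma P_fps_values:
  "fps_nth (fps_expansion P 0) 0 = 1"
  "fps_nth (fps_expansion P 0) 1 = 0"
  "fps_nth (fps_expansion P 0) 2 = 6 * z2"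
  "fps_nth (fps_expansion P 0) 3 = - 50 * z3"
  "fps_nth (fps_expansion P 0) 4 = 654 / 5 * z2 ^ 2"
  "fps_nth (fps_expansion P 0) 5 = - 300 * z2 * z3 - 1470 * z5"
  "fps_nth (fps_expansion P 0) 6 = 85684 / 35 * z2 ^ 3 + 1250 * z3 ^ 2"
  "fps_nth (fps_expansion P 0) 7 = - 6540 * z2 ^ 2 * z3 - 8820 * z2 * z5 - 39570 * z7"
  "fps_nth (fps_expansion P 0) 8 = 1662954 / 35 * z2 ^ 4 + 7500 * z2 * z3 ^ 2 + 73500 * z3 * z5"
  "fps_nth (fps_expansion P 0) 9 = - 856840 / 7 * z2 ^ 3 * z3 - 192276 * z2 ^ 2 * z5 - 237420 * z2 * z7 - 62500 / 3 * z3 ^ 3 - 3351650 / 3 * z9"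
proof -
  let ?F = "fps_nth (fps_expansion P 0)"
  show f0: "?F 0 = 1" by (simp add: fps_expansion_def P_eq_Gamma)
  have "1 * ?F 1 = ?F 0 * log_coeff 0"
    using P_fps_rec[of 0] by (simp add: sum.atLeast0_atMost_Suc eval_nat_numeral)
  also have "\<dots> = 1 * (0)"
    unfolding f0 log_coeff_values
    by (simp add: field_simps power2_eq_square power3_eq_cube power4_eq_xxxx)
  finally show f1: "?F 1 = 0"
    by (rule mult_left_cancel[THEN iffD1, rotated]) simp
  have "2 * ?F 2 = ?F 0 * log_coeff 1 + ?F 1 * log_coeff 0"
    using P_fps_rec[of 1] by (simp add: sum.atLeast0_atMost_Suc eval_nat_numeral)
  also have "\<dots> = 2 * (6 * z2)"
    unfolding f0 f1 log_coeff_values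
    by (simp add: field_simps power2_eq_square power3_eq_cube power4_eq_xxxx)
  finally show f2: "?F 2 = 6 * z2"
    by (rule mult_left_cancel[THEN iffD1, rotated]) simp
  have "3 * ?F 3 = ?F 0 * log_coeff 2 + ?F 1 * log_coeff 1 + ?F 2 * log_coeff 0"
    using P_fps_rec[of 2] by (simp add: sum.atLeast0_atMost_Suc eval_nat_numeral)
  also have "\<dots> = 3 * (- 50 * z3)"
    unfolding f0 f1 f2 log_coeff_values
    by (simp add: field_simps power2_eq_square power3_eq_cube power4_eq_xxxx)
  finally show f3: "?F 3 = - 50 * z3"
    by (rule mult_left_cancel[THEN iffD1, rotated]) simp
  have "4 * ?F 4 = ?F 0 * log_coeff 3 + ?F 1 * log_coeff 2 + ?F 2 * log_coeff 1 + ?F 3 * log_coeff 0"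
    using P_fps_rec[of 3] by (simp add: sum.atLeast0_atMost_Suc eval_nat_numeral)
  also have "\<dots> = 4 * (654 / 5 * z2 ^ 2)"
    unfolding f0 f1 f2 f3 log_coeff_values
    by (simp add: field_simps power2_eq_square power3_eq_cube power4_eq_xxxx)
  finally show f4: "?F 4 = 654 / 5 * z2 ^ 2"
    by (rule mult_left_cancel[THEN iffD1, rotated]) simp
  have "5 * ?F 5 = ?F 0 * log_coeff 4 + ?F 1 * log_coeff 3 + ?F 2 * log_coeff 2 + ?F 3 * log_coeff 1 + ?F 4 * log_coeff 0"
    using P_fps_rec[of 4] by (simp add: sum.atLeast0_atMost_Suc eval_nat_numeral)
  also have "\<dots> = 5 * (- 300 * z2 * z3 - 1470 * z5)"
    unfolding f0 f1 f2 f3 f4 log_coeff_values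
    by (simp add: field_simps power2_eq_square power3_eq_cube power4_eq_xxxx)
  finally show f5: "?F 5 = - 300 * z2 * z3 - 1470 * z5"
    by (rule mult_left_cancel[THEN iffD1, rotated]) simp
  have "6 * ?F 6 = ?F 0 * log_coeff 5 + ?F 1 * log_coeff 4 + ?F 2 * log_coeff 3 + ?F 3 * log_coeff 2 + ?F 4 * log_coeff 1 + ?F 5 * log_coeff 0"
    using P_fps_rec[of 5] by (simp add: sum.atLeast0_atMost_Suc eval_nat_numeral)
  also have "\<dots> = 6 * (85684 / 35 * z2 ^ 3 + 1250 * z3 ^ 2)"
    unfolding f0 f1 f2 f3 f4 f5 log_coeff_values
    by (simp add: field_simps power2_eq_square power3_eq_cube power4_eq_xxxx)
  finally show f6: "?F 6 = 85684 / 35 * z2 ^ 3 + 1250 * z3 ^ 2"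
    by (rule mult_left_cancel[THEN iffD1, rotated]) simp
  have "7 * ?F 7 = ?F 0 * log_coeff 6 + ?F 1 * log_coeff 5 + ?F 2 * log_coeff 4 + ?F 3 * log_coeff 3 + ?F 4 * log_coeff 2 + ?F 5 * log_coeff 1 + ?F 6 * log_coeff 0"
    using P_fps_rec[of 6] by (simp add: sum.atLeast0_atMost_Suc eval_nat_numeral)
  also have "\<dots> = 7 * (- 6540 * z2 ^ 2 * z3 - 8820 * z2 * z5 - 39570 * z7)"
    unfolding f0 f1 f2 f3 f4 f5 f6 log_coeff_values
    by (simp add: field_simps power2_eq_square power3_eq_cube power4_eq_xxxx)
  finally show f7: "?F 7 = - 6540 * z2 ^ 2 * z3 - 8820 * z2 * z5 - 39570 * z7"
    by (rule mult_left_cancel[THEN iffD1, rotated]) simp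
  have "8 * ?F 8 = ?F 0 * log_coeff 7 + ?F 1 * log_coeff 6 + ?F 2 * log_coeff 5 + ?F 3 * log_coeff 4 + ?F 4 * log_coeff 3 + ?F 5 * log_coeff 2 + ?F 6 * log_coeff 1 + ?F 7 * log_coeff 0"
    using P_fps_rec[of 7] by (simp add: sum.atLeast0_atMost_Suc eval_nat_numeral)
  also have "\<dots> = 8 * (1662954 / 35 * z2 ^ 4 + 7500 * z2 * z3 ^ 2 + 73500 * z3 * z5)"
    unfolding f0 f1 f2 f3 f4 f5 f6 f7 log_coeff_values
    by (simp add: field_simps power2_eq_square power3_eq_cube power4_eq_xxxx)
  finally show f8: "?F 8 = 1662954 / 35 * z2 ^ 4 + 7500 * z2 * z3 ^ 2 + 73500 * z3 * z5"
    by (rule mult_left_cancel[THEN iffD1, rotated]) simp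
  have "9 * ?F 9 = ?F 0 * log_coeff 8 + ?F 1 * log_coeff 7 + ?F 2 * log_coeff 6 + ?F 3 * log_coeff 5 + ?F 4 * log_coeff 4 + ?F 5 * log_coeff 3 + ?F 6 * log_coeff 2 + ?F 7 * log_coeff 1 + ?F 8 * log_coeff 0"
    using P_fps_rec[of 8] by (simp add: sum.atLeast0_atMost_Suc eval_nat_numeral)
  also have "\<dots> = 9 * (- 856840 / 7 * z2 ^ 3 * z3 - 192276 * z2 ^ 2 * z5 - 237420 * z2 * z7 - 62500 / 3 * z3 ^ 3 - 3351650 / 3 * z9)"
    unfolding f0 f1 f2 f3 f4 f5 f6 f7 f8 log_coeff_values
    by (simp add: field_simps power2_eq_square power3_eq_cube power4_eq_xxxx)
  finally show f9: "?F 9 = - 856840 / 7 * z2 ^ 3 * z3 - 192276 * z2 ^ 2 * z5 - 237420 * z2 * z7 - 62500 / 3 * z3 ^ 3 - 3351650 / 3 * z9"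
    by (rule mult_left_cancel[THEN iffD1, rotated]) simp
qed

end

section \<open>Taylor coefficients of the trigonometric part\<close>

definition trig_u :: "complex fps" where
  "trig_u = 1 - fps_cos (2 * of_real pi)"

definition trig_d :: "complex fps" where
  "trig_d = 2 * fps_cos (2 * of_real pi) - 1"

text \<open>By 1 - cos(2 pi z) = 2 sin^2(pi z) this is the expansion of 9 pi^2 z^2 / sin^2(pi z),
  that is of the double pole term made regular by z^2.\<close>

definition trig_A :: "complex fps" where
  "trig_A = fps_const (18 * of_real pi ^ 2) * inverse (fps_shift 2 trig_u)"

definition trig_B :: "complex fps" where
  "trig_B = fps_const (18 * of_real pi ^ 2) * inverse trig_d"

context
  fixes y :: complex
  defines "y \<equiv> of_real pi ^ 2"
begin

lemma fps_cos_even: "fps_nth (fps_cos (2 * complex_of_real pi)) (2 * k) = (- 4 * y) ^ k / fact (2 * k)"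
proof -
  have "(2 * complex_of_real pi) ^ (2 * k) = (4 * y) ^ k"
    unfolding power_mult y_def power_mult_distrib[of 2 "complex_of_real pi"] by simp
  hence "(- 1) ^ k * (2 * complex_of_real pi) ^ (2 * k) = (- 1 * (4 * y)) ^ k"
    by (simp only: power_mult_distrib)
  moreover have "fps_nth (fps_cos (2 * complex_of_real pi)) (2 * k) = (- 1) ^ k * (2 * complex_of_real pi) ^ (2 * k) / fact (2 * k)"
    unfolding fps_cos_def fps_nth_Abs_fps of_nat_fact by simp
  ultimately show ?thesis by simp
qed

lemma fps_cos_odd: "fps_nth (fps_cos (2 * complex_of_real pi)) (Suc (2 * k)) = 0"
  by (simp add: fps_cos_def)

lemma fps_cos_values:
  "fps_nth (fps_cos (2 * complex_of_real pi)) 0 = 1"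
  "fps_nth (fps_cos (2 * complex_of_real pi)) 1 = 0"
  "fps_nth (fps_cos (2 * complex_of_real pi)) 2 = - 2 * y"
  "fps_nth (fps_cos (2 * complex_of_real pi)) 3 = 0"
  "fps_nth (fps_cos (2 * complex_of_real pi)) 4 = 2 / 3 * y ^ 2"
  "fps_nth (fps_cos (2 * complex_of_real pi)) 5 = 0"
  "fps_nth (fps_cos (2 * complex_of_real pi)) 6 = - 4 / 45 * y ^ 3"
  "fps_nth (fps_cos (2 * complex_of_real pi)) 7 = 0"
  "fps_nth (fps_cos (2 * complex_of_real pi)) 8 = 2 / 315 * y ^ 4"
  "fps_nth (fps_cos (2 * complex_of_real pi)) 9 = 0"
  "fps_nth (fps_cos (2 * complex_of_real pi)) 10 = - 4 / 14175 * y ^ 5"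
  "fps_nth (fps_cos (2 * complex_of_real pi)) 11 = 0"
  using fps_cos_even[of 0] fps_cos_even[of 1] fps_cos_even[of 2] fps_cos_even[of 3] fps_cos_even[of 4] fps_cos_even[of 5]
    fps_cos_odd[of 0] fps_cos_odd[of 1] fps_cos_odd[of 2] fps_cos_odd[of 3] fps_cos_odd[of 4] fps_cos_odd[of 5]
  by (simp_all add: fact_numeral power_mult_distrib)

lemma trig_u_values:
  "fps_nth (fps_shift 2 trig_u) 0 = 2 * y"
  "fps_nth (fps_shift 2 trig_u) 1 = 0"
  "fps_nth (fps_shift 2 trig_u) 2 = - 2 / 3 * y ^ 2"
  "fps_nth (fps_shift 2 trig_u) 3 = 0"
  "fps_nth (fps_shift 2 trig_u) 4 = 4 / 45 * y ^ 3"
  "fps_nth (fps_shift 2 trig_u) 5 = 0"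
  "fps_nth (fps_shift 2 trig_u) 6 = - 2 / 315 * y ^ 4"
  "fps_nth (fps_shift 2 trig_u) 7 = 0"
  "fps_nth (fps_shift 2 trig_u) 8 = 4 / 14175 * y ^ 5"
  "fps_nth (fps_shift 2 trig_u) 9 = 0"
  using fps_cos_values(3,4) by (simp_all add: trig_u_def fps_cos_values numeral_2_eq_2[symmetric] numeral_3_eq_3[symmetric])

lemma trig_d_values:
  "fps_nth trig_d 0 = 1"
  "fps_nth trig_d 1 = 0"
  "fps_nth trig_d 2 = - 4 * y"
  "fps_nth trig_d 3 = 0"
  "fps_nth trig_d 4 = 4 / 3 * y ^ 2"
  "fps_nth trig_d 5 = 0"
  "fps_nth trig_d 6 = - 8 / 45 * y ^ 3"
  "fps_nth trig_d 7 = 0"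
  by (simp_all add: trig_d_def fps_cos_values numeral_fps_const)

lemma y_nonzero: "y \<noteq> 0"
  by (simp add: y_def)

lemma trig_A_mult: "trig_A * fps_shift 2 trig_u = fps_const (18 * y)"
proof -
  have "inverse (fps_shift 2 trig_u) * fps_shift 2 trig_u = 1"
    by (rule inverse_mult_eq_1) (use trig_u_values(1) y_nonzero in simp)
  thus ?thesis by (simp add: trig_A_def y_def mult.assoc)
qed

lemma trig_B_mult: "trig_B * trig_d = fps_const (18 * y)"
proof -
  have "inverse trig_d * trig_d = 1"
    by (rule inverse_mult_eq_1) (use trig_d_values(1) in simp)
  thus ?thesis by (simp add: trig_B_def y_def mult.assoc)
qed


lemma trig_A_values:
  "fps_nth trig_A 0 = 9"
  "fps_nth trig_A 1 = 0"
  "fps_nth trig_A 2 = 3 * y"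
  "fps_nth trig_A 3 = 0"
  "fps_nth trig_A 4 = 3 / 5 * y ^ 2"
  "fps_nth trig_A 5 = 0"
  "fps_nth trig_A 6 = 2 / 21 * y ^ 3"
  "fps_nth trig_A 7 = 0"
  "fps_nth trig_A 8 = 1 / 75 * y ^ 4"
  "fps_nth trig_A 9 = 0"
proof -
  let ?F = "fps_nth trig_A" and ?U = "fps_nth (fps_shift 2 trig_u)"
  \<comment> \<open>Comparing coefficients in \<open>trig_A_mult\<close> gives a triangular system
    with the nonzero diagonal entry 2 * y.\<close>
  have rec: "(\<Sum>i=0..n. ?F i * ?U (n - i)) = fps_nth (fps_const (18 * y)) n" for n
    by (simp only: fps_mult_nth[symmetric] trig_A_mult)
  have "?F 0 * ?U 0 = 18 * y"
    using rec[of 0] by (simp add: sum.atLeast0_atMost_Suc eval_nat_numeral)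
  hence "2 * y * ?F 0 = 2 * y * (9)"
    unfolding  trig_u_values
    by algebra
  thus fA0: "?F 0 = 9"
    by (rule mult_left_cancel[THEN iffD1, rotated]) (simp add: y_nonzero)
  have "?F 0 * ?U 1 + ?F 1 * ?U 0 = 0"
    using rec[of 1] by (simp add: sum.atLeast0_atMost_Suc eval_nat_numeral)
  hence "2 * y * ?F 1 = 2 * y * (0)"
    unfolding fA0 trig_u_values
    by algebra
  thus fA1: "?F 1 = 0"
    by (rule mult_left_cancel[THEN iffD1, rotated]) (simp add: y_nonzero)
  have "?F 0 * ?U 2 + ?F 1 * ?U 1 + ?F 2 * ?U 0 = 0"
    using rec[of 2] by (simp add: sum.atLeast0_atMost_Suc eval_nat_numeral)
  hence "2 * y * ?F 2 = 2 * y * (3 * y)"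
    unfolding fA0 fA1 trig_u_values
    by algebra
  thus fA2: "?F 2 = 3 * y"
    by (rule mult_left_cancel[THEN iffD1, rotated]) (simp add: y_nonzero)
  have "?F 0 * ?U 3 + ?F 1 * ?U 2 + ?F 2 * ?U 1 + ?F 3 * ?U 0 = 0"
    using rec[of 3] by (simp add: sum.atLeast0_atMost_Suc eval_nat_numeral)
  hence "2 * y * ?F 3 = 2 * y * (0)"
    unfolding fA0 fA1 fA2 trig_u_values
    by algebra
  thus fA3: "?F 3 = 0"
    by (rule mult_left_cancel[THEN iffD1, rotated]) (simp add: y_nonzero)
  have "?F 0 * ?U 4 + ?F 1 * ?U 3 + ?F 2 * ?U 2 + ?F 3 * ?U 1 + ?F 4 * ?U 0 = 0"
    using rec[of 4] by (simp add: sum.atLeast0_atMost_Suc eval_nat_numeral)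
  hence "2 * y * ?F 4 = 2 * y * (3 / 5 * y ^ 2)"
    unfolding fA0 fA1 fA2 fA3 trig_u_values
    by algebra
  thus fA4: "?F 4 = 3 / 5 * y ^ 2"
    by (rule mult_left_cancel[THEN iffD1, rotated]) (simp add: y_nonzero)
  have "?F 0 * ?U 5 + ?F 1 * ?U 4 + ?F 2 * ?U 3 + ?F 3 * ?U 2 + ?F 4 * ?U 1 + ?F 5 * ?U 0 = 0"
    using rec[of 5] by (simp add: sum.atLeast0_atMost_Suc eval_nat_numeral)
  hence "2 * y * ?F 5 = 2 * y * (0)"
    unfolding fA0 fA1 fA2 fA3 fA4 trig_u_values
    by algebra
  thus fA5: "?F 5 = 0"
    by (rule mult_left_cancel[THEN iffD1, rotated]) (simp add: y_nonzero)
  have "?F 0 * ?U 6 + ?F 1 * ?U 5 + ?F 2 * ?U 4 + ?F 3 * ?U 3 + ?F 4 * ?U 2 + ?F 5 * ?U 1 + ?F 6 * ?U 0 = 0"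
    using rec[of 6] by (simp add: sum.atLeast0_atMost_Suc eval_nat_numeral)
  hence "2 * y * ?F 6 = 2 * y * (2 / 21 * y ^ 3)"
    unfolding fA0 fA1 fA2 fA3 fA4 fA5 trig_u_values
    by algebra
  thus fA6: "?F 6 = 2 / 21 * y ^ 3"
    by (rule mult_left_cancel[THEN iffD1, rotated]) (simp add: y_nonzero)
  have "?F 0 * ?U 7 + ?F 1 * ?U 6 + ?F 2 * ?U 5 + ?F 3 * ?U 4 + ?F 4 * ?U 3 + ?F 5 * ?U 2 + ?F 6 * ?U 1 + ?F 7 * ?U 0 = 0"
    using rec[of 7] by (simp add: sum.atLeast0_atMost_Suc eval_nat_numeral)
  hence "2 * y * ?F 7 = 2 * y * (0)"
    unfolding fA0 fA1 fA2 fA3 fA4 fA5 fA6 trig_u_values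
    by algebra
  thus fA7: "?F 7 = 0"
    by (rule mult_left_cancel[THEN iffD1, rotated]) (simp add: y_nonzero)
  have "?F 0 * ?U 8 + ?F 1 * ?U 7 + ?F 2 * ?U 6 + ?F 3 * ?U 5 + ?F 4 * ?U 4 + ?F 5 * ?U 3 + ?F 6 * ?U 2 + ?F 7 * ?U 1 + ?F 8 * ?U 0 = 0"
    using rec[of 8] by (simp add: sum.atLeast0_atMost_Suc eval_nat_numeral)
  hence "2 * y * ?F 8 = 2 * y * (1 / 75 * y ^ 4)"
    unfolding fA0 fA1 fA2 fA3 fA4 fA5 fA6 fA7 trig_u_values
    by algebra
  thus fA8: "?F 8 = 1 / 75 * y ^ 4"
    by (rule mult_left_cancel[THEN iffD1, rotated]) (simp add: y_nonzero)
  have "?F 0 * ?U 9 + ?F 1 * ?U 8 + ?F 2 * ?U 7 + ?F 3 * ?U 6 + ?F 4 * ?U 5 + ?F 5 * ?U 4 + ?F 6 * ?U 3 + ?F 7 * ?U 2 + ?F 8 * ?U 1 + ?F 9 * ?U 0 = 0"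
    using rec[of 9] by (simp add: sum.atLeast0_atMost_Suc eval_nat_numeral)
  hence "2 * y * ?F 9 = 2 * y * (0)"
    unfolding fA0 fA1 fA2 fA3 fA4 fA5 fA6 fA7 fA8 trig_u_values
    by algebra
  thus fA9: "?F 9 = 0"
    by (rule mult_left_cancel[THEN iffD1, rotated]) (simp add: y_nonzero)
qed

lemma trig_B_values:
  "fps_nth trig_B 0 = 18 * y"
  "fps_nth trig_B 1 = 0"
  "fps_nth trig_B 2 = 72 * y ^ 2"
  "fps_nth trig_B 3 = 0"
  "fps_nth trig_B 4 = 264 * y ^ 3"
  "fps_nth trig_B 5 = 0"
  "fps_nth trig_B 6 = 4816 / 5 * y ^ 4"
  "fps_nth trig_B 7 = 0"
proof -
  let ?F = "fps_nth trig_B" and ?U = "fps_nth (trig_d)"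
  have rec: "(\<Sum>i=0..n. ?F i * ?U (n - i)) = fps_nth (fps_const (18 * y)) n" for n
    by (simp only: fps_mult_nth[symmetric] trig_B_mult)
  have "?F 0 * ?U 0 = 18 * y"
    using rec[of 0] by (simp add: sum.atLeast0_atMost_Suc eval_nat_numeral)
  hence "1 * ?F 0 = 1 * (18 * y)"
    unfolding  trig_d_values
    by algebra
  thus fB0: "?F 0 = 18 * y"
    by (rule mult_left_cancel[THEN iffD1, rotated]) (simp add: y_nonzero)
  have "?F 0 * ?U 1 + ?F 1 * ?U 0 = 0"
    using rec[of 1] by (simp add: sum.atLeast0_atMost_Suc eval_nat_numeral)
  hence "1 * ?F 1 = 1 * (0)"
    unfolding fB0 trig_d_values
    by algebra
  thus fB1: "?F 1 = 0"
    by (rule mult_left_cancel[THEN iffD1, rotated]) (simp add: y_nonzero)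
  have "?F 0 * ?U 2 + ?F 1 * ?U 1 + ?F 2 * ?U 0 = 0"
    using rec[of 2] by (simp add: sum.atLeast0_atMost_Suc eval_nat_numeral)
  hence "1 * ?F 2 = 1 * (72 * y ^ 2)"
    unfolding fB0 fB1 trig_d_values
    by algebra
  thus fB2: "?F 2 = 72 * y ^ 2"
    by (rule mult_left_cancel[THEN iffD1, rotated]) (simp add: y_nonzero)
  have "?F 0 * ?U 3 + ?F 1 * ?U 2 + ?F 2 * ?U 1 + ?F 3 * ?U 0 = 0"
    using rec[of 3] by (simp add: sum.atLeast0_atMost_Suc eval_nat_numeral)
  hence "1 * ?F 3 = 1 * (0)"
    unfolding fB0 fB1 fB2 trig_d_values
    by algebra
  thus fB3: "?F 3 = 0"
    by (rule mult_left_cancel[THEN iffD1, rotated]) (simp add: y_nonzero)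
  have "?F 0 * ?U 4 + ?F 1 * ?U 3 + ?F 2 * ?U 2 + ?F 3 * ?U 1 + ?F 4 * ?U 0 = 0"
    using rec[of 4] by (simp add: sum.atLeast0_atMost_Suc eval_nat_numeral)
  hence "1 * ?F 4 = 1 * (264 * y ^ 3)"
    unfolding fB0 fB1 fB2 fB3 trig_d_values
    by algebra
  thus fB4: "?F 4 = 264 * y ^ 3"
    by (rule mult_left_cancel[THEN iffD1, rotated]) (simp add: y_nonzero)
  have "?F 0 * ?U 5 + ?F 1 * ?U 4 + ?F 2 * ?U 3 + ?F 3 * ?U 2 + ?F 4 * ?U 1 + ?F 5 * ?U 0 = 0"
    using rec[of 5] by (simp add: sum.atLeast0_atMost_Suc eval_nat_numeral)
  hence "1 * ?F 5 = 1 * (0)"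
    unfolding fB0 fB1 fB2 fB3 fB4 trig_d_values
    by algebra
  thus fB5: "?F 5 = 0"
    by (rule mult_left_cancel[THEN iffD1, rotated]) (simp add: y_nonzero)
  have "?F 0 * ?U 6 + ?F 1 * ?U 5 + ?F 2 * ?U 4 + ?F 3 * ?U 3 + ?F 4 * ?U 2 + ?F 5 * ?U 1 + ?F 6 * ?U 0 = 0"
    using rec[of 6] by (simp add: sum.atLeast0_atMost_Suc eval_nat_numeral)
  hence "1 * ?F 6 = 1 * (4816 / 5 * y ^ 4)"
    unfolding fB0 fB1 fB2 fB3 fB4 fB5 trig_d_values
    by algebra
  thus fB6: "?F 6 = 4816 / 5 * y ^ 4"
    by (rule mult_left_cancel[THEN iffD1, rotated]) (simp add: y_nonzero)
  have "?F 0 * ?U 7 + ?F 1 * ?U 6 + ?F 2 * ?U 5 + ?F 3 * ?U 4 + ?F 4 * ?U 3 + ?F 5 * ?U 2 + ?F 6 * ?U 1 + ?F 7 * ?U 0 = 0"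
    using rec[of 7] by (simp add: sum.atLeast0_atMost_Suc eval_nat_numeral)
  hence "1 * ?F 7 = 1 * (0)"
    unfolding fB0 fB1 fB2 fB3 fB4 fB5 fB6 trig_d_values
    by algebra
  thus fB7: "?F 7 = 0"
    by (rule mult_left_cancel[THEN iffD1, rotated]) (simp add: y_nonzero)
qed

end

text \<open>\<open>G\<close> and \<open>trig\<close> have poles at 0. Multiplication by z^2 and by
  both trigonometric denominators gives an identity between functions that are regular at 0, hence
  between power series, from which the nonzero series \<open>trig_u * trig_d\<close> is cancelled
  again.\<close>

lemma S_fps_equation:
  obtains c where "fps_X ^ 2 * fps_expansion S 0 =
    fps_X ^ 2 * (fps_const 48 * (fps_expansion P 0 * fps_expansion V 0)) + fps_const 9 * fps_expansion P 0
     - trig_A - fps_X ^ 2 * trig_B + fps_const c * fps_X ^ 2"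
proof -
  let ?FP = "fps_expansion P 0" and ?FV = "fps_expansion V 0" and ?FS = "fps_expansion S 0"
  define y where "y = complex_of_real pi ^ 2"
  define a where "a = 2 * complex_of_real pi"
  define u d where "u z = 1 - cos (a * z)" and "d z = 2 * cos (a * z) - 1" for z :: complex
  obtain c where c: "\<And>z. z \<noteq> 0 \<Longrightarrow> norm z < 1 / 6 \<Longrightarrow> S z = G z + trig z + c"
    using S_eq_G_plus_trig by blast
  have u: "u has_fps_expansion trig_u" and d: "d has_fps_expansion trig_d"
    unfolding u_def[abs_def] d_def[abs_def] trig_u_def trig_d_def a_def by (intro fps_expansion_intros)+
  have u': "trig_u = fps_X ^ 2 * fps_shift 2 trig_u"
  proof (rule fps_ext)
    fix n :: nat
    have "n = 0 \<or> n = 1 \<or> (\<exists>k. n = k + 2)" by presburger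
    thus "fps_nth trig_u n = fps_nth (fps_X ^ 2 * fps_shift 2 trig_u) n"
      using fps_cos_values(1,2) by (auto simp: fps_X_power_mult_nth trig_u_def)
  qed
  have Au: "trig_A * trig_u = fps_const (18 * y) * fps_X ^ 2"
    using trig_A_mult by (subst u') (simp add: y_def mult_ac)
  have Bd: "trig_B * trig_d = fps_const (18 * y)"
    using trig_B_mult by (simp add: y_def)
  have nz: "trig_u \<noteq> 0" "trig_d \<noteq> 0"
    using trig_u_values(1) trig_d_values(1) by auto
  have lhs: "(\<lambda>z. z ^ 2 * S z * (u z * d z)) has_fps_expansion fps_X ^ 2 * ?FS * (trig_u * trig_d)"
    by (intro fps_expansion_intros u d has_fps_expansion_S)
  have rhs: "(\<lambda>z. (z ^ 2 * (48 * (P z * V z)) + 9 * P z) * (u z * d z) - (18 * y) * z ^ 2 * d z - z ^ 2 * (18 * y * u z) + c * z ^ 2 * (u z * d z))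
     has_fps_expansion (fps_X ^ 2 * (fps_const 48 * (?FP * ?FV)) + fps_const 9 * ?FP) * (trig_u * trig_d)
        - fps_const (18 * y) * fps_X ^ 2 * trig_d - fps_X ^ 2 * (fps_const (18 * y) * trig_u) + fps_const c * fps_X ^ 2 * (trig_u * trig_d)"
    by (intro fps_expansion_intros u d has_fps_expansion_P has_fps_expansion_V)
  have "isCont d 0" unfolding d_def by (intro continuous_intros)
  hence "(d \<longlongrightarrow> d 0) (nhds 0)" by (simp add: isCont_def tendsto_at_iff_tendsto_nhds)
  hence ev: "eventually (\<lambda>z. d z \<noteq> 0) (nhds 0)"
    by (rule tendsto_imp_eventually_ne) (simp add: d_def)
  have eq: "z ^ 2 * S z * (u z * d z) = (z ^ 2 * (48 * (P z * V z)) + 9 * P z) * (u z * d z) - (18 * y) * z ^ 2 * d z - z ^ 2 * (18 * y * u z) + c * z ^ 2 * (u z * d z)"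
    if z: "d z \<noteq> 0" "norm z < 1 / 6" for z
  proof (cases "z = 0")
    case True
    thus ?thesis by (simp add: u_def)
  next
    case False
    have "sin (of_real pi * z) \<noteq> 0"
    proof
      assume "sin (of_real pi * z) = 0"
      then obtain n where "of_real pi * z = of_real (of_int n * pi)"
        by (auto simp: sin_eq_0)
      hence n: "z = of_int n" by simp
      hence "n \<noteq> 0" using False by auto
      hence "norm z \<ge> 1" using n by simp
      thus False using z by simp
    qed
    moreover have u2: "u z = 2 * sin (of_real pi * z) ^ 2"
      using cos_double_sin[of "of_real pi * z"] by (simp add: u_def a_def mult_ac)
    ultimately have nu: "u z \<noteq> 0" by simp
    have sin: "sin (of_real pi * z) ^ 2 = u z / 2" using u2 by simp
    have "trig z = - 18 * y / u z - 18 * y / d z"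
      unfolding trig_def sin by (simp add: d_def y_def a_def)
    hence S: "S z = P z * (48 * V z + 9 / z ^ 2) - 18 * y / u z - 18 * y / d z + c"
      using c[OF False z(2)] by (simp add: G_def)
    have id: "w * (p * (48 * v + 9 / w) - k / m - k / n + c) * (m * n)
        = (w * (48 * (p * v)) + 9 * p) * (m * n) - k * w * n - w * (k * m) + c * w * (m * n)"
      if "w \<noteq> 0" "m \<noteq> 0" "n \<noteq> 0" for w p v k m n :: complex
      using that by (simp add: field_simps)
    show ?thesis unfolding S using id[of "z ^ 2" "u z" "d z" "P z" "V z" "18 * y"] nu z(1) False by simp
  qed
  have "eventually (\<lambda>z. z ^ 2 * S z * (u z * d z) = (z ^ 2 * (48 * (P z * V z)) + 9 * P z) * (u z * d z) - (18 * y) * z ^ 2 * d z - z ^ 2 * (18 * y * u z) + c * z ^ 2 * (u z * d z)) (nhds 0)"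
    using eventually_conj[OF ev eventually_norm_less_0[of "1 / 6"]] by (rule eventually_mono) (auto intro: eq)
  with rhs have "(\<lambda>z. z ^ 2 * S z * (u z * d z)) has_fps_expansion
      (fps_X ^ 2 * (fps_const 48 * (?FP * ?FV)) + fps_const 9 * ?FP) * (trig_u * trig_d)
        - fps_const (18 * y) * fps_X ^ 2 * trig_d - fps_X ^ 2 * (fps_const (18 * y) * trig_u) + fps_const c * fps_X ^ 2 * (trig_u * trig_d)"
    by (subst has_fps_expansion_cong) auto
  with lhs have "fps_X ^ 2 * ?FS * (trig_u * trig_d) =
      (fps_X ^ 2 * (fps_const 48 * (?FP * ?FV)) + fps_const 9 * ?FP) * (trig_u * trig_d)
        - fps_const (18 * y) * fps_X ^ 2 * trig_d - fps_X ^ 2 * (fps_const (18 * y) * trig_u) + fps_const c * fps_X ^ 2 * (trig_u * trig_d)"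
    by (rule fps_expansion_unique_complex)
  also have "\<dots> = (fps_X ^ 2 * (fps_const 48 * (?FP * ?FV)) + fps_const 9 * ?FP - trig_A - fps_X ^ 2 * trig_B + fps_const c * fps_X ^ 2)
      * (trig_u * trig_d)"
    unfolding Au[symmetric] unfolding Bd[symmetric] by (simp add: algebra_simps)
  finally show ?thesis using nz that[of c] by simp
qed

text \<open>The undetermined constant affects the coefficient of order 0 only, hence m >= 1. The
  indices m + 2 come from the factor z^2.\<close>

lemma S_fps_nth:
  assumes "m \<ge> 1"
  shows "fps_nth (fps_expansion S 0) m =
    48 * (\<Sum>i=0..m. fps_nth (fps_expansion P 0) i * fps_nth (fps_expansion V 0) (m - i))
      + 9 * fps_nth (fps_expansion P 0) (m + 2) - fps_nth trig_A (m + 2) - fps_nth trig_B m"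
proof -
  obtain c where c: "fps_X ^ 2 * fps_expansion S 0 =
    fps_X ^ 2 * (fps_const 48 * (fps_expansion P 0 * fps_expansion V 0)) + fps_const 9 * fps_expansion P 0
     - trig_A - fps_X ^ 2 * trig_B + fps_const c * fps_X ^ 2"
    by (rule S_fps_equation)
  have X: "fps_nth (fps_X ^ 2 * F) (m + 2) = fps_nth F m" for F :: "complex fps"
    by (simp only: fps_X_power_mult_nth) simp
  have "fps_nth (fps_X ^ 2 :: complex fps) (m + 2) = 0"
    using assms by (simp only: fps_X_power_nth) simp
  with arg_cong[OF c, of "\<lambda>F. fps_nth F (m + 2)"] show ?thesis
    by (simp only: fps_sub_nth fps_add_nth X fps_mult_left_const_nth fps_mult_nth[of "fps_expansion P 0"] mult_zero_right add_0_right)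
qed

lemma pi_squared_eq_mzv: "pi\<^sup>2 = 6 * mzv [2]"
proof -
  have "mzv [2] = pi\<^sup>2 / 6"
    using sums_unique2[OF sums_mzv[of 2], of "pi\<^sup>2 / 6"] inverse_squares_sums by (simp add: add_ac)
  thus ?thesis by simp
qed

context
  fixes z2 z3 z5 z7 z9 d53 :: complex
  defines "z2 \<equiv> mzc [2]" and "z3 \<equiv> mzc [3]" and "z5 \<equiv> mzc [5]" and "z7 \<equiv> mzc [7]" and "z9 \<equiv> mzc [9]"
    and "d53 \<equiv> mzc [5, 3]"
begin

lemma pi_squared: "complex_of_real pi ^ 2 = 6 * z2"
  unfolding z2_def of_real_power[symmetric] pi_squared_eq_mzv by simp

lemma S_fps_values:
  "fps_nth (fps_expansion S 0) 1 = - 18 * z3"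
  "fps_nth (fps_expansion S 0) 2 = 18 / 5 * z2 ^ 2"
  "fps_nth (fps_expansion S 0) 3 = - 108 * z2 * z3 + 210 * z5"
  "fps_nth (fps_expansion S 0) 4 = - 5244 / 35 * z2 ^ 3 + 450 * z3 ^ 2"
  "fps_nth (fps_expansion S 0) 5 = - 11772 / 5 * z2 ^ 2 * z3 + 1260 * z2 * z5 + 5490 * z7"
  "fps_nth (fps_expansion S 0) 6 = - 189846 / 35 * z2 ^ 4 + 2700 * z2 * z3 ^ 2 + 26460 * z3 * z5 + 7392 * d53"
  "fps_nth (fps_expansion S 0) 7 = - 1542312 / 35 * z2 ^ 3 * z3 + 27468 * z2 ^ 2 * z5 + 32940 * z2 * z7 - 7500 * z3 ^ 3 + 116890 * z9"
proof -
  let ?P = "fps_nth (fps_expansion P 0)" and ?V = "fps_nth (fps_expansion V 0)"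
  have "fps_nth (fps_expansion S 0) 1 = 48 * (?P 0 * ?V 1 + ?P 1 * ?V 0) + 9 * ?P 3 - fps_nth trig_A 3 - fps_nth trig_B 1"
    using S_fps_nth[of 1] by (simp add: sum.atLeast0_atMost_Suc eval_nat_numeral)
  also have "\<dots> = - 18 * z3"
    unfolding P_fps_values[folded z2_def z3_def z5_def z7_def z9_def] V_fps_values[folded z2_def z3_def z5_def z7_def z9_def d53_def] trig_A_values trig_B_values pi_squared
    by (simp add: field_simps power2_eq_square power3_eq_cube power4_eq_xxxx)
  finally show "fps_nth (fps_expansion S 0) 1 = - 18 * z3" .
  have "fps_nth (fps_expansion S 0) 2 = 48 * (?P 0 * ?V 2 + ?P 1 * ?V 1 + ?P 2 * ?V 0) + 9 * ?P 4 - fps_nth trig_A 4 - fps_nth trig_B 2"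
    using S_fps_nth[of 2] by (simp add: sum.atLeast0_atMost_Suc eval_nat_numeral)
  also have "\<dots> = 18 / 5 * z2 ^ 2"
    unfolding P_fps_values[folded z2_def z3_def z5_def z7_def z9_def] V_fps_values[folded z2_def z3_def z5_def z7_def z9_def d53_def] trig_A_values trig_B_values pi_squared
    by (simp add: field_simps power2_eq_square power3_eq_cube power4_eq_xxxx)
  finally show "fps_nth (fps_expansion S 0) 2 = 18 / 5 * z2 ^ 2" .
  have "fps_nth (fps_expansion S 0) 3 = 48 * (?P 0 * ?V 3 + ?P 1 * ?V 2 + ?P 2 * ?V 1 + ?P 3 * ?V 0) + 9 * ?P 5 - fps_nth trig_A 5 - fps_nth trig_B 3"
    using S_fps_nth[of 3] by (simp add: sum.atLeast0_atMost_Suc eval_nat_numeral)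
  also have "\<dots> = - 108 * z2 * z3 + 210 * z5"
    unfolding P_fps_values[folded z2_def z3_def z5_def z7_def z9_def] V_fps_values[folded z2_def z3_def z5_def z7_def z9_def d53_def] trig_A_values trig_B_values pi_squared
    by (simp add: field_simps power2_eq_square power3_eq_cube power4_eq_xxxx)
  finally show "fps_nth (fps_expansion S 0) 3 = - 108 * z2 * z3 + 210 * z5" .
  have "fps_nth (fps_expansion S 0) 4 = 48 * (?P 0 * ?V 4 + ?P 1 * ?V 3 + ?P 2 * ?V 2 + ?P 3 * ?V 1 + ?P 4 * ?V 0) + 9 * ?P 6 - fps_nth trig_A 6 - fps_nth trig_B 4"
    using S_fps_nth[of 4] by (simp add: sum.atLeast0_atMost_Suc eval_nat_numeral)
  also have "\<dots> = - 5244 / 35 * z2 ^ 3 + 450 * z3 ^ 2"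
    unfolding P_fps_values[folded z2_def z3_def z5_def z7_def z9_def] V_fps_values[folded z2_def z3_def z5_def z7_def z9_def d53_def] trig_A_values trig_B_values pi_squared
    by (simp add: field_simps power2_eq_square power3_eq_cube power4_eq_xxxx)
  finally show "fps_nth (fps_expansion S 0) 4 = - 5244 / 35 * z2 ^ 3 + 450 * z3 ^ 2" .
  have "fps_nth (fps_expansion S 0) 5 = 48 * (?P 0 * ?V 5 + ?P 1 * ?V 4 + ?P 2 * ?V 3 + ?P 3 * ?V 2 + ?P 4 * ?V 1 + ?P 5 * ?V 0) + 9 * ?P 7 - fps_nth trig_A 7 - fps_nth trig_B 5"
    using S_fps_nth[of 5] by (simp add: sum.atLeast0_atMost_Suc eval_nat_numeral)
  also have "\<dots> = - 11772 / 5 * z2 ^ 2 * z3 + 1260 * z2 * z5 + 5490 * z7"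
    unfolding P_fps_values[folded z2_def z3_def z5_def z7_def z9_def] V_fps_values[folded z2_def z3_def z5_def z7_def z9_def d53_def] trig_A_values trig_B_values pi_squared
    by (simp add: field_simps power2_eq_square power3_eq_cube power4_eq_xxxx)
  finally show "fps_nth (fps_expansion S 0) 5 = - 11772 / 5 * z2 ^ 2 * z3 + 1260 * z2 * z5 + 5490 * z7" .
  have "fps_nth (fps_expansion S 0) 6 = 48 * (?P 0 * ?V 6 + ?P 1 * ?V 5 + ?P 2 * ?V 4 + ?P 3 * ?V 3 + ?P 4 * ?V 2 + ?P 5 * ?V 1 + ?P 6 * ?V 0) + 9 * ?P 8 - fps_nth trig_A 8 - fps_nth trig_B 6"
    using S_fps_nth[of 6] by (simp add: sum.atLeast0_atMost_Suc eval_nat_numeral)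
  also have "\<dots> = - 189846 / 35 * z2 ^ 4 + 2700 * z2 * z3 ^ 2 + 26460 * z3 * z5 + 7392 * d53"
    unfolding P_fps_values[folded z2_def z3_def z5_def z7_def z9_def] V_fps_values[folded z2_def z3_def z5_def z7_def z9_def d53_def] trig_A_values trig_B_values pi_squared
    by (simp add: field_simps power2_eq_square power3_eq_cube power4_eq_xxxx)
  finally show "fps_nth (fps_expansion S 0) 6 = - 189846 / 35 * z2 ^ 4 + 2700 * z2 * z3 ^ 2 + 26460 * z3 * z5 + 7392 * d53" .
  have "fps_nth (fps_expansion S 0) 7 = 48 * (?P 0 * ?V 7 + ?P 1 * ?V 6 + ?P 2 * ?V 5 + ?P 3 * ?V 4 + ?P 4 * ?V 3 + ?P 5 * ?V 2 + ?P 6 * ?V 1 + ?P 7 * ?V 0) + 9 * ?P 9 - fps_nth trig_A 9 - fps_nth trig_B 7"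
    using S_fps_nth[of 7] by (simp add: sum.atLeast0_atMost_Suc eval_nat_numeral)
  also have "\<dots> = - 1542312 / 35 * z2 ^ 3 * z3 + 27468 * z2 ^ 2 * z5 + 32940 * z2 * z7 - 7500 * z3 ^ 3 + 116890 * z9"
    unfolding P_fps_values[folded z2_def z3_def z5_def z7_def z9_def] V_fps_values[folded z2_def z3_def z5_def z7_def z9_def d53_def] trig_A_values trig_B_values pi_squared
    by (simp add: field_simps power2_eq_square power3_eq_cube power4_eq_xxxx)
  finally show "fps_nth (fps_expansion S 0) 7 = - 1542312 / 35 * z2 ^ 3 * z3 + 27468 * z2 ^ 2 * z5 + 32940 * z2 * z7 - 7500 * z3 ^ 3 + 116890 * z9" .
qed

end

section \<open>Summation of the derivatives\<close>

lemma zeta_eq_mzv: "k \<ge> 2 \<Longrightarrow> zeta (real k) = mzv [k]"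
  using sums_unique[OF sums_mzv[of k]] unfolding zeta_def by (simp add: powr_realpow del: of_nat_Suc)

text \<open>The sum over pairs is unordered. All terms being nonnegative, it can be taken row by
  row, with the truncated sums \<open>hsum [b] m\<close> as inner sums.\<close>

lemma double_zeta_eq_mzv:
  assumes "a \<ge> 2" "b \<ge> 1"
  shows "double_zeta a b = mzv [a, b]"
proof -
  define f where "f = (\<lambda>(m, j). 1 / (real m ^ a * real j ^ b))"
  have inner: "((\<lambda>j. f (m, j)) has_sum (hsum [b] m / real m ^ a)) {0<..<m}" for m
  proof (rule has_sum_finiteI)
    have "hsum [b] m = (\<Sum>j\<in>{0<..<m}. 1 / real j ^ b)"
      unfolding hsum.simps using assms(2) by (intro sum.mono_neutral_right) (auto simp: zero_power)
    thus "hsum [b] m / real m ^ a = sum (\<lambda>j. f (m, j)) {0<..<m}"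
      by (simp add: f_def sum_divide_distrib mult.commute)
  qed simp
  have "hsum [a, b] \<longlonglongrightarrow> mzv [a, b]"
    using assms by (intro hsum_tendsto_mzv) (simp add: admissible_def)
  moreover have "(\<lambda>n. \<Sum>m<n. hsum [b] m / real m ^ a) = hsum [a, b]" by (simp add: fun_eq_iff)
  ultimately have "(\<lambda>m. hsum [b] m / real m ^ a) sums mzv [a, b]" by (simp only: sums_def)
  hence outer: "((\<lambda>m. hsum [b] m / real m ^ a) has_sum mzv [a, b]) UNIV"
    by (rule sums_nonneg_imp_has_sum) (intro divide_nonneg_nonneg hsum_nonneg zero_le_power of_nat_0_le_iff)
  have "f summable_on Sigma UNIV (\<lambda>m. {0<..<m})"
    by (rule summable_on_SigmaI[OF inner has_sum_imp_summable[OF outer]]) (simp add: f_def)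
  from has_sum_SigmaI[OF inner outer this] have "(f has_sum mzv [a, b]) (Sigma UNIV (\<lambda>m. {0<..<m}))" .
  also have "Sigma UNIV (\<lambda>m. {0<..<m}) = {(k1, k2). 0 < k2 \<and> k2 < k1}" by auto
  finally show ?thesis unfolding double_zeta_def f_def by (rule infsumI)
qed

text \<open>Differentiation along the real axis agrees with complex differentiation of
  \<open>fc\<close>; taking the real part leads back to a real function at each step of the
  induction.\<close>

lemma f15_higher_deriv:
  assumes "x > 1 / 6"
  shows "(deriv ^^ m) f15 x = Re ((deriv ^^ m) fc (of_real x))"
  using assms
proof (induction m arbitrary: x)
  case 0
  show ?case using f15_eq_fc[OF 0] by (metis Re_complex_of_real funpow_0)
next
  case (Suc m)
  define h where "h = (deriv ^^ m) fc"
  have op: "open {z. Re z > 1 / 6}" by (rule open_halfspace_Re_gt)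
  have "h holomorphic_on {z. Re z > 1 / 6}"
    unfolding h_def by (rule holomorphic_higher_deriv[OF fc_holomorphic op])
  hence "(h has_field_derivative deriv h (of_real x)) (at (of_real x))"
    using Suc.prems by (intro holomorphic_derivI[OF _ op]) auto
  hence "((\<lambda>y. h (of_real y)) has_vector_derivative deriv h (of_real x)) (at x)"
    by (rule has_vector_derivative_real_field)
  hence "((\<lambda>y. Re (h (of_real y))) has_vector_derivative Re (deriv h (of_real x))) (at x)"
    by (rule bounded_linear.has_vector_derivative[OF bounded_linear_Re])
  hence der: "((\<lambda>y. Re (h (of_real y))) has_real_derivative Re (deriv h (of_real x))) (at x)"
    by (simp add: has_real_derivative_iff_has_vector_derivative)
  have "eventually (\<lambda>y. y > 1 / 6) (nhds x)"
    using Suc.prems by (rule eventually_nhds_in_open[OF open_greaterThan, simplified])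
  hence "eventually (\<lambda>y. (deriv ^^ m) f15 y = Re (h (of_real y))) (nhds x)"
    by eventually_elim (simp add: Suc.IH h_def)
  hence "deriv ((deriv ^^ m) f15) x = deriv (\<lambda>y. Re (h (of_real y))) x"
    by (rule deriv_cong_ev) simp
  thus ?case using DERIV_imp_deriv[OF der] by (simp add: h_def)
qed

lemma higher_deriv_sum_fc:
  assumes "Re z > - 3 / 4"
  shows "(deriv ^^ m) (\<lambda>z. \<Sum>k<N. fc (z + 1 + of_nat k)) z = (\<Sum>k<N. (deriv ^^ m) fc (z + 1 + of_nat k))"
proof (induction N)
  case 0
  have "(deriv ^^ m) (\<lambda>z. 0 :: complex) = (\<lambda>z. 0)" by (induction m) auto
  thus ?case by simp
next
  case (Suc N)
  have op: "open {z. Re z > - 3 / 4}" "open {z. Re z > 1 / 6}" by (rule open_halfspace_Re_gt)+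
  have sh: "(\<lambda>z. fc (z + 1 + of_nat N)) holomorphic_on {z. Re z > - 3 / 4}"
    by (intro holomorphic_on_compose_gen[OF _ fc_holomorphic, unfolded o_def] holomorphic_intros) auto
  have "(deriv ^^ m) (\<lambda>w. fc (1 * w + (1 + of_nat N))) z = 1 ^ m * (deriv ^^ m) fc (1 * z + (1 + of_nat N))"
    by (rule higher_deriv_compose_linear'[OF fc_holomorphic op]) (use assms in auto)
  hence 1: "(deriv ^^ m) (\<lambda>w. fc (w + 1 + of_nat N)) z = (deriv ^^ m) fc (z + 1 + of_nat N)"
    by (simp add: add.assoc)
  have "(deriv ^^ m) (\<lambda>z. (\<Sum>k<N. fc (z + 1 + of_nat k)) + fc (z + 1 + of_nat N)) z
      = (deriv ^^ m) (\<lambda>z. \<Sum>k<N. fc (z + 1 + of_nat k)) z + (deriv ^^ m) (\<lambda>z. fc (z + 1 + of_nat N)) z"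
    by (rule higher_deriv_add[OF fc_shift_holomorphic sh op(1)]) (use assms in auto)
  thus ?case using Suc 1 by simp
qed

text \<open>Uniform convergence near 0 lets \<open>S\<close> be differentiated termwise to any
  order, so its m-th derivative at 0 is the sum of the m-th derivatives of \<open>fc\<close> at 1,
  2, 3 and so on.\<close>

lemma f15_higher_deriv_sums:
  assumes "fps_nth (fps_expansion S 0) m = of_real v"
  shows "(\<lambda>k. (deriv ^^ m) f15 (real (Suc k))) sums (fact m * v)"
proof -
  have sub: "ball 0 (1 / 2) \<subseteq> {z :: complex. Re z > - 3 / 4}"
  proof
    fix z :: complex assume "z \<in> ball 0 (1 / 2)"
    thus "z \<in> {z. Re z > - 3 / 4}" using abs_Re_le_cmod[of z] by simp
  qed
  have "uniform_limit (ball 0 (1 / 2)) (\<lambda>N z. \<Sum>k<N. fc (z + 1 + of_nat k)) S sequentially"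
    by (rule S_uniform_limit) (use sub in force)+
  hence "(\<lambda>N. (deriv ^^ m) (\<lambda>z. \<Sum>k<N. fc (z + 1 + of_nat k)) 0) \<longlonglongrightarrow> (deriv ^^ m) S 0"
    by (rule higher_deriv_complex_uniform_limit)
      (auto intro!: always_eventually holomorphic_on_subset[OF fc_shift_holomorphic sub])
  hence "(\<lambda>N. \<Sum>k<N. (deriv ^^ m) fc (of_real (real (Suc k)))) \<longlonglongrightarrow> (deriv ^^ m) S 0"
    by (simp add: higher_deriv_sum_fc)
  hence "(\<lambda>N. Re (\<Sum>k<N. (deriv ^^ m) fc (of_real (real (Suc k))))) \<longlonglongrightarrow> Re ((deriv ^^ m) S 0)"
    by (rule tendsto_Re)
  moreover have "Re (\<Sum>k<N. (deriv ^^ m) fc (of_real (real (Suc k)))) = (\<Sum>k<N. (deriv ^^ m) f15 (real (Suc k)))" for N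
    unfolding Re_sum by (intro sum.cong refl f15_higher_deriv[symmetric]) simp
  moreover have "(deriv ^^ m) S 0 = of_real (fact m * v)"
    unfolding fps_nth_eq_deriv[OF has_fps_expansion_S] assms by simp
  ultimately show ?thesis unfolding sums_def by (simp only: Re_complex_of_real)
qed


theorem theorem1p17:
  shows "(\<forall>m\<in>{1..7}. summable (\<lambda>k. (deriv ^^ m) f15 (real (Suc k))))
    \<and> (\<Sum>k. deriv f15 (real (Suc k))) = - 18 * zeta 3
    \<and> (\<Sum>k. (deriv ^^ 2) f15 (real (Suc k))) = 18 * zeta 4
    \<and> (\<Sum>k. (deriv ^^ 3) f15 (real (Suc k))) = 36 * (35 * zeta 5 - 3 * pi\<^sup>2 * zeta 3)
    \<and> (\<Sum>k. (deriv ^^ 4) f15 (real (Suc k))) = 36 * (300 * (zeta 3)\<^sup>2 - 437 * zeta 6)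
    \<and> 1 / 2160 * (\<Sum>k. (deriv ^^ 5) f15 (real (Suc k)))
        = 305 * zeta 7 + 70 * zeta 2 * zeta 5 - 327 * zeta 3 * zeta 4
    \<and> 1 / 540 * (\<Sum>k. (deriv ^^ 6) f15 (real (Suc k)))
        = 600 * pi\<^sup>2 * (zeta 3)\<^sup>2 + 9856 * double_zeta 5 3 + 35280 * zeta 3 * zeta 5
          - 52735 * zeta 8
    \<and> 1 / 5040 * (\<Sum>k. (deriv ^^ 7) f15 (real (Suc k)))
        = 116890 * zeta 9 - 7500 * zeta 3 ^ 3 - 192789 * zeta 3 * zeta 6
          + 68670 * zeta 4 * zeta 5 + 32940 * zeta 2 * zeta 7"
proof -
  have S1: "(\<lambda>k. (deriv ^^ 1) f15 (real (Suc k))) sums (fact 1 * (- 18 * mzv [3]))"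
    by (rule f15_higher_deriv_sums) (simp add: S_fps_values[unfolded One_nat_def])
  have S2: "(\<lambda>k. (deriv ^^ 2) f15 (real (Suc k))) sums (fact 2 * (18 / 5 * mzv [2] ^ 2))"
    by (rule f15_higher_deriv_sums) (simp add: S_fps_values)
  have S3: "(\<lambda>k. (deriv ^^ 3) f15 (real (Suc k))) sums (fact 3 * (- 108 * mzv [2] * mzv [3] + 210 * mzv [5]))"
    by (rule f15_higher_deriv_sums) (simp add: S_fps_values)
  have S4: "(\<lambda>k. (deriv ^^ 4) f15 (real (Suc k))) sums (fact 4 * (- 5244 / 35 * mzv [2] ^ 3 + 450 * mzv [3] ^ 2))"
    by (rule f15_higher_deriv_sums) (simp add: S_fps_values)
  have S5: "(\<lambda>k. (deriv ^^ 5) f15 (real (Suc k))) sums (fact 5 * (- 11772 / 5 * mzv [2] ^ 2 * mzv [3] + 1260 * mzv [2] * mzv [5] + 5490 * mzv [7]))"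
    by (rule f15_higher_deriv_sums) (simp add: S_fps_values)
  have S6: "(\<lambda>k. (deriv ^^ 6) f15 (real (Suc k))) sums (fact 6 * (- 189846 / 35 * mzv [2] ^ 4 + 2700 * mzv [2] * mzv [3] ^ 2 + 26460 * mzv [3] * mzv [5] + 7392 * mzv [5, 3]))"
    by (rule f15_higher_deriv_sums) (simp add: S_fps_values)
  have S7: "(\<lambda>k. (deriv ^^ 7) f15 (real (Suc k))) sums (fact 7 * (- 1542312 / 35 * mzv [2] ^ 3 * mzv [3] + 27468 * mzv [2] ^ 2 * mzv [5] + 32940 * mzv [2] * mzv [7] - 7500 * mzv [3] ^ 3 + 116890 * mzv [9]))"
    by (rule f15_higher_deriv_sums) (simp add: S_fps_values)
  \<comment> \<open>After this substitution every claim is a polynomial identity in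
    \<open>mzv [2]\<close>, \<open>mzv [3]\<close>, \<open>mzv [5]\<close>, \<open>mzv [7]\<close>,
    \<open>mzv [9]\<close> and \<open>mzv [5, 3]\<close>.\<close>
  have z: "zeta 2 = mzv [2]" "zeta 3 = mzv [3]" "zeta 4 = 2 / 5 * mzv [2] ^ 2" "zeta 5 = mzv [5]"
    "zeta 6 = 8 / 35 * mzv [2] ^ 3" "zeta 7 = mzv [7]" "zeta 8 = 24 / 175 * mzv [2] ^ 4" "zeta 9 = mzv [9]"
    using zeta_eq_mzv[of 2] zeta_eq_mzv[of 3] zeta_eq_mzv[of 4] zeta_eq_mzv[of 5] zeta_eq_mzv[of 6]
      zeta_eq_mzv[of 7] zeta_eq_mzv[of 8] zeta_eq_mzv[of 9] by (simp_all add: mzv_4_6_8)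
  have d: "double_zeta 5 3 = mzv [5, 3]" by (rule double_zeta_eq_mzv) auto
  have "summable (\<lambda>k. (deriv ^^ m) f15 (real (Suc k)))" if "m \<in> {1..7}" for m
  proof -
    have "m = 1 \<or> m = 2 \<or> m = 3 \<or> m = 4 \<or> m = 5 \<or> m = 6 \<or> m = 7" using that by auto
    thus ?thesis
      using S1 S2 S3 S4 S5 S6 S7 by (elim disjE) (simp_all only: sums_summable)
  qed
  hence sm: "\<forall>m\<in>{1..7}. summable (\<lambda>k. (deriv ^^ m) f15 (real (Suc k)))" by blast
  have S1': "(\<lambda>k. deriv f15 (real (Suc k))) sums (fact 1 * (- 18 * mzv [3]))" using S1 by simp
  note eqs = sums_unique[OF S1', symmetric]
    sums_unique[OF S2, symmetric]
    sums_unique[OF S3, symmetric]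
    sums_unique[OF S4, symmetric]
    sums_unique[OF S5, symmetric]
    sums_unique[OF S6, symmetric]
    sums_unique[OF S7, symmetric]
  show ?thesis
    by (intro conjI, fact sm)
      (simp only: z d pi_squared_eq_mzv eqs, simp add: fact_numeral field_simps power2_eq_square power3_eq_cube power4_eq_xxxx)+
qed

end
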